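(* Let $\boldsymbol{\gamma}\in\mathcal{P}_2(\mathcal{C}^2)$ and let $\boldsymbol{\mu}^*$ be a minimizer for the generalized $H(\mathrm{div})$ geodesic problem with coupling $\boldsymbol{\gamma}$ such that $\mathcal{A}(\boldsymbol{\mu}^* )<+\infty$. Then there exists $P\in B_0^*$ such that $$\langle P,\rho^{\boldsymbol{\nu}}-1\rangle\le\mathcal{A}(\boldsymbol{\nu})-\mathcal{A}(\boldsymbol{\mu}^* )$$ for all generalized almost diffeomorphisms $\boldsymbol{\nu}$ satisfying the homogeneous coupling constraint with respect to $\boldsymbol{\gamma}$.
   Context: Setting. $M$ is the closure of a bounded open subset of $\mathbb{R}^d$ with Lipschitz boundary, $\rho_0$ is the Lebesgue measure on $M$ normalized so that $\rho_0(M)=1$, and $T>0$ is fixed. $\mathcal{C}=(M\times\mathbb{R}_{\ge0})/(M\times\{0\})$ is the cone over $M$, with points $[x,r]$ and apex $o=[x,0]$. Fix $\bar x\in M$; $\pi_x([x,r])=x$ if $r>0$, $\pi_x(o)=\bar x$, $\pi_r([x,r])=r$. The cone carries the metric tensor $g_{\mathcal{C}}=r^2g+\mathrm{d}r^2$ on $M\times\mathbb{R}_{>0}$ ($g$ Euclidean) and the distance $d_{\mathcal{C}}([x_1,r_1],[x_2,r_2])^2=r_1^2+r_2^2-2r_1r_2\cos(\min(|x_1-x_2|,\pi))$. $\Omega=C^0([0,T];\mathcal{C})$ is the space of continuous paths $\mathrm{z}:t\mapsto z_t=[x_t,r_t]$, with $x_t=\pi_x(z_t)$, $r_t=\pi_r(z_t)$.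 $AC^2([0,T];\mathcal{C})$ is the set of absolutely continuous paths whose metric derivative is in $L^2$; for such paths $|\dot z_t|^2_{g_{\mathcal{C}}}=r_t^2|\dot x_t|^2+\dot r_t^2$ where $r_t>0$ and the derivatives exist, and $0$ otherwise. $\mathcal{A}(\mathrm{z})=\int_0^T|\dot z_t|^2_{g_{\mathcal{C}}}\mathrm{d}t$ if $\mathrm{z}\in AC^2([0,T];\mathcal{C})$, $+\infty$ otherwise; $\mathcal{A}(\boldsymbol{\mu})=\int_\Omega\mathcal{A}(\mathrm{z})\,\mathrm{d}\boldsymbol{\mu}(\mathrm{z})$. A function $f:\mathcal{C}^2\to\mathbb{R}$ is 2-homogeneous if $f([x_1,\lambda r_1],[x_2,\lambda r_2])=\lambda^2f([x_1,r_1],[x_2,r_2])$ for all $\lambda>0$. Generalized $H(\mathrm{div})$ geodesic problem: given $\boldsymbol{\gamma}\in\mathcal{P}_2(\mathcal{C}^2)$ (Borel probability measures with finite second moment), minimize $\mathcal{A}(\boldsymbol{\mu})$ among dynamic plans $\boldsymbol{\mu}\in\mathcal{P}(\Omega)$ satisfying the homogeneous coupling constraint $\int_\Omega f(z_0,z_T)\,\mathrm{d}\boldsymbol{\mu}=\int_{\mathcal{C}^2}f\,\mathrm{d}\boldsymbol{\gamma}$ for all 2-homogeneous continuous $f:\mathcal{C}^2\to\mathbb{R}$, and the homogeneous marginal constraint $\int_\Omega\int_0^Tf(t,x_t)r_t^2\,\mathrm{d}t\,\mathrm{d}\boldsymbol{\mu}=\int_M\int_0^Tf(t,x)\,\mathrm{d}t\,\mathrm{d}\rho_0$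 for all $f\in C^0([0,T]\times M)$. For $\boldsymbol{\nu}\in\mathcal{P}(\Omega)$ and $t\in[0,T]$, $\mathfrak{h}^2_t(\boldsymbol{\nu})$ is the measure on $M$ defined by $\int_Mf\,\mathrm{d}\mathfrak{h}^2_t(\boldsymbol{\nu})=\int_\Omega f(x_t)r_t^2\,\mathrm{d}\boldsymbol{\nu}(\mathrm{z})$, and $\rho^{\boldsymbol{\nu}}(t,\cdot):=\mathrm{d}\mathfrak{h}_t^2(\boldsymbol{\nu})/\mathrm{d}\rho_0$ denotes its density. $C^{0,1}([0,T]\times M)$ is the space of Lipschitz functions with norm $\|f\|_{C^{0,1}}=\|f\|_{C^0}+|f|_{C^{0,1}}$, $|f|_{C^{0,1}}$ being the Lipschitz constant. A generalized almost diffeomorphism is a $\boldsymbol{\nu}\in\mathcal{P}(\Omega)$ such that $\rho^{\boldsymbol{\nu}}\in C^{0,1}([0,T]\times M)$ and $\|\rho^{\boldsymbol{\nu}}-1\|_{C^{0,1}}\le\frac12$. $B_0:=\{\rho\in C^{0,1}([0,T]\times M):\rho(0,\cdot)=\rho(T,\cdot)=0\}$, a Banach space with the $C^{0,1}$ norm, and $B_0^*$ is its topological dual, with pairing $\langle\cdot,\cdot\rangle$. *)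

theory Defs
  imports "HOL-Probability.Probability"
begin

subsection \<open>The cone over a metric space\<close>

text \<open>Quotient of \<open>X \<times> [0,\<infinity>)\<close> collapsing \<open>X \<times> {0}\<close> to the apex, for a whole type \<open>X\<close>; the cone
  over a subset \<open>M\<close> is the subset \<open>cone_over M\<close> below.\<close>

definition cone_rel :: "'a \<times> real \<Rightarrow> 'a \<times> real \<Rightarrow> bool" where
  "cone_rel p q \<longleftrightarrow> 0 \<le> snd p \<and> 0 \<le> snd q \<and> (p = q \<or> (snd p = 0 \<and> snd q = 0))"

quotient_type 'a cone = "'a \<times> real" / partial: cone_rel
proof (rule part_equivpI)
  show "\<exists>x::'a \<times> real. cone_rel x x"
    by (rule exI[of _ "(undefined, 0)"]) (simp add: cone_rel_def)
  show "symp (cone_rel :: 'a \<times> real \<Rightarrow> _)"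
    by (auto simp: symp_def cone_rel_def)
  show "transp (cone_rel :: 'a \<times> real \<Rightarrow> _)"
    by (auto simp: transp_def cone_rel_def)
qed

text \<open>\<open>cone_point x r\<close> is \<open>[x,r]\<close>; only used with \<open>r \<ge> 0\<close>, the \<open>max\<close> makes it total.\<close>

lift_definition cone_point :: "'a \<Rightarrow> real \<Rightarrow> 'a cone" is "\<lambda>x r. (x, max r 0)"
  by (simp add: cone_rel_def)

lift_definition pi_r :: "'a cone \<Rightarrow> real" is "snd"
  by (auto simp: cone_rel_def)

lift_definition pi_x :: "'a \<Rightarrow> 'a cone \<Rightarrow> 'a" is "\<lambda>xbar p. if snd p > 0 then fst p else xbar"
  by (auto simp: cone_rel_def)

definition cone_over :: "'a set \<Rightarrow> 'a cone set" where
  "cone_over M = {cone_point x r | x r. x \<in> M \<and> 0 \<le> r}"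

definition apex :: "'a cone" where
  "apex = cone_point undefined 0"

lemma cone_point_0: "cone_point x 0 = apex"
  unfolding apex_def by transfer (simp add: cone_rel_def)

lemma pi_r_cone_point: "0 \<le> r \<Longrightarrow> pi_r (cone_point x r) = r"
  by transfer simp

lemma pi_x_cone_point: "0 < r \<Longrightarrow> pi_x xbar (cone_point x r) = x"
  by transfer simp

lemma pi_x_apex: "pi_x xbar apex = xbar"
  unfolding apex_def by transfer simp

lemma cone_point_eq_iff:
  "0 \<le> r \<Longrightarrow> 0 \<le> s \<Longrightarrow> cone_point x r = cone_point y s \<longleftrightarrow> r = s \<and> (x = y \<or> r = 0)"
  by transfer (auto simp: cone_rel_def)

lemma cone_cases: obtains x r where "0 \<le> r" "c = cone_point x r"
proof -
  have "\<exists>x r. 0 \<le> r \<and> c = cone_point x r"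
  proof transfer
    fix c :: "'a \<times> real" assume "cone_rel c c"
    then show "\<exists>x r. 0 \<le> r \<and> cone_rel c (x, max r 0)"
      by (intro exI[of _ "fst c"] exI[of _ "snd c"]) (auto simp: cone_rel_def)
  qed
  with that show ?thesis by blast
qed

subsection \<open>The cone distance\<close>

definition planar_dist :: "real \<Rightarrow> real \<Rightarrow> real \<Rightarrow> real" where
  "planar_dist r s \<theta> = sqrt (r\<^sup>2 + s\<^sup>2 - 2 * r * s * cos \<theta>)"

lemma planar_dist_cis: "planar_dist r s (b - a) = dist (of_real r * cis a) (of_real s * cis b)"
proof -
  have "(dist (of_real r * cis a) (of_real s * cis b))\<^sup>2
      = (r * cos a - s * cos b)\<^sup>2 + (r * sin a - s * sin b)\<^sup>2"
    by (simp add: dist_norm cmod_power2)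
  also have "\<dots> = r\<^sup>2 * ((cos a)\<^sup>2 + (sin a)\<^sup>2) + s\<^sup>2 * ((cos b)\<^sup>2 + (sin b)\<^sup>2)
      - 2 * r * s * (cos b * cos a + sin b * sin a)"
    by algebra
  also have "\<dots> = r\<^sup>2 + s\<^sup>2 - 2 * r * s * cos (b - a)"
    by (simp add: cos_diff)
  finally show ?thesis
    unfolding planar_dist_def by (metis real_sqrt_unique zero_le_dist)
qed

lemma planar_dist_triangle: "planar_dist r t (a + b) \<le> planar_dist r s a + planar_dist s t b"
  using planar_dist_cis[of r t "a + b" 0] planar_dist_cis[of r s a 0]
    planar_dist_cis[of s t "a + b" a]
    dist_triangle[of "of_real r * cis 0" "of_real t * cis (a + b)" "of_real s * cis a"]
  by simp

lemma planar_dist_mono: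
  assumes "0 \<le> r" "0 \<le> s" "0 \<le> a" "a \<le> b" "b \<le> pi"
  shows "planar_dist r s a \<le> planar_dist r s b"
proof -
  have "cos b \<le> cos a" using assms by (intro cos_monotone_0_pi_le) auto
  then have "2 * r * s * cos b \<le> 2 * r * s * cos a" using assms by (intro mult_left_mono) auto
  then show ?thesis unfolding planar_dist_def by simp
qed

lemma planar_dist_eq_0:
  assumes "0 \<le> r" "0 \<le> s" "0 \<le> a" "a \<le> pi" "planar_dist r s a = 0"
  shows "r = s \<and> (a = 0 \<or> r = 0)"
proof -
  have le: "planar_dist r s 0 \<le> 0" using planar_dist_mono[of r s 0 a] assms by auto
  have "planar_dist r s 0 = \<bar>r - s\<bar>"
    unfolding planar_dist_def
    by (simp add: power2_diff flip: real_sqrt_abs)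
  with le have rs: "r = s" by simp
  have "r\<^sup>2 + s\<^sup>2 - 2 * r * s * cos a = 0" using assms(5) by (simp add: planar_dist_def)
  then have "2 * r\<^sup>2 * (1 - cos a) = 0" using rs by (simp add: power2_eq_square algebra_simps)
  then have "r = 0 \<or> cos a = cos 0" by auto
  with assms have "r = 0 \<or> a = 0" using cos_inj_pi[of a 0] by auto
  with rs show ?thesis by auto
qed

lift_definition cone_dist :: "'a::metric_space cone \<Rightarrow> 'a cone \<Rightarrow> real" is
  "\<lambda>p q. sqrt ((snd p)\<^sup>2 + (snd q)\<^sup>2 - 2 * snd p * snd q * cos (min (dist (fst p) (fst q)) pi))"
  by (auto simp: cone_rel_def)

lemma cone_dist_cone_point:
  "0 \<le> r \<Longrightarrow> 0 \<le> s \<Longrightarrow>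
    cone_dist (cone_point x r) (cone_point y s) = planar_dist r s (min (dist x y) pi)"
  unfolding planar_dist_def by transfer simp

instantiation cone :: (metric_space) metric_space
begin

definition dist_cone :: "'a cone \<Rightarrow> 'a cone \<Rightarrow> real" where
  "dist_cone = cone_dist"

definition uniformity_cone :: "('a cone \<times> 'a cone) filter" where
  "uniformity_cone = (INF e\<in>{0<..}. principal {(x, y). dist x y < e})"

definition open_cone :: "'a cone set \<Rightarrow> bool" where
  "open_cone U \<longleftrightarrow> (\<forall>x\<in>U. eventually (\<lambda>(x', y). x' = x \<longrightarrow> y \<in> U) uniformity)"

instance
proof
  fix c d :: "'a cone"
  obtain x r where c: "0 \<le> r" "c = cone_point x r" by (rule cone_cases)
  obtain y s where d: "0 \<le> s" "d = cone_point y s" by (rule cone_cases)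
  have e: "dist c d = planar_dist r s (min (dist x y) pi)"
    using c d by (simp add: dist_cone_def cone_dist_cone_point)
  show "dist c d = 0 \<longleftrightarrow> c = d"
  proof
    assume "dist c d = 0"
    then have "r = s \<and> (min (dist x y) pi = 0 \<or> r = 0)"
      using e c d by (intro planar_dist_eq_0) auto
    then have "r = s \<and> (x = y \<or> r = 0)" using pi_gt_zero by (auto simp: min_def split: if_splits)
    then show "c = d" unfolding c(2) d(2) by (rule cone_point_eq_iff[OF c(1) d(1), THEN iffD2])
  next
    assume "c = d"
    then have "r = s \<and> (x = y \<or> r = 0)"
      unfolding c(2) d(2) by (rule cone_point_eq_iff[OF c(1) d(1), THEN iffD1])
    then show "dist c d = 0" unfolding e planar_dist_def
      by (auto simp: power2_eq_square)
  qed
next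
  fix c d f :: "'a cone"
  obtain x r where c: "0 \<le> r" "c = cone_point x r" by (rule cone_cases)
  obtain y s where d: "0 \<le> s" "d = cone_point y s" by (rule cone_cases)
  obtain z t where f: "0 \<le> t" "f = cone_point z t" by (rule cone_cases)
  define A B C where "A = min (dist x z) pi" and "B = min (dist z y) pi" and "C = min (dist x y) pi"
  have nn: "0 \<le> A" "0 \<le> B" "0 \<le> C" "A \<le> pi" "B \<le> pi" "C \<le> pi" by (auto simp: A_def B_def C_def)
  have CAB: "C \<le> A + B"
    using dist_triangle[of x y z] zero_le_dist[of x z] zero_le_dist[of z y] pi_ge_zero
    unfolding A_def B_def C_def min_def by (smt (verit))
  have sym: "planar_dist s t B = planar_dist t s B"
    by (simp add: planar_dist_def algebra_simps)
  have "planar_dist r s C \<le> planar_dist r t A + planar_dist t s B"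
  proof (cases "A + B \<le> pi")
    case True
    have "planar_dist r s C \<le> planar_dist r s (A + B)"
      using planar_dist_mono c d nn CAB True by auto
    also have "\<dots> \<le> planar_dist r t A + planar_dist t s B" by (rule planar_dist_triangle)
    finally show ?thesis .
  next
    case False
    have "planar_dist r s C \<le> planar_dist r s (A + (pi - A))"
      using planar_dist_mono[of r s C pi] c d nn by auto
    also have "\<dots> \<le> planar_dist r t A + planar_dist t s (pi - A)" by (rule planar_dist_triangle)
    also have "planar_dist t s (pi - A) \<le> planar_dist t s B"
      using False nn d f by (intro planar_dist_mono) auto
    finally show ?thesis by simp
  qed
  then have "planar_dist r s C \<le> planar_dist r t A + planar_dist s t B" using sym by simp
  then show "dist c d \<le> dist c f + dist d f"
    using c d f by (simp add: dist_cone_def cone_dist_cone_point A_def B_def C_def dist_commute)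
qed (simp_all add: uniformity_cone_def open_cone_def)

end

subsection \<open>The domain\<close>

text \<open>Near each boundary point \<open>U\<close> is, in suitable orthonormal coordinates, the strict epigraph of a
  Lipschitz function; \<open>e\<close> is the vertical direction and \<open>x - (x \<bullet> e) *\<^sub>R e\<close> are the horizontal
  coordinates.\<close>

definition lipschitz_boundary :: "'a::euclidean_space set \<Rightarrow> bool" where
  "lipschitz_boundary U \<longleftrightarrow>
     (\<forall>p\<in>frontier U. \<exists>e \<phi> L \<delta>. norm e = 1 \<and> 0 < \<delta> \<and> L-lipschitz_on {y. y \<bullet> e = 0} \<phi> \<and>
        U \<inter> ball p \<delta> = {x \<in> ball p \<delta>. \<phi> (x - (x \<bullet> e) *\<^sub>R e) < x \<bullet> e})"

definition rho0 :: "'a::euclidean_space set \<Rightarrow> 'a measure" where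
  "rho0 M = uniform_measure lborel M"

subsection \<open>Path space and action\<close>

text \<open>Continuous paths \<open>[0,T] \<rightarrow> cone_over M\<close> with the supremum distance; paths are \<open>undefined\<close>
  outside \<open>[0,T]\<close>.\<close>

definition path_metric :: "real \<Rightarrow> 'a::metric_space set \<Rightarrow> (real \<Rightarrow> 'a cone) metric" where
  "path_metric T M =
     cfunspace (top_of_set {0..T}) (submetric euclidean_metric (cone_over M))"

abbreviation Omega :: "real \<Rightarrow> 'a::metric_space set \<Rightarrow> (real \<Rightarrow> 'a cone) set" where
  "Omega T M \<equiv> mspace (path_metric T M)"

lemma Omega_eq:
  "Omega T M = {z \<in> extensional {0..T}. continuous_on {0..T} z \<and> z ` {0..T} \<subseteq> cone_over M}"
proof -
  have top: "mtopology_of (submetric euclidean_metric (cone_over M)) = top_of_set (cone_over M)"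
    by (simp add: mtopology_of_submetric)
  have bdd: "Metric_space.mbounded (cone_over M) dist (z ` {0..T})"
    if "continuous_on {0..T} z" "z ` {0..T} \<subseteq> cone_over M" for z :: "real \<Rightarrow> 'a cone"
  proof -
    interpret Metric_space "cone_over M" dist
      by (rule Met_TC.subspace) simp
    have "bounded (z ` {0..T})"
      using that compact_continuous_image compact_imp_bounded by blast
    then obtain e where "\<And>y y'. y \<in> z ` {0..T} \<Longrightarrow> y' \<in> z ` {0..T} \<Longrightarrow> dist y y' \<le> e"
      by (auto simp: bounded_two_points)
    then show ?thesis using that(2) by (auto simp: mbounded_alt)
  qed
  have "f \<in> Omega T M \<longleftrightarrow>
      f \<in> extensional {0..T} \<and> continuous_on {0..T} f \<and> f ` {0..T} \<subseteq> cone_over M" for f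
    using bdd[of f] unfolding path_metric_def mspace_cfunspace top
    by (simp add: image_subset_iff_funcset) blast
  then show ?thesis by blast
qed

definition path_borel :: "real \<Rightarrow> 'a::metric_space set \<Rightarrow> (real \<Rightarrow> 'a cone) measure" where
  "path_borel T M = sigma (Omega T M) {S. openin (mtopology_of (path_metric T M)) S}"

definition path_prob :: "real \<Rightarrow> 'a::metric_space set \<Rightarrow> (real \<Rightarrow> 'a cone) measure set" where
  "path_prob T M = {\<nu>. prob_space \<nu> \<and> sets \<nu> = sets (path_borel T M)}"

definition abs_cont_path :: "real \<Rightarrow> (real \<Rightarrow> 'b::metric_space) \<Rightarrow> bool" where
  "abs_cont_path T z \<longleftrightarrow>
     (\<exists>m::real \<Rightarrow> real. set_integrable lborel {0..T} m \<and>
        (\<forall>s t. 0 \<le> s \<and> s \<le> t \<and> t \<le> T \<longrightarrow> dist (z s) (z t) \<le> (LINT u:{s..t}|lborel. m u)))"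

definition metric_derivative :: "real \<Rightarrow> (real \<Rightarrow> 'b::metric_space) \<Rightarrow> real \<Rightarrow> real" where
  "metric_derivative T z t = Lim (at t within {0..T}) (\<lambda>s. dist (z s) (z t) / \<bar>s - t\<bar>)"

definition AC2 :: "real \<Rightarrow> (real \<Rightarrow> 'b::metric_space) \<Rightarrow> bool" where
  "AC2 T z \<longleftrightarrow>
     abs_cont_path T z \<and> integrable (lebesgue_on {0..T}) (\<lambda>t. (metric_derivative T z t)\<^sup>2)"

text \<open>Squared speed for the tensor \<open>r\<^sup>2 g + dr\<^sup>2\<close>. The base point of \<open>pi_x\<close> is immaterial,
  since \<open>r > 0\<close> near any \<open>t\<close> that contributes.\<close>

definition cone_speed2 :: "real \<Rightarrow> 'a::euclidean_space \<Rightarrow> (real \<Rightarrow> 'a cone) \<Rightarrow> real \<Rightarrow> real" where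
  "cone_speed2 T xbar z t =
     (let x = (\<lambda>s. pi_x xbar (z s)); r = (\<lambda>s. pi_r (z s)) in
      if 0 < r t \<and> x differentiable (at t within {0..T}) \<and> r differentiable (at t within {0..T})
      then (r t)\<^sup>2 * (norm (vector_derivative x (at t within {0..T})))\<^sup>2
           + (vector_derivative r (at t within {0..T}))\<^sup>2
      else 0)"

definition path_action :: "real \<Rightarrow> 'a::euclidean_space \<Rightarrow> (real \<Rightarrow> 'a cone) \<Rightarrow> ennreal" where
  "path_action T xbar z =
     (if AC2 T z then \<integral>\<^sup>+t\<in>{0..T}. ennreal (cone_speed2 T xbar z t) \<partial>lborel else \<infinity>)"

definition action ::
  "real \<Rightarrow> 'a::euclidean_space \<Rightarrow> (real \<Rightarrow> 'a cone) measure \<Rightarrow> ennreal" where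
  "action T xbar \<mu> = (\<integral>\<^sup>+z. path_action T xbar z \<partial>\<mu>)"

subsection \<open>The generalized geodesic problem\<close>

definition P2_cone :: "'a::metric_space set \<Rightarrow> ('a cone \<times> 'a cone) measure set" where
  "P2_cone M = {\<gamma>. prob_space \<gamma> \<and>
     sets \<gamma> = sets (restrict_space borel (cone_over M \<times> cone_over M)) \<and>
     (\<integral>\<^sup>+p. ennreal ((dist p (apex, apex))\<^sup>2) \<partial>\<gamma>) < \<infinity>}"

definition homogeneous2 :: "'a set \<Rightarrow> ('a cone \<times> 'a cone \<Rightarrow> real) \<Rightarrow> bool" where
  "homogeneous2 M f \<longleftrightarrow>
     (\<forall>x1\<in>M. \<forall>x2\<in>M. \<forall>r1\<ge>0. \<forall>r2\<ge>0. \<forall>l>0.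
        f (cone_point x1 (l * r1), cone_point x2 (l * r2))
        = l\<^sup>2 * f (cone_point x1 r1, cone_point x2 r2))"

text \<open>Both constraints include integrability of the integrand over path space, as Bochner
  integrals of non-integrable functions are \<open>0\<close> by convention. Under \<open>P2_cone\<close> the right-hand side of the
  coupling constraint is always integrable.\<close>

definition coupling_constraint ::
  "real \<Rightarrow> 'a::metric_space set \<Rightarrow> ('a cone \<times> 'a cone) measure \<Rightarrow> (real \<Rightarrow> 'a cone) measure \<Rightarrow> bool"
  where
  "coupling_constraint T M \<gamma> \<mu> \<longleftrightarrow>
     (\<forall>f. continuous_on (cone_over M \<times> cone_over M) f \<and> homogeneous2 M f \<longrightarrow>
        has_bochner_integral \<mu> (\<lambda>z. f (z 0, z T)) (LINT p|\<gamma>. f p))"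

definition marginal_constraint ::
  "real \<Rightarrow> 'a::euclidean_space set \<Rightarrow> 'a \<Rightarrow> (real \<Rightarrow> 'a cone) measure \<Rightarrow> bool" where
  "marginal_constraint T M xbar \<mu> \<longleftrightarrow>
     (\<forall>f::real \<times> 'a \<Rightarrow> real. continuous_on ({0..T} \<times> M) f \<longrightarrow>
        has_bochner_integral \<mu>
          (\<lambda>z. LINT t:{0..T}|lborel. f (t, pi_x xbar (z t)) * (pi_r (z t))\<^sup>2)
          (LINT x:M|rho0 M. (LINT t:{0..T}|lborel. f (t, x))))"

definition admissible_plan ::
  "real \<Rightarrow> 'a::euclidean_space set \<Rightarrow> 'a \<Rightarrow> ('a cone \<times> 'a cone) measure \<Rightarrow>
   (real \<Rightarrow> 'a cone) measure \<Rightarrow> bool" where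
  "admissible_plan T M xbar \<gamma> \<mu> \<longleftrightarrow>
     \<mu> \<in> path_prob T M \<and> coupling_constraint T M \<gamma> \<mu> \<and> marginal_constraint T M xbar \<mu>"

definition geodesic_minimizer ::
  "real \<Rightarrow> 'a::euclidean_space set \<Rightarrow> 'a \<Rightarrow> ('a cone \<times> 'a cone) measure \<Rightarrow>
   (real \<Rightarrow> 'a cone) measure \<Rightarrow> bool" where
  "geodesic_minimizer T M xbar \<gamma> \<mu> \<longleftrightarrow>
     admissible_plan T M xbar \<gamma> \<mu> \<and>
     (\<forall>\<mu>'. admissible_plan T M xbar \<gamma> \<mu>' \<longrightarrow> action T xbar \<mu> \<le> action T xbar \<mu>')"

subsection \<open>Lipschitz functions, densities and the dual space\<close>

text \<open>Functions on \<open>[0,T] \<times> M\<close> are extended by \<open>0\<close>, so that they form a vector space under the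
  pointwise operations of the ambient function type. The constant function \<open>1\<close> on \<open>[0,T] \<times> M\<close> is
  thus \<open>indicator ({0..T} \<times> M)\<close>.\<close>

definition C01 :: "real \<Rightarrow> 'a::metric_space set \<Rightarrow> (real \<times> 'a \<Rightarrow> real) set" where
  "C01 T M = {f. (\<exists>L. L-lipschitz_on ({0..T} \<times> M) f) \<and> (\<forall>p. p \<notin> {0..T} \<times> M \<longrightarrow> f p = 0)}"

definition C01_norm :: "real \<Rightarrow> 'a::metric_space set \<Rightarrow> (real \<times> 'a \<Rightarrow> real) \<Rightarrow> real" where
  "C01_norm T M f =
     (SUP p\<in>{0..T} \<times> M. \<bar>f p\<bar>) + Inf {L. L-lipschitz_on ({0..T} \<times> M) f}"

definition B0 :: "real \<Rightarrow> 'a::metric_space set \<Rightarrow> (real \<times> 'a \<Rightarrow> real) set" where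
  "B0 T M = {f \<in> C01 T M. \<forall>x\<in>M. f (0, x) = 0 \<and> f (T, x) = 0}"

definition B0_dual :: "real \<Rightarrow> 'a::metric_space set \<Rightarrow> ((real \<times> 'a \<Rightarrow> real) \<Rightarrow> real) set" where
  "B0_dual T M = {P.
     (\<forall>f\<in>B0 T M. \<forall>g\<in>B0 T M. P (\<lambda>p. f p + g p) = P f + P g) \<and>
     (\<forall>c. \<forall>f\<in>B0 T M. P (\<lambda>p. c * f p) = c * P f) \<and>
     (\<exists>K. \<forall>f\<in>B0 T M. \<bar>P f\<bar> \<le> K * C01_norm T M f)}"

definition h2 ::
  "'a::euclidean_space \<Rightarrow> real \<Rightarrow> (real \<Rightarrow> 'a cone) measure \<Rightarrow> 'a measure" where
  "h2 xbar t \<nu> = distr (density \<nu> (\<lambda>z. ennreal ((pi_r (z t))\<^sup>2))) borel (\<lambda>z. pi_x xbar (z t))"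

definition lipschitz_density ::
  "real \<Rightarrow> 'a::euclidean_space set \<Rightarrow> 'a \<Rightarrow> (real \<Rightarrow> 'a cone) measure \<Rightarrow>
   (real \<times> 'a \<Rightarrow> real) \<Rightarrow> bool" where
  "lipschitz_density T M xbar \<nu> \<rho> \<longleftrightarrow>
     \<rho> \<in> C01 T M \<and> (\<forall>p. 0 \<le> \<rho> p) \<and>
     (\<forall>t\<in>{0..T}. h2 xbar t \<nu> = density (rho0 M) (\<lambda>x. ennreal (\<rho> (t, x))))"

text \<open>The density is determined almost everywhere only; \<open>rho_of\<close> is its Lipschitz version, which is
  unique if it exists.\<close>

definition rho_of ::
  "real \<Rightarrow> 'a::euclidean_space set \<Rightarrow> 'a \<Rightarrow> (real \<Rightarrow> 'a cone) measure \<Rightarrow> real \<times> 'a \<Rightarrow> real"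
  where
  "rho_of T M xbar \<nu> = (THE \<rho>. lipschitz_density T M xbar \<nu> \<rho>)"

lemma lipschitz_density_unique:
  assumes U: "open U" "bounded U" "U \<noteq> {}" "M = closure U"
    and 1: "lipschitz_density T M xbar \<nu> \<rho>" and 2: "lipschitz_density T M xbar \<nu> \<sigma>"
  shows "\<rho> = \<sigma>"
proof
  fix p
  show "\<rho> p = \<sigma> p"
  proof (cases "p \<in> {0..T} \<times> M")
    case False
    then have "\<rho> p = 0" "\<sigma> p = 0" using 1 2 by (simp_all only: lipschitz_density_def C01_def mem_Collect_eq) blast+
    then show ?thesis by simp
  next
    case True
    then obtain t x where p: "p = (t, x)" "t \<in> {0..T}" "x \<in> M" by auto
    have cont: "continuous_on M (\<lambda>x. f (t, x))" if "f \<in> C01 T M" for f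
    proof -
      from that obtain L where "L-lipschitz_on ({0..T} \<times> M) f" by (auto simp: C01_def)
      then have "continuous_on ({0..T} \<times> M) f" by (rule lipschitz_on_continuous_on)
      then show ?thesis
        by (rule continuous_on_compose2) (use p in \<open>auto intro!: continuous_intros\<close>)
    qed
    have M: "M \<in> sets lborel" "U \<subseteq> M" "closed M" "bounded M"
      using U by (auto simp: closure_subset bounded_closure)
    have zero: "f (t, x) = 0" if "f \<in> C01 T M" "x \<notin> M" for f x
      using that by (auto simp: C01_def)
    have meas: "(\<lambda>x. f (t, x)) \<in> borel_measurable borel" if "f \<in> C01 T M" for f
    proof -
      have "(\<lambda>x. indicator M x *\<^sub>R f (t, x)) \<in> borel_measurable borel"
        using M cont[OF that] by (intro borel_measurable_continuous_on_indicator) auto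
      also have "(\<lambda>x. indicator M x *\<^sub>R f (t, x)) = (\<lambda>x. f (t, x))"
        using zero[OF that] by (force simp: indicator_def)
      finally show ?thesis .
    qed
    have C: "\<rho> \<in> C01 T M" "\<sigma> \<in> C01 T M" using 1 2 by (auto simp: lipschitz_density_def)
    have pos: "emeasure lborel M \<noteq> 0"
    proof
      assume "emeasure lborel M = 0"
      then have "emeasure lborel U = 0"
        using emeasure_mono[of U M lborel] M by auto
      then have "negligible U"
        using U(1) by (simp add: negligible_iff_null_sets null_sets_def)
      then show False using open_not_negligible U by blast
    qed
    have fin: "emeasure lborel M \<noteq> \<infinity>"
      using emeasure_bounded_finite[OF M(4)] by auto
    interpret R: prob_space "rho0 M"
      unfolding rho0_def by (rule prob_space_uniform_measure) (use pos fin in auto)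
    have "density (rho0 M) (\<lambda>x. ennreal (\<rho> (t, x))) = density (rho0 M) (\<lambda>x. ennreal (\<sigma> (t, x)))"
      using 1 2 p by (simp add: lipschitz_density_def)
    then have "AE x in rho0 M. ennreal (\<rho> (t, x)) = ennreal (\<sigma> (t, x))"
      using meas[OF C(1)] meas[OF C(2)]
      by (subst (asm) R.density_unique_iff) (auto simp: rho0_def)
    then have "AE x in rho0 M. \<rho> (t, x) = \<sigma> (t, x)"
      using 1 2 by (simp add: lipschitz_density_def)
    then have ae: "AE x in lborel. x \<in> M \<longrightarrow> \<rho> (t, x) = \<sigma> (t, x)"
      unfolding rho0_def
      using pos fin by (simp add: AE_uniform_measure top.not_eq_extremum)
    have eqU: "\<rho> (t, y) = \<sigma> (t, y)" if "y \<in> U" for y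
    proof (rule ccontr)
      assume ne: "\<rho> (t, y) \<noteq> \<sigma> (t, y)"
      have co: "continuous_on U (\<lambda>x. \<rho> (t, x) - \<sigma> (t, x))"
        using cont[OF C(1)] cont[OF C(2)] M(2)
        by (intro continuous_intros) (auto intro: continuous_on_subset)
      have op: "open ((\<lambda>x. \<rho> (t, x) - \<sigma> (t, x)) -` (- {0}) \<inter> U)" (is "open ?V")
        using co U(1) by (subst (asm) continuous_on_open_vimage) auto
      have "AE x in lborel. x \<notin> ?V" using ae by eventually_elim (use M(2) in auto)
      then have "?V \<in> null_sets lborel"
        using op by (subst (asm) AE_iff_null_sets[symmetric]) auto
      then have "negligible ?V" by (simp add: negligible_iff_null_sets null_sets_completionI)
      moreover have "?V \<noteq> {}" using ne that by auto
      ultimately show False using open_not_negligible[OF op] by blast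
    qed
    have "\<rho> (t, x) - \<sigma> (t, x) = 0"
      using continuous_constant_on_closure[of U "\<lambda>x. \<rho> (t, x) - \<sigma> (t, x)" 0 x]
        continuous_on_diff[OF cont[OF C(1)] cont[OF C(2)]] eqU p U(4)
      by simp
    then show ?thesis using p by simp
  qed
qed

definition gen_almost_diffeo ::
  "real \<Rightarrow> 'a::euclidean_space set \<Rightarrow> 'a \<Rightarrow> (real \<Rightarrow> 'a cone) measure \<Rightarrow> bool" where
  "gen_almost_diffeo T M xbar \<nu> \<longleftrightarrow>
     \<nu> \<in> path_prob T M \<and> (\<exists>\<rho>. lipschitz_density T M xbar \<nu> \<rho>) \<and>
     C01_norm T M (\<lambda>p. rho_of T M xbar \<nu> p - indicator ({0..T} \<times> M) p) \<le> 1 / 2"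

end

theory Submission
  imports Defs "HOL-Library.Function_Algebras"
begin

text \<open>
  For \<open>\<sigma> \<in> B0\<close> let \<open>\<phi>(\<sigma>)\<close> be the infimum of the action over all plans with coupling \<open>\<gamma>\<close> and
  density \<open>1 + \<sigma>\<close>. Mixing plans shows that \<open>\<phi>\<close> is convex, and minimality of \<open>\<mu>\<close> gives
  \<open>\<phi>(0) = action \<mu>\<close>. On the cone mass can be created without moving points: pushing \<open>\<mu>\<close> forward by
  \<open>[x\<^sub>t, r\<^sub>t] \<mapsto> [x\<^sub>t, r\<^sub>t sqrt (1 + \<sigma>(t, x\<^sub>t))]\<close> produces a plan with density \<open>1 + \<sigma>\<close>, with the same
  coupling because \<open>\<sigma>\<close> vanishes at the endpoints, and with action at most
  \<open>7 action \<mu> + \<integral>\<integral> r\<^sup>2\<close> when \<open>C01_norm \<sigma> \<le> 1/2\<close>. Hence \<open>\<phi>\<close> is bounded near \<open>0\<close>, so it has a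
  continuous subgradient at \<open>0\<close> by the Hahn--Banach theorem, and this is the pressure \<open>P\<close>.

  The action is computed through pointwise derivatives, so the estimate for the pushed plan needs
  that \<open>r\<close>, and \<open>x\<close> where \<open>r > 0\<close>, are differentiable almost everywhere along absolutely continuous paths.
\<close>

text \<open>The marginal constraint is only averaged in time, whereas the density of a generalized
  almost diffeomorphism is prescribed at every time. The competitors defining \<open>\<phi>\<close>
  are therefore asked to have density \<open>1 + \<sigma>\<close> in the averaged sense
  \<open>weak_density\<close>, which survives push-forward and mixing. The price is paid at the
  endpoints: that the density of \<open>\<nu>\<close> minus one belongs to \<open>B0\<close> is a
  statement about the single times 0 and \<open>T\<close>. The coupling gives \<open>\<nu>\<close>
  and \<open>\<mu>\<close> the same marginals there, and those of \<open>\<mu>\<close> are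
  identified by continuity in time; finite action supplies the dominating function.
  \<open>\<phi>\<close> may be infinite and its infimum need not be attained, so only its epigraph
  is used. As \<open>path_action\<close> is not known to be measurable, actions are lower integrals,
  for which additivity and change of variables may fail. Only upper bounds for the action of pushed
  and mixed plans are needed, and these remain true.\<close>

section \<open>Lebesgue differentiation on the line\<close>

text \<open>The intervals with average below \<open>p\<close> cover the set finely, and by Vitali's theorem disjoint ones
  cover almost all of it; they are taken inside an open set that exceeds \<open>{g \<ge> p + \<delta>}\<close> by little
  \<open>\<bar>g - p\<bar>\<close>-mass. No measurability of the set is needed.\<close>

lemma negligible_lower_derivate:
  fixes g :: "real \<Rightarrow> real"
  assumes g: "integrable lborel g" and "0 < \<delta>"
  shows "negligible {t. l < t \<and> t < r \<and> p + \<delta> \<le> g t \<and>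
     (\<forall>d>0. \<exists>a b. a < b \<and> a \<le> t \<and> t \<le> b \<and> b - a < d \<and> (LINT u:{a..b}|lborel. g u) < p * (b - a))}" (is "negligible ?E")
proof -
  define E where "E = ?E"
  have "negligible E"
  unfolding negligible_outer_le
proof (intro allI impI)
  fix e :: real assume "0 < e"
  define I where "I = {l<..<r}"
  have I: "I \<in> sets borel" "emeasure lborel I < \<infinity>" using emeasure_bounded_finite[of I] by (auto simp: I_def bounded_subset[OF bounded_closed_interval])
  \<comment> \<open>Cutting off to the bounded \<open>I\<close> makes the constant \<open>p\<close>
    integrable. All intervals selected below lie in \<open>I\<close>, where \<open>G\<close> is
    \<open>g - p\<close>.\<close>
  define G where "G u = indicator I u * (g u - p)" for u
  have G: "integrable lborel G"
  proof -
    have "integrable lborel (\<lambda>u. indicator I u *\<^sub>R g u - p * indicator I u)"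
      using integrable_mult_indicator[of I lborel g] g I
      by (intro Bochner_Integration.integrable_diff integrable_mult_right integrable_real_indicator) auto
    then show ?thesis by (rule Bochner_Integration.integrable_cong[THEN iffD1, rotated 2]) (auto simp: G_def algebra_simps)
  qed
  then have Gm[measurable]: "G \<in> borel_measurable borel" by auto
  have gm[measurable]: "g \<in> borel_measurable borel" using g by auto
  have Gset: "set_integrable lborel S G" if "S \<in> sets borel" for S
    using integrable_mult_indicator[of S lborel G] G that by (auto simp: set_integrable_def)
  \<comment> \<open>A finite Borel measure on the line is outer regular, which provides the open set
    \<open>V\<close>. The excess \<delta> * e is chosen because a factor \<delta> is divided out at
    the end.\<close>
  define N where "N = density lborel (\<lambda>u. ennreal \<bar>G u\<bar>)"
  have sN: "sets N = sets borel" by (simp add: N_def)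
  have eN: "emeasure N S = ennreal (LINT u:S|lborel. \<bar>G u\<bar>)" if "S \<in> sets borel" for S
  proof -
    have "emeasure N S = (\<integral>\<^sup>+u. ennreal (indicator S u * \<bar>G u\<bar>) \<partial>lborel)"
      using that unfolding N_def by (subst emeasure_density) (auto intro!: nn_integral_cong simp: indicator_def)
    also have "\<dots> = ennreal (\<integral>u. indicator S u * \<bar>G u\<bar> \<partial>lborel)"
      using integrable_mult_indicator[of S lborel "\<lambda>u. \<bar>G u\<bar>"] G that
      by (intro nn_integral_eq_integral) auto
    finally show ?thesis by (simp add: set_lebesgue_integral_def)
  qed
  have Nfin: "emeasure N (space N) \<noteq> \<infinity>" using eN[of UNIV] by (simp add: N_def)
  define A where "A = {t\<in>I. p + \<delta> \<le> g t}"
  have A: "A \<in> sets borel" unfolding A_def I_def by measurable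
  have "emeasure N A \<noteq> \<infinity>" using eN[OF A] by simp
  then have "emeasure N A < emeasure N A + ennreal (\<delta> * e)"
    using \<open>0 < e\<close> \<open>0 < \<delta>\<close> by (simp add: ennreal_add_left_cancel_less)
  then have "(INF U\<in>{U. A \<subseteq> U \<and> open U}. emeasure N U) < emeasure N A + ennreal (\<delta> * e)"
    by (subst outer_regular[symmetric]) (use Nfin A sN in auto)
  then obtain V where V: "A \<subseteq> V" "open V" "emeasure N V < emeasure N A + ennreal (\<delta> * e)"
    unfolding INF_less_iff by blast
  have Vb: "V \<in> sets borel" using V by auto
  have dVA: "(LINT u:V - A|lborel. \<bar>G u\<bar>) \<le> \<delta> * e"
  proof -
    have "emeasure N V = emeasure N (V - A) + emeasure N A"
      using V(1) Vb A sN by (subst plus_emeasure) (auto intro!: arg_cong[where f="emeasure N"])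
    with V(3) have "emeasure N A + emeasure N (V - A) \<le> emeasure N A + ennreal (\<delta> * e)" by (simp only: add.commute less_imp_le)
    then have "emeasure N (V - A) \<le> ennreal (\<delta> * e)"
      using \<open>emeasure N A \<noteq> \<infinity>\<close> by (subst (asm) ennreal_add_left_cancel_le) auto
    then show ?thesis using eN[of "V - A"] Vb A \<open>0 < e\<close> \<open>0 < \<delta>\<close> by (simp add: ennreal_le_iff)
  qed
  define K where "K = {(c, q). 0 < q \<and> cball c q \<subseteq> V \<inter> I \<and> (LINT u:cball c q|lborel. g u) < p * (2 * q)}"
  have cov: "\<exists>i. i \<in> K \<and> t \<in> cball (fst i) (snd i) \<and> snd i < d" if "t \<in> E" "0 < d" for t d
  proof -
    have "t \<in> V \<inter> I" using that V by (auto simp: E_def A_def I_def)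
    moreover have "open (V \<inter> I)" using V by (auto simp: I_def)
    ultimately obtain \<eta> where \<eta>: "0 < \<eta>" "ball t \<eta> \<subseteq> V \<inter> I" using open_contains_ball by blast
    \<comment> \<open>Length below \<open>d\<close> makes the cover fine, length below \<eta> keeps
      the interval inside \<open>V \<inter> I\<close>.\<close>
    then obtain a b where ab: "a < b" "a \<le> t" "t \<le> b" "b - a < min d \<eta>" "(LINT u:{a..b}|lborel. g u) < p * (b - a)"
      using \<open>t \<in> E\<close> \<open>0 < d\<close> by (auto simp: E_def elim!: allE[of _ "min d \<eta>"])
    have cb: "cball ((a+b)/2) ((b-a)/2) = {a..b}"
      by (auto simp: cball_eq_atLeastAtMost field_simps)
    have "{a..b} \<subseteq> ball t \<eta>" using ab by (auto simp: dist_real_def)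
    then have "((a+b)/2, (b-a)/2) \<in> K" using \<eta> ab(1) ab(5) cb by (auto simp: K_def simp flip: diff_divide_distrib) (simp add: algebra_simps)
    then show ?thesis
      using ab cb by (intro bexI[of _ "((a+b)/2, (b-a)/2)", unfolded Bex_def]) auto
  qed
  have Kpos: "0 < snd i" if "i \<in> K" for i using that by (auto simp: K_def)
  obtain C where C: "countable C" "C \<subseteq> K"
    "pairwise (\<lambda>i j. disjnt (cball (fst i) (snd i)) (cball (fst j) (snd j))) C"
    "negligible (E - (\<Union>i \<in> C. cball (fst i) (snd i)))"
    by (rule Vitali_covering_theorem_cballs[of K snd E fst]) (rule Kpos cov that; assumption)+
  define B where "B n = (\<Union>i\<in>{i\<in>C. to_nat_on C i = n}. cball (fst i) (snd i))" for n
  have Bcases: "B n = {} \<or> (\<exists>i\<in>C. to_nat_on C i = n \<and> B n = cball (fst i) (snd i))" for n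
  proof (cases "\<exists>i\<in>C. to_nat_on C i = n")
    case True
    then obtain i where i: "i \<in> C" "to_nat_on C i = n" by auto
    then have "{i\<in>C. to_nat_on C i = n} = {i}" using inj_onD[OF inj_on_to_nat_on[OF C(1)]] by blast
    with i show ?thesis unfolding B_def by (intro disjI2 bexI[of _ i]) simp_all
  qed (auto simp: B_def)
  have UB: "(\<Union>n. B n) = (\<Union>i \<in> C. cball (fst i) (snd i))" by (auto simp: B_def)
  have Bb: "B n \<in> sets borel" for n using Bcases[of n] by auto
  have Bdis: "B i \<inter> B j = {}" if "i \<noteq> j" for i j
  proof -
    have "cball (fst x) (snd x) \<inter> cball (fst y) (snd y) = {}"
      if "x \<in> C" "y \<in> C" "to_nat_on C x \<noteq> to_nat_on C y" for x y
      using that C(3) unfolding pairwise_def disjnt_def by metis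
    then show ?thesis using Bcases[of i] Bcases[of j] that by (elim disjE bexE) auto
  qed
  have Bneg: "(LINT u:B n|lborel. G u) \<le> 0" for n
  proof -
    from Bcases[of n] consider "B n = {}" | c q where "(c, q) \<in> C" "B n = cball c q" by force
    then show ?thesis
    proof cases
      case 2
      have sub: "cball c q \<subseteq> I" and le: "(LINT u:cball c q|lborel. g u) < p * (2 * q)" and "0 < q" using 2 C(2) by (auto simp: K_def)
      have "(LINT u:cball c q|lborel. G u) = (LINT u:cball c q|lborel. g u - p)"
        using sub by (intro set_lebesgue_integral_cong) (auto simp: G_def)
      also have "\<dots> = (LINT u:cball c q|lborel. g u) - (LINT u:cball c q|lborel. p)"
        using g integrable_mult_indicator[of "cball c q" lborel g]
        by (intro set_integral_diff) (auto simp: set_integrable_def intro!: integrable_mult_left integrable_real_indicator emeasure_lborel_cball_finite)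
      also have "(LINT u:cball c q|lborel. p) = 2 * q * p"
        using \<open>0 < q\<close> by (auto simp: set_lebesgue_integral_def cball_eq_atLeastAtMost)
      finally show ?thesis using 2 le by (simp add: mult_ac)
    qed (auto simp: set_lebesgue_integral_def)
  qed
  define W where "W = (\<Union>n. B n)"
  have Wb: "W \<in> sets borel" using Bb by (auto simp: W_def)
  have WV: "W \<subseteq> V \<inter> I" using C(2) unfolding W_def UB by (force simp: K_def)
  have lim: "(\<lambda>n. LINT u:(\<Union>i\<in>{..<n}. B i)|lborel. G u) \<longlonglongrightarrow> (LINT u:(\<Union>n. \<Union>i\<in>{..<n}. B i)|lborel. G u)"
    by (rule set_integral_cont_up) (use Bb in \<open>auto simp: incseq_def intro!: Gset intro: less_le_trans\<close>)
  have UW: "(\<Union>n. \<Union>i\<in>{..<n}. B i) = W" by (auto simp: W_def)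
  have le: "(LINT u:(\<Union>i\<in>{..<n}. B i)|lborel. G u) \<le> 0" for n
    using Bb Bdis Bneg by (subst set_integral_finite_Union) (auto simp: disjoint_family_on_def intro!: Gset sum_nonpos)
  have W0: "(LINT u:W|lborel. G u) \<le> 0"
    using LIMSEQ_le_const2[OF lim] le unfolding UW by blast
  have split: "(LINT u:W|lborel. G u) = (LINT u:W\<inter>A|lborel. G u) + (LINT u:W-A|lborel. G u)"
    using Wb A by (subst set_integral_Un[symmetric]) (auto intro!: Gset simp: Int_Diff_Un)
  \<comment> \<open>The integral of \<open>G\<close> over \<open>W\<close> is at most 0, and
    \<open>W - A\<close>, being part of \<open>V - A\<close>, can compensate at most \<delta> * e.
    So the integral over \<open>W \<inter> A\<close> is at most \<delta> * e, while \<open>G\<close>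
    is at least \<delta> there.\<close>
  have "- (LINT u:W-A|lborel. G u) \<le> (LINT u:V-A|lborel. \<bar>G u\<bar>)"
    unfolding set_lebesgue_integral_def 
    using WV G Wb A Vb by (subst integral_minus[symmetric], intro integral_mono integrable_minus integrable_mult_indicator) (auto simp: indicator_def)
  then have up: "(LINT u:W\<inter>A|lborel. G u) \<le> \<delta> * e" using W0 split dVA by linarith
  have fin: "emeasure lborel (W \<inter> A) < \<infinity>"
    using emeasure_mono[of "W \<inter> A" I lborel] I WV A by (metis Int_lower2 emeasure_mono inf.coboundedI1 order_le_less_trans sets_lborel subset_trans)
  have "\<delta> * measure lborel (W \<inter> A) = (LINT u:W\<inter>A|lborel. \<delta>)"
    using fin Wb A by (simp add: set_lebesgue_integral_def less_top[symmetric])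
  also have "\<dots> \<le> (LINT u:W\<inter>A|lborel. G u)"
    using fin Wb A by (intro set_integral_mono Gset) (auto simp: set_integrable_def G_def A_def less_top[symmetric])
  also note up
  finally have m: "measure lborel (W \<inter> A) \<le> e" using \<open>0 < \<delta>\<close> by simp
  have neg: "negligible (E - W)" using C(4) by (simp add: W_def UB)
  have "E \<subseteq> A" by (auto simp: E_def A_def I_def)
  have lm: "W \<inter> A \<in> lmeasurable" using fin Wb A by (auto simp: fmeasurable_def)
  show "\<exists>T. E \<subseteq> T \<and> T \<in> lmeasurable \<and> measure lebesgue T \<le> e"
  proof (intro exI conjI)
    show "E \<subseteq> (W \<inter> A) \<union> (E - W)" using \<open>E \<subseteq> A\<close> by auto
    show "(W \<inter> A) \<union> (E - W) \<in> lmeasurable" using lm neg by (simp add: negligible_imp_measurable fmeasurable.Un)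
    have "measure lebesgue ((W \<inter> A) \<union> (E - W)) \<le> measure lebesgue (W \<inter> A) + measure lebesgue (E - W)"
      using lm neg by (intro measure_Un_le) (auto simp: negligible_imp_sets)
    also have "\<dots> = measure lborel (W \<inter> A)" using neg Wb A by (simp add: negligible_imp_measure0)
    also note m
    finally show "measure lebesgue ((W \<inter> A) \<union> (E - W)) \<le> e" .
  qed
qed
  then show ?thesis by (simp add: E_def)
qed


lemma negligible_countable_UN:
  assumes "countable I" "\<And>i. i \<in> I \<Longrightarrow> negligible (A i)"
  shows "negligible (\<Union>i\<in>I. A i)"
  using assms null_sets_UN'[of I A lebesgue] by (simp add: negligible_iff_null_sets)

text \<open>Lebesgue's differentiation theorem. If averages of \<open>g\<close> near
  \<open>t\<close> drop below \<open>g t\<close> by a fixed amount, two rationals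
  \<open>p < q\<close> separate them from \<open>g t\<close>; this leaves countably many null sets.
  The same for \<open>- g\<close> bounds the averages from above.\<close>

lemma AE_has_derivative_indefinite_integral:
  fixes g F :: "real \<Rightarrow> real"
  assumes g: "integrable lborel g"
    and F: "\<And>s t. l \<le> s \<Longrightarrow> s \<le> t \<Longrightarrow> t \<le> r \<Longrightarrow> F t - F s = (LINT u:{s..t}|lborel. g u)"
  shows "AE t in lborel. l < t \<and> t < r \<longrightarrow> (F has_real_derivative g t) (at t)"
proof -
  \<comment> \<open>Writing \<open>p + (q - p)\<close> for \<open>q\<close> matches
    \<open>negligible_lower_derivate\<close> with \<delta> = q - p.\<close>
  define E where "E p q h = {t. l < t \<and> t < r \<and> p + (q - p) \<le> h t \<and>
     (\<forall>d>0. \<exists>a b. a < b \<and> a \<le> t \<and> t \<le> b \<and> b - a < d \<and> (LINT u:{a..b}|lborel. h u) < p * (b - a))}"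
    for p q :: real and h
  have neg: "negligible (E p q h)" if "integrable lborel h" "p < q" for p q h
    unfolding E_def using that by (intro negligible_lower_derivate) auto
  define Z where "Z = (\<Union>p\<in>\<rat>. \<Union>q\<in>\<rat> \<inter> {p<..}. E p q g \<union> E p q (\<lambda>u. - g u))"
  have "negligible Z"
    unfolding Z_def using g
    by (intro negligible_countable_UN) (auto intro!: negligible_Un neg countable_rat countable_Int1)
  have low: "\<exists>d>0. \<forall>a b. a < b \<and> a \<le> t \<and> t \<le> b \<and> b - a < d \<longrightarrow> (h t - e) * (b - a) \<le> (LINT u:{a..b}|lborel. h u)"
    if t: "l < t" "t < r" "t \<notin> Z" "0 < e" "h = g \<or> h = (\<lambda>u. - g u)" for t e h
  proof -
    obtain p where p: "p \<in> \<rat>" "h t - e < p" "p < h t" using Rats_dense_in_real[of "h t - e" "h t"] \<open>0 < e\<close> by auto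
    obtain q where q: "q \<in> \<rat>" "p < q" "q < h t" using Rats_dense_in_real[of p "h t"] p by auto
    have "t \<notin> E p q h" using that p q by (auto simp: Z_def)
    then obtain d where d: "d > 0" "\<And>a b. a < b \<and> a \<le> t \<and> t \<le> b \<and> b - a < d \<Longrightarrow> p * (b - a) \<le> (LINT u:{a..b}|lborel. h u)"
    proof -
      have "\<not> (\<forall>d>0. \<exists>a b. a < b \<and> a \<le> t \<and> t \<le> b \<and> b - a < d \<and> (LINT u:{a..b}|lborel. h u) < p * (b - a))"
        using \<open>t \<notin> E p q h\<close> t(1,2) q by (simp add: E_def)
      then show ?thesis using that by (meson not_less)
    qed
    have "(h t - e) * (b - a) \<le> p * (b - a)" if "a < b" for a b
      using p that by (intro mult_right_mono) auto
    then show ?thesis using d by (meson order.trans)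
  qed
  have der: "(F has_real_derivative g t) (at t)" if t: "l < t" "t < r" "t \<notin> Z" for t
    unfolding has_field_derivative_iff LIM_def dist_norm
  proof (intro allI impI)
    fix e :: real assume "0 < e"
    then have e2: "0 < e/2" by simp
    obtain d1 where d1: "d1 > 0" "\<And>a b. a < b \<and> a \<le> t \<and> t \<le> b \<and> b - a < d1 \<Longrightarrow> (g t - e/2) * (b - a) \<le> (LINT u:{a..b}|lborel. g u)"
      using low[OF t e2, of g] by auto
    obtain d2 where d2: "d2 > 0" "\<And>a b. a < b \<and> a \<le> t \<and> t \<le> b \<and> b - a < d2 \<Longrightarrow> (- g t - e/2) * (b - a) \<le> (LINT u:{a..b}|lborel. - g u)"
      using low[OF t e2, of "\<lambda>u. - g u"] by auto
    have both: "\<bar>(LINT u:{a..b}|lborel. g u) - g t * (b - a)\<bar> \<le> e/2 * (b - a)"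
      if "a < b" "a \<le> t" "t \<le> b" "b - a < min d1 d2" for a b
    proof -
      have "(LINT u:{a..b}|lborel. - g u) = - (LINT u:{a..b}|lborel. g u)"
        by (simp add: set_lebesgue_integral_def)
      then show ?thesis using d1(2)[of a b] d2(2)[of a b] that unfolding abs_le_iff by (simp add: field_simps)
    qed
    show "\<exists>d>0. \<forall>x. x \<noteq> t \<and> norm (x - t) < d \<longrightarrow> norm ((F x - F t) / (x - t) - g t) < e"
    proof (intro exI[of _ "min (min d1 d2) (min (t - l) (r - t))"] conjI allI impI)
      fix x assume x: "x \<noteq> t \<and> norm (x - t) < min (min d1 d2) (min (t - l) (r - t))"
      have "\<bar>F x - F t - g t * (x - t)\<bar> \<le> e/2 * \<bar>x - t\<bar>"
      proof (cases "t < x")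
        case True
        then show ?thesis using both[of t x] F[of t x] x t by auto
      next
        case False
        then have "\<bar>F t - F x - g t * (t - x)\<bar> \<le> e/2 * (t - x)" using both[of x t] F[of x t] x t by auto
        moreover have "F t - F x - g t * (t - x) = - (F x - F t - g t * (x - t))" by (simp add: algebra_simps)
        ultimately show ?thesis using False by (simp only: abs_minus_cancel) simp
      qed
      then have "\<bar>(F x - F t) / (x - t) - g t\<bar> * \<bar>x - t\<bar> \<le> e/2 * \<bar>x - t\<bar>"
        using x by (simp only: abs_mult[symmetric] left_diff_distrib) simp
      then have "\<bar>(F x - F t) / (x - t) - g t\<bar> \<le> e/2" using x by simp
      then show "norm ((F x - F t) / (x - t) - g t) < e" using \<open>0 < e\<close> by simp
    qed (use d1(1) d2(1) t in auto)
  qed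
  from \<open>negligible Z\<close> have "Z \<in> null_sets lebesgue" by (simp add: negligible_iff_null_sets)
  then have "AE t in lebesgue. t \<notin> Z" by (rule AE_not_in)
  then have "AE t in lborel. t \<notin> Z" by (simp add: AE_completion_iff)
  then show ?thesis by eventually_elim (use der in auto)
qed

section \<open>Sums of measures, and absolutely continuous functions as indefinite integrals\<close>

definition plus_measure :: "'a measure \<Rightarrow> 'a measure \<Rightarrow> 'a measure" where
  "plus_measure M N = measure_of (space M) (sets M) (\<lambda>A. emeasure M A + emeasure N A)"

lemma space_plus_measure [simp]: "space (plus_measure M N) = space M"
  and sets_plus_measure [simp, measurable_cong]: "sets (plus_measure M N) = sets M"
  by (simp_all add: plus_measure_def)

lemma emeasure_plus_measure:
  assumes "sets N = sets M" "A \<in> sets M"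
  shows "emeasure (plus_measure M N) A = emeasure M A + emeasure N A"
  unfolding plus_measure_def
proof (rule emeasure_measure_of_sigma)
  show "A \<in> sets M" by fact
  show "sigma_algebra (space M) (sets M)" ..
  show "positive (sets M) (\<lambda>A. emeasure M A + emeasure N A)" by (simp add: positive_def)
  show "countably_additive (sets M) (\<lambda>A. emeasure M A + emeasure N A)"
    using assms(1) by (auto simp: countably_additive_def suminf_add[symmetric] suminf_emeasure)
qed

lemma nn_integral_plus_measure:
  assumes "sets N = sets M" "f \<in> borel_measurable M"
  shows "(\<integral>\<^sup>+x. f x \<partial>plus_measure M N) = (\<integral>\<^sup>+x. f x \<partial>M) + (\<integral>\<^sup>+x. f x \<partial>N)"
  using assms(2)
proof induction
  case (cong f g)
  then show ?case using sets_eq_imp_space_eq[OF assms(1)] by (simp cong: nn_integral_cong_simp)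
next
  case (set A)
  then show ?case using assms(1) by (simp add: emeasure_plus_measure)
next
  case (mult u c)
  then show ?case using assms(1) by (simp add: nn_integral_cmult distrib_left measurable_cong_sets[OF assms(1) refl] measurable_cong_sets[OF sets_plus_measure refl])
next
  case (add u v)
  then show ?case using assms(1) by (simp add: nn_integral_add add_ac measurable_cong_sets[OF assms(1) refl] measurable_cong_sets[OF sets_plus_measure refl])
next
  case (seq U)
  have "incseq (\<lambda>i. integral\<^sup>N M (U i))" "incseq (\<lambda>i. integral\<^sup>N N (U i))"
    using seq(3) by (auto simp: incseq_def le_fun_def intro!: nn_integral_mono)
  then show ?case using seq assms(1)
    by (simp add: nn_integral_monotone_convergence_SUP measurable_cong_sets[OF assms(1) refl] measurable_cong_sets[OF sets_plus_measure refl] ennreal_SUP_add image_comp SUP_apply[abs_def])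
qed

lemma set_integral_Ioc_eq_Icc:
  fixes g :: "real \<Rightarrow> real"
  assumes "integrable lborel g"
  shows "(LINT u:{s<..t}|lborel. g u) = (LINT u:{s..t}|lborel. g u)"
  unfolding set_lebesgue_integral_def
proof (rule integral_cong_AE)
  have [measurable]: "g \<in> borel_measurable borel" using assms by auto
  show "(\<lambda>u. indicat_real {s<..t} u *\<^sub>R g u) \<in> borel_measurable lborel"
    "(\<lambda>u. indicat_real {s..t} u *\<^sub>R g u) \<in> borel_measurable lborel" by measurable
  have "AE u in lborel. u \<noteq> s" by (rule AE_lborel_singleton)
  then show "AE u in lborel. indicat_real {s<..t} u *\<^sub>R g u = indicat_real {s..t} u *\<^sub>R g u"
    by eventually_elim (auto simp: indicator_def)
qed

text \<open>With \<open>N\<close> the indefinite integral of \<open>\<bar>m\<bar>\<close>, both \<open>N + f\<close> and \<open>N - f\<close> are increasing and their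
  Stieltjes measures add up to an absolutely continuous one.\<close>

lemma abs_cont_imp_indefinite_integral:
  fixes f m :: "real \<Rightarrow> real"
  assumes m: "set_integrable lborel {a..b} m"
    and dom: "\<And>s t. a \<le> s \<Longrightarrow> s \<le> t \<Longrightarrow> t \<le> b \<Longrightarrow> \<bar>f t - f s\<bar> \<le> (LINT u:{s..t}|lborel. m u)"
  shows "\<exists>g. integrable lborel g \<and>
    (\<forall>s t. a \<le> s \<longrightarrow> s \<le> t \<longrightarrow> t \<le> b \<longrightarrow> f t - f s = (LINT u:{s..t}|lborel. g u))"
proof (cases "a \<le> b")
  case ab: True
  \<comment> \<open>\<open>m\<close> may be negative and is controlled on \<open>{a..b}\<close>
    only, but the density of \<open>D\<close> has to be nonnegative and integrable on the whole
    line.\<close>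
  define w where "w u = \<bar>indicator {a..b} u * m u\<bar>" for u
  have w: "integrable lborel w" using m by (simp add: w_def[abs_def] set_integrable_def)
  then have [measurable]: "w \<in> borel_measurable borel" by auto
  have w0: "0 \<le> w u" for u by (simp add: w_def)
  define D where "D = density lborel (\<lambda>u. ennreal (w u))"
  have eD: "emeasure D S = ennreal (LINT u:S|lborel. w u)" if "S \<in> sets borel" for S
  proof -
    have "emeasure D S = (\<integral>\<^sup>+u. ennreal (indicator S u * w u) \<partial>lborel)"
      using that unfolding D_def by (subst emeasure_density) (auto intro!: nn_integral_cong simp: indicator_def)
    also have "\<dots> = ennreal (\<integral>u. indicator S u * w u \<partial>lborel)"
      using integrable_mult_indicator[of S lborel w] w that w0
      by (intro nn_integral_eq_integral) auto
    finally show ?thesis by (simp add: set_lebesgue_integral_def)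
  qed
  have mD: "measure D S = (LINT u:S|lborel. w u)" if "S \<in> sets borel" for S
    using eD[OF that] w0 by (simp add: measure_def set_lebesgue_integral_def)
  interpret D: finite_borel_measure D
  proof (intro finite_borel_measure.intro finite_measureI finite_borel_measure_axioms.intro)
    have "space D = UNIV" by (simp add: D_def)
    then show "emeasure D (space D) \<noteq> \<infinity>" using eD[of UNIV] by simp
    show "sets D = sets borel" by (simp add: D_def)
  qed
  define N where "N = cdf D"
  have N0: "measure D {t} = 0" for t
    using AE_lborel_singleton[of t] by (subst mD) (auto simp: set_lebesgue_integral_def intro!: integral_eq_zero_AE)
  have Ncont: "isCont N t" for t unfolding N_def D.isCont_cdf by (rule N0)
  have Ndiff: "N t - N s = (LINT u:{s<..t}|lborel. w u)" if "s \<le> t" for s t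
    using D.cdf_diff_eq[of s t] mD[of "{s<..t}"] that by (cases "s = t") (auto simp: N_def)
  have Nmono: "N s \<le> N t" if "s \<le> t" for s t using D.cdf_nondecreasing that by (simp add: N_def)
  \<comment> \<open>Clamping extends \<open>f\<close> to the line by constants, since Stieltjes
    measures are built from functions on the whole line. The increments of \<open>N\<close> are
    unaffected because \<open>w\<close> vanishes outside \<open>{a..b}\<close>.\<close>
  define c where "c t = max a (min b t)" for t
  have c: "a \<le> c t" "c t \<le> b" "s \<le> t \<Longrightarrow> c s \<le> c t" "a \<le> t \<Longrightarrow> t \<le> b \<Longrightarrow> c t = t" for s t using ab by (auto simp: c_def)
  have Nc: "N (c t) - N (c s) = N t - N s" if "s \<le> t" for s t
  proof -
    have "(LINT u:{c s<..c t}|lborel. w u) = (LINT u:{s<..t}|lborel. w u)"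
      unfolding set_lebesgue_integral_def
    proof (rule integral_cong_AE)
      have "AE u in lborel. u \<noteq> a" by (rule AE_lborel_singleton)
      then show "AE u in lborel. indicat_real {c s<..c t} u *\<^sub>R w u = indicat_real {s<..t} u *\<^sub>R w u"
        by eventually_elim (auto simp: indicator_def w_def c_def)
    qed auto
    then show ?thesis using Ndiff[OF that] Ndiff[OF c(3)[OF that]] by simp
  qed
  have fN: "\<bar>f (c t) - f (c s)\<bar> \<le> N t - N s" if "s \<le> t" for s t
  proof -
    have "\<bar>f (c t) - f (c s)\<bar> \<le> (LINT u:{c s..c t}|lborel. m u)"
      using dom c that by auto
    also have "\<dots> = (LINT u:{c s..c t}|lborel. indicator {a..b} u * m u)"
      using c[of s] c[of t] by (intro set_lebesgue_integral_cong) auto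
    also have "\<dots> \<le> (LINT u:{c s..c t}|lborel. w u)"
      using m w integrable_mult_indicator[of "{c s..c t}" lborel w]
       integrable_mult_indicator[of "{c s..c t}" lborel "\<lambda>u. indicator {a..b} u * m u"]
      by (intro set_integral_mono) (auto simp: set_integrable_def w_def)
    also have "\<dots> = N t - N s" using Ndiff[of "c s" "c t"] c that Nc w by (simp add: set_integral_Ioc_eq_Icc)
    finally show ?thesis .
  qed
  have fcont: "isCont (\<lambda>t. f (c t)) t" for t
  proof -
    have "(\<lambda>s. \<bar>N s - N t\<bar>) \<midarrow>t\<rightarrow> 0"
      using Ncont[of t] unfolding isCont_def by (simp add: tendsto_rabs_zero_iff LIM_zero)
    then have "(\<lambda>s. f (c s) - f (c t)) \<midarrow>t\<rightarrow> 0"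
    proof (rule Lim_null_comparison[rotated], intro always_eventually allI)
      fix s show "norm (f (c s) - f (c t)) \<le> \<bar>N s - N t\<bar>"
        using fN[of s t] fN[of t s] by (cases "s \<le> t") auto
    qed
    then show ?thesis unfolding isCont_def by (rule LIM_zero_cancel)
  qed
  define h where "h t = f (c t) + N t" for t
  define k where "k t = N t - f (c t)" for t
  have hm: "h s \<le> h t" and km: "k s \<le> k t" if "s \<le> t" for s t
    using fN[OF that] by (auto simp: h_def k_def)
  have hc: "continuous (at_right t) h" and kc: "continuous (at_right t) k" for t
    unfolding h_def k_def using fcont Ncont
    by (auto intro!: continuous_intros intro: continuous_within_subset[OF _ subset_UNIV])
  have eqM: "plus_measure (interval_measure h) (interval_measure k) = scale_measure 2 D"
  proof (rule measure_eqI_generator_eq[where \<Omega>=UNIV and E="range (\<lambda>(s, t). {s<..t})" and A="\<lambda>i::nat. {- real i<..real i}"])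
    show "Int_stable (range (\<lambda>(s, t). {s<..t::real}))" by (auto simp: Int_stable_def)
    fix X assume "X \<in> range (\<lambda>(s, t). {s<..t::real})"
    then obtain s t where X: "X = {s<..t}" by auto
    have "ennreal (h t - h s) + ennreal (k t - k s) = 2 * ennreal (N t - N s)" if "s \<le> t"
      using hm[OF that] km[OF that] Nmono[OF that]
      by (simp add: h_def k_def ennreal_plus[symmetric] ennreal_mult'[symmetric] del: ennreal_plus flip: ennreal_numeral)
    then show "emeasure (plus_measure (interval_measure h) (interval_measure k)) X = emeasure (scale_measure 2 D) X"
      using hm km hc kc by (cases "s \<le> t") (auto simp: X emeasure_plus_measure emeasure_interval_measure_Ioc eD Ndiff)
  next
    show "(\<Union>i::nat. {- real i<..real i}) = UNIV"
      by (auto intro!: real_arch_simple) (metis abs_less_iff reals_Archimedean2 less_imp_le minus_less_iff)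
    show "emeasure (plus_measure (interval_measure h) (interval_measure k)) {- real i<..real i} \<noteq> \<infinity>" for i
      by (simp add: emeasure_plus_measure emeasure_interval_measure_Ioc hm km hc kc)
  qed (auto simp: borel_sigma_sets_Ioc D_def)
  have ac: "absolutely_continuous lborel (interval_measure h)"
    unfolding absolutely_continuous_def
  proof
    fix A assume A: "A \<in> null_sets (lborel :: real measure)"
    then have "emeasure D A = 0" unfolding D_def
      by (subst emeasure_density) (auto simp: null_sets_def intro!: nn_integral_null_set)
    then have "emeasure (plus_measure (interval_measure h) (interval_measure k)) A = 0" by (simp add: eqM)
    then show "A \<in> null_sets (interval_measure h)" using A
      by (subst (asm) emeasure_plus_measure) (auto simp: null_sets_def)
  qed
  obtain p where p[measurable]: "p \<in> borel_measurable borel" and dp: "density lborel p = interval_measure h"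
    using sigma_finite_measure.Radon_Nikodym[OF sigma_finite_lborel ac] by auto
  have pint: "(\<integral>\<^sup>+u\<in>{s<..t}. p u \<partial>lborel) = ennreal (h t - h s)" if "s \<le> t" for s t
    using emeasure_interval_measure_Ioc[OF that hm hc] that
    by (simp add: dp[symmetric] emeasure_density)
  have AEp: "AE u in lborel. p u * indicator {a<..b} u \<noteq> \<infinity>"
    using pint[OF ab] by (intro nn_integral_PInf_AE) auto
  \<comment> \<open>The Radon-Nikodym density \<open>p\<close> takes values in
    \<open>ennreal\<close>. It is finite almost everywhere on \<open>{a<..b}\<close>, where its
    integral is \<open>h b - h a\<close>.\<close>
  define q where "q u = enn2real (p u) * indicator {a<..b} u" for u
  have [measurable]: "q \<in> borel_measurable borel" unfolding q_def[abs_def] by measurable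
  have qint: "(\<integral>\<^sup>+u. ennreal (indicator {s<..t} u * q u) \<partial>lborel) = ennreal (h t - h s)"
    if "a \<le> s" "s \<le> t" "t \<le> b" for s t
  proof -
    have "(\<integral>\<^sup>+u. ennreal (indicator {s<..t} u * q u) \<partial>lborel) = (\<integral>\<^sup>+u\<in>{s<..t}. p u \<partial>lborel)"
    proof (rule nn_integral_cong_AE)
      show "AE u in lborel. ennreal (indicator {s<..t} u * q u) = p u * indicator {s<..t} u"
        using AEp by eventually_elim (use that in \<open>auto simp: q_def indicator_def less_top split: if_splits\<close>)
    qed
    with pint[OF that(2)] show ?thesis by simp
  qed
  have q: "integrable lborel q"
  proof (rule integrableI_nonneg)
    have "(\<integral>\<^sup>+u. ennreal (q u) \<partial>lborel) = (\<integral>\<^sup>+u. ennreal (indicator {a<..b} u * q u) \<partial>lborel)"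
      by (intro nn_integral_cong) (auto simp: q_def indicator_def)
    then show "(\<integral>\<^sup>+u. ennreal (q u) \<partial>lborel) < \<infinity>" using qint[of a b] ab by simp
  qed (auto simp: q_def)
  have qset: "(LINT u:{s<..t}|lborel. q u) = h t - h s" if "a \<le> s" "s \<le> t" "t \<le> b" for s t
    unfolding set_lebesgue_integral_def
    using qint[OF that] hm[OF that(2)] by (subst integral_eq_nn_integral) (auto simp: q_def)
  \<comment> \<open>On \<open>{a..b}\<close> one has \<open>h = f + N\<close>, where
    \<open>h\<close> has density \<open>q\<close> and \<open>N\<close> has density
    \<open>w\<close>.\<close>
  show ?thesis
  proof (intro exI[of _ "\<lambda>u. q u - w u"] conjI allI impI)
    fix s t assume st: "a \<le> s" "s \<le> t" "t \<le> b"
    have "(LINT u:{s..t}|lborel. q u - w u) = (LINT u:{s<..t}|lborel. q u - w u)"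
      using q w by (subst set_integral_Ioc_eq_Icc) auto
    also have "\<dots> = (LINT u:{s<..t}|lborel. q u) - (LINT u:{s<..t}|lborel. w u)"
      using q w integrable_mult_indicator[of "{s<..t}" lborel q] integrable_mult_indicator[of "{s<..t}" lborel w]
      by (intro set_integral_diff) (auto simp: set_integrable_def)
    also have "\<dots> = f t - f s" using qset[OF st] Ndiff[OF st(2)] c(4) st by (simp add: h_def)
    finally show "f t - f s = (LINT u:{s..t}|lborel. q u - w u)" ..
  qed (use q w in auto)
qed (auto intro!: exI[of _ "\<lambda>_. 0"])

lemma abs_cont_AE_has_derivative:
  fixes f m :: "real \<Rightarrow> real"
  assumes "set_integrable lborel {a..b} m"
    and "\<And>s t. a \<le> s \<Longrightarrow> s \<le> t \<Longrightarrow> t \<le> b \<Longrightarrow> \<bar>f t - f s\<bar> \<le> (LINT u:{s..t}|lborel. m u)"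
  obtains g where "integrable lborel g"
    "\<And>s t. a \<le> s \<Longrightarrow> s \<le> t \<Longrightarrow> t \<le> b \<Longrightarrow> f t - f s = (LINT u:{s..t}|lborel. g u)"
    "AE t in lborel. a < t \<and> t < b \<longrightarrow> (f has_real_derivative g t) (at t)"
proof -
  obtain g where g: "integrable lborel g"
    "\<And>s t. a \<le> s \<Longrightarrow> s \<le> t \<Longrightarrow> t \<le> b \<Longrightarrow> f t - f s = (LINT u:{s..t}|lborel. g u)"
    using abs_cont_imp_indefinite_integral[OF assms] by blast
  from AE_has_derivative_indefinite_integral[of g a b f, OF this] that[OF this] show thesis by blast
qed

section \<open>Subgradients of convex functions\<close>

definition sublinear_on :: "'v::real_vector set \<Rightarrow> ('v \<Rightarrow> real) \<Rightarrow> bool" where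
  "sublinear_on V q \<longleftrightarrow> (\<forall>x\<in>V. \<forall>y\<in>V. q (x + y) \<le> q x + q y) \<and>
     (\<forall>x\<in>V. \<forall>c>0. q (c *\<^sub>R x) = c * q x)"

text \<open>Homogeneity at 0 with the factor 2 reads \<open>q 0 = 2 * q 0\<close>.\<close>

lemma sublinear_on_zero:
  assumes "subspace V" "sublinear_on V q"
  shows "q 0 = 0"
  using assms unfolding sublinear_on_def subspace_def
  by (auto dest!: bspec[of V _ 0] spec[of _ "2::real"])

lemma sublinear_on_lower:
  assumes "subspace V" "sublinear_on V q" "x \<in> V" "y \<in> V"
  shows "q y - q (- x) \<le> q (x + y)"
proof -
  have "q ((x + y) + (- x)) \<le> q (x + y) + q (- x)"
    using assms subspace_add[OF assms(1,3,4)] subspace_neg[OF assms(1,3)] unfolding sublinear_on_def by blast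
  then show ?thesis by simp
qed

text \<open>The reverse inequality is the given one for the factor \<open>1 / c\<close> at the point
  \<open>c *\<^sub>R x\<close>.\<close>

lemma sublinear_onI_scale_le:
  assumes "subspace V" "\<And>x y. x \<in> V \<Longrightarrow> y \<in> V \<Longrightarrow> q (x + y) \<le> q x + q y"
    and le: "\<And>x c. x \<in> V \<Longrightarrow> 0 < c \<Longrightarrow> q (c *\<^sub>R x) \<le> c * q x"
  shows "sublinear_on V q"
  unfolding sublinear_on_def
proof (intro conjI ballI allI impI)
  fix x c assume x: "x \<in> V" "0 < (c::real)"
  have "q ((1/c) *\<^sub>R (c *\<^sub>R x)) \<le> (1/c) * q (c *\<^sub>R x)"
    using x assms(1) by (intro le subspace_scale) auto
  then have "c * q x \<le> q (c *\<^sub>R x)" using x by (simp add: field_simps)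
  with le[OF x] show "q (c *\<^sub>R x) = c * q x" by simp
qed (use assms in auto)

text \<open>A minimal sublinear functional is linear; this replaces the extension step of the usual proof of
  the Hahn--Banach theorem.\<close>

lemma linear_minorant_of_sublinear:
  assumes V: "subspace V" and p: "sublinear_on V p"
  obtains P where "\<And>x y. x \<in> V \<Longrightarrow> y \<in> V \<Longrightarrow> P (x + y) = P x + P y"
    "\<And>c x. x \<in> V \<Longrightarrow> P (c *\<^sub>R x) = c * P x" "\<And>x. x \<in> V \<Longrightarrow> P x \<le> p x"
proof -
  note Vs = subspace_add[OF V] subspace_scale[OF V] subspace_neg[OF V] subspace_0[OF V]
  \<comment> \<open>Prescribing 0 outside \<open>V\<close> prevents values there from being lowered
    indefinitely, so minimality concerns \<open>V\<close> alone. The order \<open>R\<close> is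
    reversed because Zorn's lemma delivers maximal elements.\<close>
  define A where "A = {q. sublinear_on V q \<and> (\<forall>x. x \<notin> V \<longrightarrow> q x = 0) \<and> (\<forall>x\<in>V. q x \<le> p x)}"
  define R where "R = (\<lambda>q q' :: 'a \<Rightarrow> real. \<forall>x. q' x \<le> q x)"
  \<comment> \<open>A lower bound common to all members of \<open>A\<close>; it keeps the infimum
    over a chain finite.\<close>
  have lower: "- p (- x) \<le> q x" if "q \<in> A" "x \<in> V" for q x
  proof -
    have "- q (- x) \<le> q x"
      using sublinear_on_lower[OF V, of q x 0] sublinear_on_zero[OF V, of q] that Vs by (auto simp: A_def)
    moreover have "q (- x) \<le> p (- x)" using that Vs by (auto simp: A_def)
    ultimately show ?thesis by linarith
  qed
  have "\<exists>m\<in>A. \<forall>a\<in>A. R m a \<longrightarrow> a = m"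
  proof (rule predicate_Zorn)
    show "partial_order_on A (relation_of R A)"
      by (rule partial_order_on_relation_ofI) (auto simp: R_def fun_eq_iff intro: order.trans antisym)
    fix C assume "C \<in> Chains (relation_of R A)"
    then have CA: "C \<subseteq> A" and tot: "\<And>q q'. q \<in> C \<Longrightarrow> q' \<in> C \<Longrightarrow> R q q' \<or> R q' q"
      by (auto simp: Chains_def relation_of_def)
    show "\<exists>u\<in>A. \<forall>a\<in>C. R a u"
    proof (cases "C = {}")
      case True
      have "sublinear_on V (\<lambda>x. if x \<in> V then p x else 0)"
        using p Vs by (auto simp: sublinear_on_def)
      then have "(\<lambda>x. if x \<in> V then p x else 0) \<in> A" by (auto simp: A_def)
      with True show ?thesis by blast
    next
      case False
      define u where "u x = (if x \<in> V then INF q\<in>C. q x else 0)" for x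
      have bdd: "bdd_below ((\<lambda>q. q x) ` C)" if "x \<in> V" for x
        using lower[OF _ that] CA by (auto intro!: bdd_belowI2)
      have u_le: "u x \<le> q x" if "q \<in> C" for q x
        using that CA bdd by (auto simp: u_def A_def intro!: cINF_lower)
      have "sublinear_on V u"
      proof (rule sublinear_onI_scale_le[OF V])
        fix x y assume xy: "x \<in> V" "y \<in> V"
        \<comment> \<open>Two members of the chain occur on the right. They are comparable, and the
          smaller one \<open>r\<close> serves both arguments.\<close>
        have *: "u (x + y) \<le> q x + q' y" if q: "q \<in> C" "q' \<in> C" for q q'
        proof -
          obtain r where r: "r \<in> C" "r x \<le> q x" "r y \<le> q' y"
            using tot[OF q] q unfolding R_def by blast
          have "u (x + y) \<le> r x + r y"
            using u_le[OF r(1), of "x + y"] r(1) CA xy by (force simp: A_def sublinear_on_def)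
          with r show ?thesis by linarith
        qed
        have "u (x + y) - q x \<le> q' y" if "q \<in> C" "q' \<in> C" for q q'
          using *[OF that] by linarith
        then have "u (x + y) - q x \<le> u y" if "q \<in> C" for q
          unfolding u_def[of y] using that False xy by (auto intro!: cINF_greatest)
        then have "u (x + y) - u y \<le> q x" if "q \<in> C" for q
          using that by (metis diff_le_eq add.commute)
        then have "u (x + y) - u y \<le> u x"
          unfolding u_def[of x] using False xy by (auto intro!: cINF_greatest)
        then show "u (x + y) \<le> u x + u y" by simp
      next
        fix x and c :: real assume xc: "x \<in> V" "0 < c"
        have "u (c *\<^sub>R x) / c \<le> q x" if "q \<in> C" for q
        proof -
          have "q (c *\<^sub>R x) = c * q x" using that CA xc by (auto simp: A_def sublinear_on_def)
          then show ?thesis using u_le[OF that, of "c *\<^sub>R x"] xc by (simp add: field_simps)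
        qed
        then have "u (c *\<^sub>R x) / c \<le> u x"
          unfolding u_def[of x] using False xc by (auto intro!: cINF_greatest)
        then show "u (c *\<^sub>R x) \<le> c * u x" using xc by (simp add: field_simps)
      qed
      moreover have "\<forall>x\<in>V. u x \<le> p x"
      proof
        fix x assume "x \<in> V"
        obtain q where "q \<in> C" using False by auto
        then show "u x \<le> p x" using u_le[of q x] CA \<open>x \<in> V\<close> by (force simp: A_def)
      qed
      ultimately have "u \<in> A" by (auto simp: A_def u_def)
      then show ?thesis using u_le by (auto simp: R_def)
    qed
  qed
  then obtain m where m: "m \<in> A" and min: "\<And>a. a \<in> A \<Longrightarrow> (\<And>x. a x \<le> m x) \<Longrightarrow> a = m"
    by (auto simp: R_def)
  have ms: "sublinear_on V m" using m by (simp add: A_def)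
  have hom: "m (c *\<^sub>R x) = c * m x" if "x \<in> V" "0 < c" for x c
    using ms that by (auto simp: sublinear_on_def)
  have sub: "m (x + y) \<le> m x + m y" if "x \<in> V" "y \<in> V" for x y
    using ms that by (auto simp: sublinear_on_def)
  have m0: "m 0 = 0" using sublinear_on_zero[OF V ms] .
  have add: "m (x + y) = m x + m y" if xy: "x \<in> V" "y \<in> V" for x y
  proof -
    \<comment> \<open>\<open>w\<close> is the lowering of \<open>m\<close> in direction
      \<open>y\<close>. It is sublinear and below \<open>m\<close>, so minimality forces
      \<open>w = m\<close>; the choice \<open>t = 1\<close> in the infimum then gives
      \<open>m x + m y \<le> m (x + y)\<close>.\<close>
    define w where "w z = (if z \<in> V then INF t\<in>{0..}. m (z + t *\<^sub>R y) - t * m y else 0)" for z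
    have bdd: "bdd_below ((\<lambda>t. m (z + t *\<^sub>R y) - t * m y) ` {0..})" if "z \<in> V" for z
    proof (rule bdd_belowI2)
      fix t :: real assume t: "t \<in> {0..}"
      have "m (t *\<^sub>R y) = t * m y" using hom[of y t] m0 xy t by (cases "t = 0") auto
      then show "- m (- z) \<le> m (z + t *\<^sub>R y) - t * m y"
        using sublinear_on_lower[OF V ms that, of "t *\<^sub>R y"] xy Vs by auto
    qed
    have w_le: "w z \<le> m (z + t *\<^sub>R y) - t * m y" if "z \<in> V" "0 \<le> t" for z t
      using that cINF_lower[OF bdd[OF that(1)], of t] by (simp add: w_def)
    have w_m: "w z \<le> m z" for z
      using w_le[of z 0] m by (cases "z \<in> V") (auto simp: w_def A_def)
    have w_ge: "k \<le> w z" if "z \<in> V" "\<And>t. 0 \<le> t \<Longrightarrow> k \<le> m (z + t *\<^sub>R y) - t * m y" for k z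
      unfolding w_def using that by (auto intro!: cINF_greatest)
    have "sublinear_on V w"
    proof (rule sublinear_onI_scale_le[OF V])
      fix z z' assume z: "z \<in> V" "z' \<in> V"
      have *: "w (z + z') \<le> (m (z + t *\<^sub>R y) - t * m y) + (m (z' + t' *\<^sub>R y) - t' * m y)"
        if "0 \<le> t" "0 \<le> t'" for t t'
      proof -
        have "w (z + z') \<le> m ((z + z') + (t + t') *\<^sub>R y) - (t + t') * m y"
          using z that Vs by (intro w_le) auto
        also have "(z + z') + (t + t') *\<^sub>R y = (z + t *\<^sub>R y) + (z' + t' *\<^sub>R y)" by (simp add: algebra_simps)
        also have "m \<dots> \<le> m (z + t *\<^sub>R y) + m (z' + t' *\<^sub>R y)" using z xy Vs by (intro sub) auto
        finally show ?thesis by (simp add: algebra_simps)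
      qed
      have "w (z + z') - (m (z + t *\<^sub>R y) - t * m y) \<le> w z'" if "0 \<le> t" for t
        using *[OF that] z by (intro w_ge) (auto simp: algebra_simps)
      then have "w (z + z') - w z' \<le> w z"
        using z by (intro w_ge) (auto simp: algebra_simps)
      then show "w (z + z') \<le> w z + w z'" by simp
    next
      fix z and c :: real assume z: "z \<in> V" "0 < c"
      have "w (c *\<^sub>R z) / c \<le> w z"
      proof (rule w_ge[OF z(1)])
        fix t :: real assume t: "0 \<le> t"
        have "w (c *\<^sub>R z) \<le> m (c *\<^sub>R z + (c * t) *\<^sub>R y) - (c * t) * m y"
          using z t Vs by (intro w_le) auto
        also have "c *\<^sub>R z + (c * t) *\<^sub>R y = c *\<^sub>R (z + t *\<^sub>R y)" by (simp add: algebra_simps)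
        also have "m \<dots> = c * m (z + t *\<^sub>R y)" using z xy Vs by (intro hom) auto
        finally show "w (c *\<^sub>R z) / c \<le> m (z + t *\<^sub>R y) - t * m y" using z by (simp add: field_simps)
      qed
      then show "w (c *\<^sub>R z) \<le> c * w z" using z by (simp add: field_simps)
    qed
    moreover have "\<forall>z\<in>V. w z \<le> p z" using w_m m by (force simp: A_def intro: order.trans)
    ultimately have "w \<in> A" by (auto simp: A_def w_def)
    then have "w = m" using w_m min by blast
    then have "m x \<le> m (x + y) - m y" using w_le[OF xy(1), of 1] by simp
    with sub[OF xy] show ?thesis by linarith
  qed
  have neg: "m (- x) = - m x" if "x \<in> V" for x using add[of x "- x"] m0 that Vs by simp
  have "m (c *\<^sub>R x) = c * m x" if "x \<in> V" for c x
  proof (cases c "0::real" rule: linorder_cases)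
    case less
    then show ?thesis using hom[of "- x" "- c"] neg[OF that] that Vs by simp
  qed (use hom m0 that in auto)
  then show thesis using that[of m] add m by (auto simp: A_def)
qed

text \<open>\<open>G\<close> stands for the epigraph of a convex function with value at least
  \<open>a0\<close> at 0; working with \<open>G\<close> admits infinite values and infima that are
  not attained. The infimum \<open>p x\<close> of the slopes \<open>(a - a0) / s\<close> is the
  directional derivative at 0 when \<open>a0\<close> is the value there. It is sublinear, and a
  linear minorant of it is a subgradient.\<close>

lemma convex_epigraph_subgradient:
  fixes G :: "('v::real_vector \<times> real) set"
  assumes V: "subspace V"
    and dom: "\<And>x a. (x, a) \<in> G \<Longrightarrow> x \<in> V"
    and conv: "\<And>x y a b u v. (x, a) \<in> G \<Longrightarrow> (y, b) \<in> G \<Longrightarrow> 0 < u \<Longrightarrow> 0 < v \<Longrightarrow> u + v = 1 \<Longrightarrow>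
      (u *\<^sub>R x + v *\<^sub>R y, u * a + v * b) \<in> G"
    and absorb: "\<And>x. x \<in> V \<Longrightarrow> \<exists>s>0. \<exists>a. (s *\<^sub>R x, a) \<in> G"
    and zero: "\<And>a. (0, a) \<in> G \<Longrightarrow> a0 \<le> a"
  obtains P where "\<And>x y. x \<in> V \<Longrightarrow> y \<in> V \<Longrightarrow> P (x + y) = P x + P y"
    "\<And>c x. x \<in> V \<Longrightarrow> P (c *\<^sub>R x) = c * P x" "\<And>x a. (x, a) \<in> G \<Longrightarrow> P x \<le> a - a0"
proof -
  define S where "S x = {(a - a0) / s | s a. 0 < s \<and> (s *\<^sub>R x, a) \<in> G}" for x
  define p where "p x = Inf (S x)" for x
  have ne: "S x \<noteq> {}" if "x \<in> V" for x using absorb[OF that] by (auto simp: S_def)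
  \<comment> \<open>The weights are chosen so that \<open>s *\<^sub>R x\<close> and
    \<open>t *\<^sub>R y\<close> end up with the same factor \<open>s * t / (s + t)\<close>.\<close>
  have comb: "((s * t / (s + t)) *\<^sub>R (x + y), (t * a + s * b) / (s + t)) \<in> G"
    if "0 < s" "0 < t" "(s *\<^sub>R x, a) \<in> G" "(t *\<^sub>R y, b) \<in> G" for s t x y a b
    using conv[OF that(3,4), of "t / (s + t)" "s / (s + t)"] that(1,2)
    by (simp add: add_divide_distrib[symmetric] scaleR_add_right mult.commute)
  have bdd: "bdd_below (S x)" if "x \<in> V" for x
  proof -
    obtain t b where t: "0 < t" "(t *\<^sub>R (- x), b) \<in> G" using absorb[OF subspace_neg[OF V \<open>x \<in> V\<close>]] by auto
    \<comment> \<open>Combining the directions \<open>x\<close> and \<open>- x\<close> lands at 0,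
      where heights are at least \<open>a0\<close>. Thus a single slope towards \<open>- x\<close>
      bounds all slopes towards \<open>x\<close> from below.\<close>
    have "- ((b - a0) / t) \<le> (a - a0) / s" if "0 < s" "(s *\<^sub>R x, a) \<in> G" for s a
    proof -
      have "a0 \<le> (t * a + s * b) / (s + t)" using comb[OF that(1) t(1) that(2) t(2)] zero by simp
      then show ?thesis using that t by (simp add: field_simps)
    qed
    then show ?thesis by (auto simp: S_def intro!: bdd_belowI)
  qed
  have p_le: "p x \<le> (a - a0) / s" if "0 < s" "(s *\<^sub>R x, a) \<in> G" "x \<in> V" for x s a
    unfolding p_def using that by (intro cInf_lower bdd) (auto simp: S_def)
  have p_ge: "k \<le> p x" if "x \<in> V" "\<And>s a. 0 < s \<Longrightarrow> (s *\<^sub>R x, a) \<in> G \<Longrightarrow> k \<le> (a - a0) / s" for k x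
    unfolding p_def using that by (intro cInf_greatest ne) (auto simp: S_def)
  have "sublinear_on V p"
  proof (rule sublinear_onI_scale_le[OF V])
    fix x y assume xy: "x \<in> V" "y \<in> V"
    have *: "p (x + y) \<le> (a - a0) / s + (b - a0) / t"
      if "0 < s" "(s *\<^sub>R x, a) \<in> G" "0 < t" "(t *\<^sub>R y, b) \<in> G" for s t a b
    proof -
      have "p (x + y) \<le> ((t * a + s * b) / (s + t) - a0) / (s * t / (s + t))"
        using comb[OF that(1,3,2,4)] that xy subspace_add[OF V] by (intro p_le) auto
      also have "\<dots> = (a - a0) / s + (b - a0) / t"
      proof -
        have "(t * a + s * b) / (s + t) - a0 = (t * (a - a0) + s * (b - a0)) / (s + t)"
          using that by (simp add: field_simps)
        moreover have "(t * (a - a0) + s * (b - a0)) / (s + t) / (s * t / (s + t)) = (t * (a - a0) + s * (b - a0)) / (s * t)"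
          using that by simp
        ultimately show ?thesis using that by (simp add: add_divide_distrib)
      qed
      finally show ?thesis .
    qed
    have "p (x + y) - (a - a0) / s \<le> p y" if "0 < s" "(s *\<^sub>R x, a) \<in> G" for s a
      using *[OF that] xy by (intro p_ge) (auto simp: algebra_simps)
    then have "p (x + y) - p y \<le> p x" using xy by (intro p_ge) (auto simp: algebra_simps)
    then show "p (x + y) \<le> p x + p y" by simp
  next
    fix x and c :: real assume x: "x \<in> V" "0 < c"
    have "p (c *\<^sub>R x) / c \<le> p x"
    proof (rule p_ge[OF x(1)])
      fix s a assume s: "0 < s" "(s *\<^sub>R x, a) \<in> G"
      have "p (c *\<^sub>R x) \<le> (a - a0) / (s / c)" using s x subspace_scale[OF V] by (intro p_le) auto
      then show "p (c *\<^sub>R x) / c \<le> (a - a0) / s" using x by (simp add: field_simps)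
    qed
    then show "p (c *\<^sub>R x) \<le> c * p x" using x by (simp add: field_simps)
  qed
  then obtain P where P: "\<And>x y. x \<in> V \<Longrightarrow> y \<in> V \<Longrightarrow> P (x + y) = P x + P y"
    "\<And>c x. x \<in> V \<Longrightarrow> P (c *\<^sub>R x) = c * P x" "\<And>x. x \<in> V \<Longrightarrow> P x \<le> p x"
    using linear_minorant_of_sublinear[OF V] by blast
  have "P x \<le> a - a0" if "(x, a) \<in> G" for x a
    using P(3)[OF dom[OF that]] p_le[of 1 x a] that dom[OF that] by simp
  with P(1,2) show thesis by (rule that)
qed

section \<open>Geometry of the cone and absolutely continuous paths\<close>

text \<open>The Taylor remainder gives sin u \<ge> u - u^3 / 6, and u \<le> pi / 2 < 2 bounds u^3 by
  4 u. The value of the slope is unimportant; the factors 3 and 6 in the cone estimates below come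
  from here.\<close>

lemma sin_ge_third:
  fixes u :: real
  assumes "0 \<le> u" "u \<le> pi / 2"
  shows "u / 3 \<le> sin u"
proof -
  have "u \<le> 2" using assms(2) pi_less_4 by linarith
  have "(\<Sum>m<3. sin_coeff m * u ^ m) = u"
    by (simp add: numeral_3_eq_3 sin_coeff_def)
  then have "\<bar>sin u - u\<bar> \<le> inverse (fact 3) * \<bar>u\<bar> ^ 3"
    using Maclaurin_sin_bound[of u 3] by simp
  also have "\<dots> = u ^ 3 / 6" using assms by (simp add: fact_numeral field_simps)
  also have "\<dots> \<le> u * 4 / 6"
    using mult_left_mono[OF mult_mono[of u 2 u 2], of u] \<open>u \<le> 2\<close> assms by (simp add: power3_eq_cube)
  finally show ?thesis using assms by linarith
qed

lemma pi_r_nonneg [simp]: "0 \<le> pi_r c"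
  by (rule cone_cases[of c]) (simp add: pi_r_cone_point)

lemma pi_r_apex [simp]: "pi_r apex = 0"
  unfolding apex_def by (simp add: pi_r_cone_point)

lemma cone_point_pi [simp]: "cone_point (pi_x xbar c) (pi_r c) = c"
proof -
  obtain x r where c: "0 \<le> r" "c = cone_point x r" by (rule cone_cases)
  then show ?thesis
    by (cases "r = 0") (simp_all add: pi_r_cone_point pi_x_cone_point cone_point_0 less_le)
qed

lemma pi_r_eq_0_iff [simp]: "pi_r c = 0 \<longleftrightarrow> c = apex"
  by (metis cone_point_0 cone_point_pi pi_r_apex)

lemma pi_r_pos_iff: "0 < pi_r c \<longleftrightarrow> c \<noteq> apex"
  using pi_r_nonneg[of c] pi_r_eq_0_iff[of c] by linarith

lemma pi_x_in_cone_over: "c \<in> cone_over M \<Longrightarrow> xbar \<in> M \<Longrightarrow> pi_x xbar c \<in> M"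
proof -
  assume "c \<in> cone_over M" "xbar \<in> M"
  then obtain x r where "x \<in> M" "0 \<le> r" "c = cone_point x r" by (auto simp: cone_over_def)
  with \<open>xbar \<in> M\<close> show ?thesis
    by (cases "r = 0") (simp_all add: pi_x_cone_point cone_point_0 pi_x_apex less_le)
qed

definition cone_angle :: "'a::metric_space \<Rightarrow> 'a cone \<Rightarrow> 'a cone \<Rightarrow> real" where
  "cone_angle xbar c d = min (dist (pi_x xbar c) (pi_x xbar d)) pi"

lemma cone_angle_bounds: "0 \<le> cone_angle xbar c d" "cone_angle xbar c d \<le> pi"
  by (auto simp: cone_angle_def)

text \<open>The half-angle formula turns the law of cosines into a sum of two nonnegative terms, one
  radial and one angular, which can be estimated separately.\<close>

lemma cone_point_dist_sq:
  assumes "0 \<le> r" "0 \<le> s"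
  shows "(dist (cone_point x r) (cone_point y s))\<^sup>2
    = (r - s)\<^sup>2 + 4 * r * s * (sin (min (dist x y) pi / 2))\<^sup>2"
proof -
  define a where "a = min (dist x y) pi"
  have "cos a = 1 - 2 * (sin (a / 2))\<^sup>2" using cos_double_sin[of "a / 2"] by simp
  then have "r\<^sup>2 + s\<^sup>2 - 2 * r * s * cos a = r\<^sup>2 + s\<^sup>2 - 2 * r * s * (1 - 2 * (sin (a / 2))\<^sup>2)"
    by (simp only:)
  also have "\<dots> = (r - s)\<^sup>2 + 4 * r * s * (sin (a / 2))\<^sup>2"
    by (simp add: power2_eq_square algebra_simps)
  finally have eq: "r\<^sup>2 + s\<^sup>2 - 2 * r * s * cos a = (r - s)\<^sup>2 + 4 * r * s * (sin (a / 2))\<^sup>2" .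
  have "dist (cone_point x r) (cone_point y s) = sqrt (r\<^sup>2 + s\<^sup>2 - 2 * r * s * cos a)"
    using assms by (simp add: dist_cone_def cone_dist_cone_point planar_dist_def a_def)
  then show ?thesis unfolding eq a_def[symmetric] using assms by simp
qed

lemma cone_dist_sq:
  "(dist c d)\<^sup>2 = (pi_r c - pi_r d)\<^sup>2 + 4 * pi_r c * pi_r d * (sin (cone_angle xbar c d / 2))\<^sup>2"
  using cone_point_dist_sq[of "pi_r c" "pi_r d" "pi_x xbar c" "pi_x xbar d"]
  by (simp add: cone_angle_def)

lemma dist_apex [simp]: "dist c apex = pi_r c" "dist apex c = pi_r c"
proof -
  have "(dist c apex)\<^sup>2 = (pi_r c)\<^sup>2" using cone_dist_sq[of c apex undefined] by simp
  then show "dist c apex = pi_r c" by (simp add: power2_eq_iff_nonneg)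
  then show "dist apex c = pi_r c" by (simp add: dist_commute)
qed

lemma pi_r_dist_le: "\<bar>pi_r c - pi_r d\<bar> \<le> dist c d"
  using abs_dist_diff_le[of c apex d] by (simp add: dist_commute)

text \<open>Away from the apex the angular term alone controls the angle: for radii at least
  \<open>e\<close> it is at least 4 e^2 (a / 6)^2 = (e a / 3)^2, where a is the angle.\<close>

lemma cone_angle_le_dist:
  assumes "0 < e" "e \<le> pi_r c" "e \<le> pi_r d"
  shows "cone_angle xbar c d \<le> 3 / e * dist c d"
proof -
  define a where "a = cone_angle xbar c d"
  have a: "0 \<le> a" "a \<le> pi" using cone_angle_bounds[of xbar c d] by (auto simp: a_def)
  have s: "a / 6 \<le> sin (a / 2)" using sin_ge_third[of "a / 2"] a by simp
  have "(e * a / 3)\<^sup>2 = 4 * e * e * (a / 6)\<^sup>2" by (simp add: power2_eq_square)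
  also have "\<dots> \<le> 4 * pi_r c * pi_r d * (sin (a / 2))\<^sup>2"
    using assms a s by (intro mult_mono power_mono) auto
  also have "\<dots> \<le> (dist c d)\<^sup>2" unfolding cone_dist_sq[of c d xbar] a_def by simp
  finally have "e * a / 3 \<le> dist c d" by (rule power2_le_imp_le) simp
  then show ?thesis using assms by (simp add: a_def field_simps)
qed

text \<open>The angle stops growing at \<open>pi\<close>, so it controls the distance of base points
  only when that distance has a bound \<open>D\<close>; beyond \<open>pi\<close> the loss is the
  factor \<open>D / pi\<close>.\<close>

lemma dist_pi_x_le:
  assumes "0 < e" "e \<le> pi_r c" "e \<le> pi_r d" "dist (pi_x xbar c) (pi_x xbar d) \<le> D" "pi \<le> D"
  shows "dist (pi_x xbar c) (pi_x xbar d) \<le> D / pi * (3 / e) * dist c d"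
proof -
  have "dist (pi_x xbar c) (pi_x xbar d) \<le> D / pi * cone_angle xbar c d"
  proof (cases "dist (pi_x xbar c) (pi_x xbar d) \<le> pi")
    case True
    have "1 * dist (pi_x xbar c) (pi_x xbar d) \<le> D / pi * dist (pi_x xbar c) (pi_x xbar d)"
      using assms by (intro mult_right_mono) auto
    then show ?thesis using True by (simp add: cone_angle_def)
  qed (use assms in \<open>simp add: cone_angle_def\<close>)
  also have "\<dots> \<le> D / pi * (3 / e * dist c d)"
    using assms order.trans[OF pi_ge_zero assms(5)]
    by (intro mult_left_mono cone_angle_le_dist divide_nonneg_nonneg) auto
  finally show ?thesis by (simp add: mult.assoc)
qed

lemma continuous_on_pi_r [continuous_intros]: "continuous_on S f \<Longrightarrow> continuous_on S (\<lambda>x. pi_r (f x))"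
  using continuous_on_dist[of S f "\<lambda>_. apex"] by simp

lemma isCont_pi_x:
  assumes "c \<noteq> apex"
  shows "isCont (pi_x xbar) c"
  unfolding isCont_def
proof (rule tendstoI)
  fix e :: real assume "0 < e"
  define \<epsilon> where "\<epsilon> = pi_r c / 2"
  have \<epsilon>: "0 < \<epsilon>" using assms pi_r_nonneg[of c] pi_r_eq_0_iff[of c] by (simp add: \<epsilon>_def less_le)
  \<comment> \<open>\<delta> \<le> \<epsilon> keeps \<open>d\<close> away from the apex. The other
    bound puts the angle strictly below \<open>min e pi\<close>, hence below the cutoff, where it is
    the distance of the base points.\<close>
  define \<delta> where "\<delta> = min \<epsilon> (min e pi * \<epsilon> / 3)"
  have "0 < \<delta>" using \<epsilon> \<open>0 < e\<close> by (simp add: \<delta>_def)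
  have "dist (pi_x xbar d) (pi_x xbar c) < e" if d: "dist d c < \<delta>" for d
  proof -
    have "dist d c < pi_r c / 2" using d by (simp add: \<delta>_def \<epsilon>_def)
    then have "\<epsilon> \<le> pi_r d" using pi_r_dist_le[of d c] unfolding \<epsilon>_def by linarith
    then have "cone_angle xbar d c \<le> 3 / \<epsilon> * dist d c" using \<epsilon> by (intro cone_angle_le_dist) (auto simp: \<epsilon>_def)
    also have "\<dots> < 3 / \<epsilon> * (min e pi * \<epsilon> / 3)" using d \<epsilon> by (intro mult_strict_left_mono) (auto simp: \<delta>_def)
    also have "\<dots> = min e pi" using \<epsilon> by simp
    finally show ?thesis by (auto simp: cone_angle_def min_def split: if_splits)
  qed
  then show "\<forall>\<^sub>F d in at c. dist (pi_x xbar d) (pi_x xbar c) < e"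
    using \<open>0 < \<delta>\<close> by (auto simp: eventually_at)
qed

section \<open>Differentiability and speed of absolutely continuous paths\<close>

lemma abs_cont_pathE:
  assumes "abs_cont_path T z"
  obtains m where "set_integrable lborel {0..T} m"
    "\<And>s t. 0 \<le> s \<Longrightarrow> s \<le> t \<Longrightarrow> t \<le> T \<Longrightarrow> dist (z s) (z t) \<le> (LINT u:{s..t}|lborel. m u)"
  using assms unfolding abs_cont_path_def by blast

lemma abs_cont_path_pi_r:
  assumes "abs_cont_path T z"
  obtains g where "integrable lborel g"
    "\<And>s t. 0 \<le> s \<Longrightarrow> s \<le> t \<Longrightarrow> t \<le> T \<Longrightarrow> pi_r (z t) - pi_r (z s) = (LINT u:{s..t}|lborel. g u)"
    "AE t in lborel. 0 < t \<and> t < T \<longrightarrow> ((\<lambda>t. pi_r (z t)) has_real_derivative g t) (at t)"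
proof -
  obtain m where m: "set_integrable lborel {0..T} m"
    "\<And>s t. 0 \<le> s \<Longrightarrow> s \<le> t \<Longrightarrow> t \<le> T \<Longrightarrow> dist (z s) (z t) \<le> (LINT u:{s..t}|lborel. m u)"
    using abs_cont_pathE[OF assms] by blast
  have "\<bar>pi_r (z t) - pi_r (z s)\<bar> \<le> (LINT u:{s..t}|lborel. m u)" if "0 \<le> s" "s \<le> t" "t \<le> T" for s t
    using pi_r_dist_le[of "z t" "z s"] m(2)[OF that] by (simp add: dist_commute)
  from abs_cont_AE_has_derivative[OF m(1) this] that show thesis by blast
qed

text \<open>The base point is a Lipschitz function of the cone point only away from the apex. On an
  interval where the radius has a positive lower bound, its coordinates are absolutely continuous;
  intervals of this kind with rational endpoints are countably many and cover all times with
  \<open>r > 0\<close>.\<close>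

lemma abs_cont_path_pi_x_differentiable:
  fixes z :: "real \<Rightarrow> 'a::euclidean_space cone"
  assumes z: "abs_cont_path T z" "continuous_on {0..T} z" "z ` {0..T} \<subseteq> cone_over M"
    and M: "bounded M" "xbar \<in> M"
  shows "AE t in lborel. 0 < t \<and> t < T \<and> 0 < pi_r (z t) \<longrightarrow> (\<lambda>t. pi_x xbar (z t)) differentiable (at t)"
proof -
  let ?x = "\<lambda>t. pi_x xbar (z t)"
  obtain m where m: "set_integrable lborel {0..T} m"
    "\<And>s t. 0 \<le> s \<Longrightarrow> s \<le> t \<Longrightarrow> t \<le> T \<Longrightarrow> dist (z s) (z t) \<le> (LINT u:{s..t}|lborel. m u)"
    using abs_cont_pathE[OF z(1)] by blast
  obtain D0 where D0: "\<And>x y. x \<in> M \<Longrightarrow> y \<in> M \<Longrightarrow> dist x y \<le> D0"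
    using M(1) by (auto simp: bounded_two_points)
  define D where "D = max D0 pi"
  have xM: "?x t \<in> M" if "t \<in> {0..T}" for t using that z(3) M(2) by (intro pi_x_in_cone_over) auto
  have D: "dist (?x s) (?x t) \<le> D" if "s \<in> {0..T}" "t \<in> {0..T}" for s t
    using D0[OF xM[OF that(1)] xM[OF that(2)]] by (simp add: D_def)
  define pos where "pos p q \<longleftrightarrow> 0 \<le> p \<and> p < q \<and> q \<le> T \<and> (\<exists>e>0. \<forall>t\<in>{p..q}. e \<le> pi_r (z t))" for p q
  have ae: "AE t in lborel. p < t \<and> t < q \<longrightarrow> ?x differentiable (at t)" if pq: "pos p q" for p q
  proof -
    obtain e where e: "0 < e" "\<And>t. t \<in> {p..q} \<Longrightarrow> e \<le> pi_r (z t)" using pq by (auto simp: pos_def)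
    define C where "C = D / pi * (3 / e)"
    have "0 \<le> C" using e pi_ge_zero unfolding C_def D_def
      by (intro mult_nonneg_nonneg divide_nonneg_nonneg) (auto simp: max.coboundedI2)
    have mi: "set_integrable lborel {p..q} (\<lambda>u. C * m u)"
      using pq set_integrable_subset[OF m(1), of "{p..q}"] by (auto simp: pos_def)
    have "AE t in lborel. p < t \<and> t < q \<longrightarrow> (\<lambda>t. ?x t \<bullet> i) differentiable (at t)" if i: "i \<in> Basis" for i
    proof -
      have bd: "\<bar>?x t \<bullet> i - ?x s \<bullet> i\<bar> \<le> (LINT u:{s..t}|lborel. C * m u)"
        if st: "p \<le> s" "s \<le> t" "t \<le> q" for s t
      proof -
        have "\<bar>?x t \<bullet> i - ?x s \<bullet> i\<bar> \<le> dist (?x s) (?x t)"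
          using Basis_le_norm[OF i, of "?x t - ?x s"] by (simp add: inner_diff_left dist_norm norm_minus_commute)
        also have "\<dots> \<le> C * dist (z s) (z t)"
          unfolding C_def using st pq e D[of s t] by (intro dist_pi_x_le) (auto simp: pos_def D_def)
        also have "\<dots> \<le> C * (LINT u:{s..t}|lborel. m u)"
          using st pq \<open>0 \<le> C\<close> by (intro mult_left_mono m(2)) (auto simp: pos_def)
        finally show ?thesis by simp
      qed
      obtain g where "AE t in lborel. p < t \<and> t < q \<longrightarrow> ((\<lambda>t. ?x t \<bullet> i) has_real_derivative g t) (at t)"
        by (rule abs_cont_AE_has_derivative[OF mi bd]) (assumption | (rule that, assumption))+
      then show ?thesis by eventually_elim (auto simp: real_differentiable_def)
    qed
    then have "AE t in lborel. \<forall>i\<in>Basis. p < t \<and> t < q \<longrightarrow> (\<lambda>t. ?x t \<bullet> i) differentiable (at t)"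
      by (rule AE_finite_allI[OF finite_Basis])
    then show ?thesis
      by eventually_elim (simp add: differentiable_componentwise_within[of ?x])
  qed
  have "AE t in lborel. \<forall>p\<in>\<rat>. \<forall>q\<in>\<rat>. pos p q \<longrightarrow> p < t \<and> t < q \<longrightarrow> ?x differentiable (at t)"
    unfolding AE_ball_countable[OF countable_rat]
  proof (intro ballI)
    fix p q
    show "AE t in lborel. pos p q \<longrightarrow> p < t \<and> t < q \<longrightarrow> ?x differentiable (at t)"
      using ae[of p q] by (cases "pos p q") simp_all
  qed
  then show ?thesis
  proof eventually_elim
    fix t assume H: "\<forall>p\<in>\<rat>. \<forall>q\<in>\<rat>. pos p q \<longrightarrow> p < t \<and> t < q \<longrightarrow> ?x differentiable (at t)"
    show "0 < t \<and> t < T \<and> 0 < pi_r (z t) \<longrightarrow> ?x differentiable (at t)"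
    proof
      assume t: "0 < t \<and> t < T \<and> 0 < pi_r (z t)"
      have "continuous_on {0..T} (\<lambda>t. pi_r (z t))" using z(2) by (intro continuous_intros)
      then obtain d where d: "0 < d"
        "\<And>s. s \<in> {0..T} \<Longrightarrow> dist s t < d \<Longrightarrow> dist (pi_r (z s)) (pi_r (z t)) < pi_r (z t) / 2"
        using t continuous_on_iff[THEN iffD1, rule_format, of "{0..T}" "\<lambda>t. pi_r (z t)" t "pi_r (z t) / 2"] by auto
      obtain p where p: "p \<in> \<rat>" "max 0 (t - d) < p" "p < t"
        using Rats_dense_in_real[of "max 0 (t - d)" t] t d by auto
      obtain q where q: "q \<in> \<rat>" "t < q" "q < min T (t + d)"
        using Rats_dense_in_real[of t "min T (t + d)"] t d by auto
      have "pos p q" unfolding pos_def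
      proof (intro conjI exI[of _ "pi_r (z t) / 2"] ballI)
        fix s assume "s \<in> {p..q}"
        then have "\<bar>pi_r (z s) - pi_r (z t)\<bar> < pi_r (z t) / 2"
          using d(2)[of s] p q by (simp add: dist_real_def abs_less_iff)
        then show "pi_r (z t) / 2 \<le> pi_r (z s)" by linarith
      qed (use p q t in auto)
      with H p q show "?x differentiable (at t)" by blast
    qed
  qed
qed

text \<open>Nothing is asked of the base point at the apex: there it is the arbitrary
  \<open>xbar\<close> and the speed does not see it.\<close>

definition good_time :: "'a::euclidean_space \<Rightarrow> (real \<Rightarrow> 'a cone) \<Rightarrow> real \<Rightarrow> bool" where
  "good_time xbar z t \<longleftrightarrow> (\<lambda>t. pi_r (z t)) differentiable (at t) \<and>
     (0 < pi_r (z t) \<longrightarrow> (\<lambda>t. pi_x xbar (z t)) differentiable (at t))"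

lemma abs_cont_path_AE_good_time:
  fixes z :: "real \<Rightarrow> 'a::euclidean_space cone"
  assumes z: "abs_cont_path T z" "continuous_on {0..T} z" "z ` {0..T} \<subseteq> cone_over M"
    and M: "bounded M" "xbar \<in> M"
  shows "AE t in lborel. 0 < t \<and> t < T \<longrightarrow> good_time xbar z t"
proof -
  obtain g where g: "AE t in lborel. 0 < t \<and> t < T \<longrightarrow> ((\<lambda>t. pi_r (z t)) has_real_derivative g t) (at t)"
    by (rule abs_cont_path_pi_r[OF z(1)]) (rule that)
  from g abs_cont_path_pi_x_differentiable[OF assms] show ?thesis
    by eventually_elim (auto simp: good_time_def real_differentiable_def)
qed

text \<open>The radius is nonnegative, so a time at the apex is a minimum.\<close>

lemma deriv_pi_r_eq_0:
  assumes "((\<lambda>t. pi_r (z t)) has_real_derivative g) (at t)" "pi_r (z t) = 0"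
  shows "g = 0"
  using DERIV_local_min[OF assms(1), of 1] assms(2) by simp

lemma norm_difference_quotient_tendsto:
  assumes "(f has_vector_derivative v) (at t)"
  shows "((\<lambda>s. norm (f s - f t) / \<bar>s - t\<bar>) \<longlongrightarrow> norm v) (at t)"
proof -
  have lim: "((\<lambda>s. norm ((f s - f t) - (s - t) *\<^sub>R v) / norm (s - t)) \<longlongrightarrow> 0) (at t)"
    using assms by (simp add: has_vector_derivative_def has_derivative_iff_norm)
  have eq: "norm ((f s - f t) - (s - t) *\<^sub>R v) / norm (s - t) = norm ((f s - f t) /\<^sub>R (s - t) - v)" if "s \<noteq> t" for s
  proof -
    have "(f s - f t) /\<^sub>R (s - t) - v = ((f s - f t) - (s - t) *\<^sub>R v) /\<^sub>R (s - t)"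
      using that by (simp add: scaleR_diff_right)
    then show ?thesis by (simp add: divide_inverse_commute abs_inverse)
  qed
  have "((\<lambda>s. norm ((f s - f t) /\<^sub>R (s - t) - v)) \<longlongrightarrow> 0) (at t)"
    by (rule Lim_transform_eventually[OF lim]) (use eq in \<open>auto simp: eventually_at_filter\<close>)
  then have "((\<lambda>s. norm ((f s - f t) /\<^sub>R (s - t))) \<longlongrightarrow> norm v) (at t)"
    by (intro tendsto_norm) (simp add: tendsto_norm_zero_iff LIM_zero_cancel)
  then show ?thesis by (simp add: divide_inverse mult.commute abs_inverse)
qed

text \<open>In the half-angle form of the distance, the radial quotient tends to the derivative of
  \<open>r\<close>, and the sine of half the distance of the base points behaves like that half
  distance. At the apex the distance is the radius itself, whose derivative vanishes, in agreement
  with the convention that the speed is 0 there.\<close>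

lemma metric_derivative_limit:
  fixes z :: "real \<Rightarrow> 'a::euclidean_space cone"
  assumes t: "0 < t" "t < T" and good: "good_time xbar z t"
  shows "((\<lambda>s. dist (z s) (z t) / \<bar>s - t\<bar>) \<longlongrightarrow> sqrt (cone_speed2 T xbar z t)) (at t)"
proof -
  let ?x = "\<lambda>t. pi_x xbar (z t)" and ?r = "\<lambda>t. pi_r (z t)"
  have within: "at t within {0..T} = at t" using t by (rule at_within_Icc_at)
  obtain r' where r': "(?r has_real_derivative r') (at t)"
    using good by (auto simp: good_time_def real_differentiable_def)
  then have vr: "vector_derivative ?r (at t) = r'"
    by (simp add: has_real_derivative_iff_has_vector_derivative vector_derivative_at)
  have lr: "((\<lambda>s. (?r s - ?r t) / (s - t)) \<longlongrightarrow> r') (at t)" using r' by (simp add: has_field_derivative_iff)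
  show ?thesis
  proof (cases "?r t = 0")
    case True
    then have "r' = 0" using deriv_pi_r_eq_0[OF r'] by simp
    have "((\<lambda>s. \<bar>(?r s - ?r t) / (s - t)\<bar>) \<longlongrightarrow> 0) (at t)"
      using tendsto_rabs_zero[OF lr[unfolded \<open>r' = 0\<close>]] .
    moreover have "cone_speed2 T xbar z t = 0" using True by (simp add: cone_speed2_def)
    moreover have "z t = apex" using True by simp
    ultimately show ?thesis by (simp add: abs_divide)
  next
    case False
    then have pos: "0 < ?r t" using pi_r_nonneg[of "z t"] by linarith
    then have "?x differentiable (at t)" using good by (simp add: good_time_def)
    then obtain x' where x': "(?x has_vector_derivative x') (at t)"
      using vector_derivative_works by blast
    then have vx: "vector_derivative ?x (at t) = x'" by (rule vector_derivative_at)
    have xd: "?x differentiable (at t)" by fact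
    have rd: "?r differentiable (at t)" using r' real_differentiable_def by blast
    have sp: "cone_speed2 T xbar z t = (?r t)\<^sup>2 * (norm x')\<^sup>2 + r'\<^sup>2"
      unfolding cone_speed2_def Let_def within using pos xd rd by (simp add: vr vx)
    have lx: "((\<lambda>s. norm (?x s - ?x t) / \<bar>s - t\<bar>) \<longlongrightarrow> norm x') (at t)"
      using x' by (rule norm_difference_quotient_tendsto)
    have xc: "(?x \<longlongrightarrow> ?x t) (at t)" using differentiable_imp_continuous_within[OF xd] by (simp add: continuous_within)
    have rc: "(?r \<longlongrightarrow> ?r t) (at t)" using differentiable_imp_continuous_within[OF rd] by (simp add: continuous_within)
    define u where "u s = dist (?x s) (?x t) / 2" for s
    have uc: "(u \<longlongrightarrow> 0) (at t)"
      using xc tendsto_divide[OF tendsto_dist[OF xc tendsto_const, of "?x t"] tendsto_const[of 2]] by (simp add: u_def[abs_def])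
    \<comment> \<open>\<open>sinc\<close> allows \<open>sin (u s)\<close> to be replaced by
      \<open>u s\<close> also at those \<open>s\<close> where \<open>u s = 0\<close>.\<close>
    have "((\<lambda>s. sinc (u s) * (norm (?x s - ?x t) / \<bar>s - t\<bar> / 2)) \<longlongrightarrow> 1 * (norm x' / 2)) (at t)"
      using isCont_tendsto_compose[OF isCont_sinc uc] by (intro tendsto_intros lx) auto
    moreover have "sinc (u s) * (norm (?x s - ?x t) / \<bar>s - t\<bar> / 2) = sin (u s) / \<bar>s - t\<bar>" for s
      by (simp add: u_def dist_norm)
    ultimately have ls: "((\<lambda>s. sin (u s) / \<bar>s - t\<bar>) \<longlongrightarrow> norm x' / 2) (at t)"
      by (simp only: mult_1)
    have "((\<lambda>s. ((?r s - ?r t) / (s - t))\<^sup>2 + 4 * ?r s * ?r t * (sin (u s) / \<bar>s - t\<bar>)\<^sup>2) \<longlongrightarrow>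
        r'\<^sup>2 + 4 * ?r t * ?r t * (norm x' / 2)\<^sup>2) (at t)"
      by (intro tendsto_intros lr rc ls)
    also have "r'\<^sup>2 + 4 * ?r t * ?r t * (norm x' / 2)\<^sup>2 = cone_speed2 T xbar z t"
      by (simp add: sp power2_eq_square)
    finally have lim: "((\<lambda>s. sqrt (((?r s - ?r t) / (s - t))\<^sup>2 + 4 * ?r s * ?r t * (sin (u s) / \<bar>s - t\<bar>)\<^sup>2)) \<longlongrightarrow>
        sqrt (cone_speed2 T xbar z t)) (at t)"
      by (rule tendsto_real_sqrt)
    \<comment> \<open>Close to \<open>t\<close> the truncation of the angle at \<open>pi\<close> is
      not active.\<close>
    have ev: "\<forall>\<^sub>F s in at t. u s < pi / 2" using order_tendstoD(2)[OF uc, of "pi / 2"] by simp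
    show ?thesis
    proof (rule Lim_transform_eventually[OF lim])
      show "\<forall>\<^sub>F s in at t. sqrt (((?r s - ?r t) / (s - t))\<^sup>2 + 4 * ?r s * ?r t * (sin (u s) / \<bar>s - t\<bar>)\<^sup>2)
          = dist (z s) (z t) / \<bar>s - t\<bar>"
        using ev
      proof eventually_elim
        case (elim s)
        then have "cone_angle xbar (z s) (z t) / 2 = u s" by (simp add: cone_angle_def u_def)
        then have "(dist (z s) (z t))\<^sup>2 = (?r s - ?r t)\<^sup>2 + 4 * ?r s * ?r t * (sin (u s))\<^sup>2"
          using cone_dist_sq[of "z s" "z t" xbar] by simp
        then have "((?r s - ?r t) / (s - t))\<^sup>2 + 4 * ?r s * ?r t * (sin (u s) / \<bar>s - t\<bar>)\<^sup>2
            = (dist (z s) (z t) / \<bar>s - t\<bar>)\<^sup>2"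
          by (simp add: power_divide add_divide_distrib)
        then show ?case by simp
      qed
    qed
  qed
qed

lemma cone_speed2_nonneg: "0 \<le> cone_speed2 T xbar z t"
  by (simp add: cone_speed2_def Let_def)

text \<open>Reconciles the two notions of speed: \<open>AC2\<close> is stated with the metric
  derivative, \<open>path_action\<close> with the metric tensor.\<close>

lemma metric_derivative_sq:
  assumes "0 < t" "t < T" "good_time xbar z t"
  shows "(metric_derivative T z t)\<^sup>2 = cone_speed2 T xbar z t"
proof -
  have "metric_derivative T z t = sqrt (cone_speed2 T xbar z t)"
    unfolding metric_derivative_def at_within_Icc_at[OF assms(1,2)]
    using metric_derivative_limit[OF assms] by (intro tendsto_Lim) auto
  then show ?thesis by (simp add: cone_speed2_nonneg)
qed

text \<open>\<open>f\<close> and \<open>g\<close> need not be measurable; \<open>nn_integral\<close> is then a lower integral. This matters since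
  \<open>path_action\<close> is not known to be measurable.\<close>

lemma nn_integral_le_cmult_add:
  assumes h[measurable]: "h \<in> borel_measurable M" and hfin: "\<And>x. h x < \<infinity>" and c: "0 < c"
    and le: "AE x in M. f x \<le> ennreal c * g x + h x"
  shows "(\<integral>\<^sup>+x. f x \<partial>M) \<le> ennreal c * (\<integral>\<^sup>+x. g x \<partial>M) + (\<integral>\<^sup>+x. h x \<partial>M)"
  unfolding nn_integral_def[of M f]
proof (rule SUP_least)
  fix s assume "s \<in> {g. simple_function M g \<and> g \<le> f}"
  then have s: "simple_function M s" "\<And>x. s x \<le> f x" by (auto simp: le_fun_def)
  have [measurable]: "s \<in> borel_measurable M" using s(1) by (rule borel_measurable_simple_function)
  \<comment> \<open>For a simple \<open>s\<close> below \<open>f\<close>, the measurable function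
    \<open>(s - h) / c\<close>, truncated at 0, lies below \<open>g\<close> almost everywhere and so
    competes in the lower integral of \<open>g\<close>.\<close>
  define k where "k x = ennreal (1 / c) * (s x - h x)" for x
  have [measurable]: "k \<in> borel_measurable M" unfolding k_def[abs_def] by measurable
  have c1: "ennreal c * ennreal (1 / c) = 1" using c by (simp flip: ennreal_mult)
  have ck: "ennreal c * k x = s x - h x" for x
    by (simp add: k_def c1 flip: mult.assoc)
  have "AE x in M. k x \<le> g x"
    using le
  proof eventually_elim
    case (elim x)
    have "s x \<le> h x + ennreal c * g x" using order.trans[OF s(2) elim] by (simp add: add.commute)
    then have "s x - h x \<le> ennreal c * g x" using hfin[of x] by (auto simp: ennreal_minus_le_iff)
    then have "ennreal (1 / c) * (s x - h x) \<le> ennreal (1 / c) * (ennreal c * g x)" by (rule mult_left_mono) simp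
    also have "\<dots> = g x" using c1 by (simp add: mult.assoc[symmetric] mult.commute)
    finally show ?case by (simp add: k_def)
  qed
  then have kg: "(\<integral>\<^sup>+x. k x \<partial>M) \<le> (\<integral>\<^sup>+x. g x \<partial>M)" by (rule nn_integral_mono_AE)
  have "integral\<^sup>S M s = (\<integral>\<^sup>+x. s x \<partial>M)" using s(1) by (rule nn_integral_eq_simple_integral[symmetric])
  also have "\<dots> \<le> (\<integral>\<^sup>+x. ennreal c * k x + h x \<partial>M)"
  proof (rule nn_integral_mono)
    fix x
    show "s x \<le> ennreal c * k x + h x"
      unfolding ck using hfin[of x] ennreal_minus_le_iff[of "s x" "h x" "s x - h x"] by (simp add: add.commute)
  qed
  also have "\<dots> = ennreal c * (\<integral>\<^sup>+x. k x \<partial>M) + (\<integral>\<^sup>+x. h x \<partial>M)"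
    by (simp add: nn_integral_add nn_integral_cmult)
  also have "\<dots> \<le> ennreal c * (\<integral>\<^sup>+x. g x \<partial>M) + (\<integral>\<^sup>+x. h x \<partial>M)"
    using kg by (intro add_right_mono mult_left_mono) auto
  finally show "integral\<^sup>S M s \<le> ennreal c * (\<integral>\<^sup>+x. g x \<partial>M) + (\<integral>\<^sup>+x. h x \<partial>M)" .
qed

section \<open>Measurability of the metric derivative, and a bound for the radius by the
  action\<close>

lemma (in complete_measure) borel_measurable_AE_eq:
  fixes f g :: "'a \<Rightarrow> 'b::topological_space"
  assumes f: "f \<in> borel_measurable M" and eq: "AE x in M. f x = g x"
  shows "g \<in> borel_measurable M"
proof (rule measurableI)
  fix A :: "'b set" assume A: "A \<in> sets borel"
  have fA: "f -` A \<inter> space M \<in> sets M" using f A by (rule measurable_sets)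
  have "AE x in M. x \<in> f -` A \<inter> space M \<longleftrightarrow> x \<in> g -` A \<inter> space M"
    using eq by eventually_elim auto
  then show "g -` A \<inter> space M \<in> sets M" using fA by (rule in_sets_AE) auto
qed simp

lemma AE_lebesgue_on_Icc:
  assumes "AE t in lborel. 0 < t \<and> t < T \<longrightarrow> P t"
  shows "AE t in lebesgue_on {0..T::real}. P t"
proof -
  have "AE t in lborel. t \<in> {0..T} \<longrightarrow> P t"
    using assms AE_lborel_singleton[of 0] AE_lborel_singleton[of T]
    by eventually_elim auto
  then have "AE t in lebesgue. t \<in> {0..T} \<longrightarrow> P t" by (rule AE_completion)
  then show ?thesis by (subst AE_restrict_space_iff) auto
qed

lemma AE_lborel_Icc:
  assumes "AE t in lborel. 0 < t \<and> t < T \<longrightarrow> P t"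
  shows "AE t in lborel. t \<in> {0..T::real} \<longrightarrow> P t"
  using assms AE_lborel_singleton[of 0] AE_lborel_singleton[of T]
  by eventually_elim auto

text \<open>\<open>AC2\<close> asks for integrability, hence measurability, which must be proved for
  rescaled paths. \<open>Lim\<close> is arbitrary where the limit fails to exist, but this is a null
  set, and elsewhere the metric derivative is a limit of continuous functions along t + 1/(n+1).
  Completeness of the measure absorbs the exceptional set.\<close>

lemma metric_derivative_measurable:
  fixes z :: "real \<Rightarrow> 'a::euclidean_space cone"
  assumes z: "abs_cont_path T z" "continuous_on {0..T} z" "z ` {0..T} \<subseteq> cone_over M"
    and M: "bounded M" "xbar \<in> M" and T: "0 < T"
  shows "metric_derivative T z \<in> borel_measurable (lebesgue_on {0..T})"
proof -
  \<comment> \<open>Clamping to \<open>{0..T}\<close> makes \<open>f n\<close> continuous on the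
    whole line; it has no effect at interior times once \<open>n\<close> is large.\<close>
  define cl where "cl t = max 0 (min T t)" for t :: real
  have clT: "cl t \<in> {0..T}" "t \<in> {0..T} \<Longrightarrow> cl t = t" for t using T by (auto simp: cl_def)
  define f where "f n t = dist (z (cl (t + 1 / real (Suc n)))) (z (cl t)) * real (Suc n)" for n t
  have "continuous_on UNIV (\<lambda>t. z (cl (t + a)))" for a
    by (rule continuous_on_compose2[OF z(2)]) (use clT in \<open>auto simp: cl_def[abs_def] intro!: continuous_intros\<close>)
  from this[of "1 / real (Suc n)" for n] this[of 0] have fm[measurable]: "f n \<in> borel_measurable borel" for n
    unfolding f_def[abs_def] by (intro borel_measurable_continuous_onI continuous_intros) auto
  define F where "F t = lim (\<lambda>n. f n t)" for t
  have Fm: "F \<in> borel_measurable borel" unfolding F_def[abs_def] by measurable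
  have eq: "metric_derivative T z t = F t" if t: "0 < t" "t < T" and good: "good_time xbar z t" for t
  proof -
    let ?L = "sqrt (cone_speed2 T xbar z t)"
    have lim: "((\<lambda>s. dist (z s) (z t) / \<bar>s - t\<bar>) \<longlongrightarrow> ?L) (at t)" by (rule metric_derivative_limit[OF t good])
    have tn: "(\<lambda>n. t + 1 / real (Suc n)) \<longlonglongrightarrow> t"
      using tendsto_add[OF tendsto_const[of t] LIMSEQ_Suc[OF lim_1_over_n]] by simp
    have "((\<lambda>s. dist (z s) (z t) / \<bar>s - t\<bar>) \<circ> (\<lambda>n. t + 1 / real (Suc n))) \<longlonglongrightarrow> ?L"
      using lim tn unfolding tendsto_at_iff_sequentially
      by (elim allE[of _ "\<lambda>n. t + 1 / real (Suc n)"]) simp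
    then have "(\<lambda>n. dist (z (t + 1 / real (Suc n))) (z t) / \<bar>(t + 1 / real (Suc n)) - t\<bar>) \<longlonglongrightarrow> ?L"
      by (simp only: comp_def)
    moreover have "\<forall>\<^sub>F n in sequentially. dist (z (t + 1 / real (Suc n))) (z t) / \<bar>(t + 1 / real (Suc n)) - t\<bar> = f n t"
      using order_tendstoD(2)[OF tn t(2)]
    proof eventually_elim
      case (elim n)
      have "0 \<le> t + 1 / real (Suc n)" using t by simp
      with elim t show ?case unfolding f_def by (simp add: clT(2))
    qed
    ultimately have "(\<lambda>n. f n t) \<longlonglongrightarrow> ?L" by (rule Lim_transform_eventually)
    then have "F t = ?L" unfolding F_def by (rule limI)
    moreover have "metric_derivative T z t = ?L"
      unfolding metric_derivative_def at_within_Icc_at[OF t] using lim by (intro tendsto_Lim) auto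
    ultimately show ?thesis by simp
  qed
  define G where "G t = (if t \<in> {0..T} then metric_derivative T z t else F t)" for t
  have "AE t in lborel. 0 < t \<and> t < T \<longrightarrow> F t = metric_derivative T z t"
    using abs_cont_path_AE_good_time[OF z M] by eventually_elim (simp add: eq)
  then have "AE t in lborel. t \<in> {0..T} \<longrightarrow> F t = metric_derivative T z t" by (rule AE_lborel_Icc)
  then have "AE t in lborel. F t = G t" by eventually_elim (simp add: G_def)
  then have "AE t in lebesgue. F t = G t" by (rule AE_completion)
  moreover have "F \<in> borel_measurable lebesgue" using Fm by (simp add: measurable_completion)
  ultimately have "G \<in> borel_measurable lebesgue" using completion.borel_measurable_AE_eq by blast
  then have "G \<in> borel_measurable (lebesgue_on {0..T})" by (rule measurable_restrict_space1)
  then show ?thesis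
    by (rule measurable_cong[THEN iffD1, rotated]) (simp add: G_def)
qed

text \<open>The squared derivative of the radius is at most the squared speed, so Cauchy-Schwarz
  bounds the squared increment of the radius by \<open>T\<close> times the action. Being uniform in
  \<open>t\<close>, the bound leads to a dominating function for all times at once.\<close>

lemma path_action_pi_r_bound:
  fixes z :: "real \<Rightarrow> 'a::euclidean_space cone"
  assumes z: "continuous_on {0..T} z" "z ` {0..T} \<subseteq> cone_over M"
    and M: "bounded M" "xbar \<in> M" and t: "t \<in> {0..T}"
  shows "ennreal ((pi_r (z t))\<^sup>2) \<le> ennreal (2 * (pi_r (z 0))\<^sup>2) + ennreal (2 * T) * path_action T xbar z"
proof (cases "AC2 T z")
  case True
  then have ac: "abs_cont_path T z" by (simp add: AC2_def)
  obtain g where g: "integrable lborel g"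
    "\<And>s t. 0 \<le> s \<Longrightarrow> s \<le> t \<Longrightarrow> t \<le> T \<Longrightarrow> pi_r (z t) - pi_r (z s) = (LINT u:{s..t}|lborel. g u)"
    "AE t in lborel. 0 < t \<and> t < T \<longrightarrow> ((\<lambda>t. pi_r (z t)) has_real_derivative g t) (at t)"
    using abs_cont_path_pi_r[OF ac] by blast
  have [measurable]: "g \<in> borel_measurable borel" using g(1) by auto
  have "AE u in lborel. 0 < u \<and> u < T \<longrightarrow> (g u)\<^sup>2 \<le> cone_speed2 T xbar z u"
    using g(3) abs_cont_path_AE_good_time[OF ac z M]
  proof eventually_elim
    case (elim u)
    show ?case
    proof
      assume u: "0 < u \<and> u < T"
      with elim have d: "((\<lambda>t. pi_r (z t)) has_real_derivative g u) (at u)" and good: "good_time xbar z u" by auto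
      have within: "at u within {0..T} = at u" using u by (intro at_within_Icc_at) auto
      show "(g u)\<^sup>2 \<le> cone_speed2 T xbar z u"
      proof (cases "pi_r (z u) = 0")
        case True
        then show ?thesis using deriv_pi_r_eq_0[OF d] cone_speed2_nonneg by simp
      next
        case False
        then have "0 < pi_r (z u)" using pi_r_nonneg[of "z u"] by linarith
        moreover have "vector_derivative (\<lambda>t. pi_r (z t)) (at u) = g u"
          using d by (simp add: has_real_derivative_iff_has_vector_derivative vector_derivative_at)
        ultimately show ?thesis using good unfolding cone_speed2_def Let_def within good_time_def by simp
      qed
    qed
  qed
  then have le: "AE u in lborel. u \<in> {0..T} \<longrightarrow> (g u)\<^sup>2 \<le> cone_speed2 T xbar z u" by (rule AE_lborel_Icc)
  define A where "A = (\<integral>\<^sup>+u\<in>{0..T}. ennreal \<bar>g u\<bar> \<partial>lborel)"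
  have "A\<^sup>2 = (\<integral>\<^sup>+u. (ennreal \<bar>g u\<bar> * indicator {0..T} u) * indicator {0..T} u \<partial>lborel)\<^sup>2"
    unfolding A_def by (intro arg_cong[where f="\<lambda>x. x\<^sup>2"] nn_integral_cong) (auto simp: indicator_def)
  also have "\<dots> \<le> (\<integral>\<^sup>+u. (ennreal \<bar>g u\<bar> * indicator {0..T} u)\<^sup>2 \<partial>lborel) * (\<integral>\<^sup>+u. (indicator {0..T} u)\<^sup>2 \<partial>lborel)"
    by (rule Cauchy_Schwarz_nn_integral) auto
  also have "(\<integral>\<^sup>+u. (indicator {0..T} u)\<^sup>2 \<partial>(lborel::real measure)) = ennreal T"
  proof -
    have "(\<integral>\<^sup>+u. (indicator {0..T} u)\<^sup>2 \<partial>(lborel::real measure)) = (\<integral>\<^sup>+u. indicator {0..T} u \<partial>lborel)"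
      by (intro nn_integral_cong) (auto simp: indicator_def)
    then show ?thesis using t by simp
  qed
  also have "(\<integral>\<^sup>+u. (ennreal \<bar>g u\<bar> * indicator {0..T} u)\<^sup>2 \<partial>lborel) \<le> (\<integral>\<^sup>+u\<in>{0..T}. ennreal (cone_speed2 T xbar z u) \<partial>lborel)"
  proof (rule nn_integral_mono_AE)
    show "AE u in lborel. (ennreal \<bar>g u\<bar> * indicator {0..T} u)\<^sup>2 \<le> ennreal (cone_speed2 T xbar z u) * indicator {0..T} u"
      using le by eventually_elim (auto simp: indicator_def ennreal_power intro: ennreal_leI)
  qed
  also have "\<dots> = path_action T xbar z" using True by (simp add: path_action_def)
  finally have A2: "A\<^sup>2 \<le> ennreal T * path_action T xbar z" by (simp add: mult.commute mult_right_mono)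
  have "pi_r (z t) - pi_r (z 0) = (LINT u:{0..t}|lborel. g u)" using g(2)[of 0 t] t by simp
  also have "ennreal \<bar>\<dots>\<bar> \<le> (\<integral>\<^sup>+u. ennreal \<bar>indicator {0..t} u * g u\<bar> \<partial>lborel)"
    using integral_norm_bound_ennreal[of lborel "\<lambda>u. indicator {0..t} u * g u"] integrable_mult_indicator[of "{0..t}" lborel g] g(1)
    by (simp add: set_lebesgue_integral_def)
  also have "\<dots> \<le> A" unfolding A_def
    using t by (intro nn_integral_mono) (auto simp: indicator_def)
  finally have rA: "ennreal \<bar>pi_r (z t) - pi_r (z 0)\<bar> \<le> A" .
  define d where "d = \<bar>pi_r (z t) - pi_r (z 0)\<bar>"
  have "0 \<le> d" by (simp add: d_def)
  \<comment> \<open>The right side exceeds the left by the square of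
    \<open>pi_r (z t) - 2 * pi_r (z 0)\<close>.\<close>
  have "(pi_r (z t))\<^sup>2 \<le> 2 * (pi_r (z 0))\<^sup>2 + 2 * d\<^sup>2"
    using sum_squares_ge_zero[of "pi_r (z t) - 2 * pi_r (z 0)" 0] by (simp add: d_def power2_eq_square algebra_simps)
  then have "ennreal ((pi_r (z t))\<^sup>2) \<le> ennreal (2 * (pi_r (z 0))\<^sup>2 + 2 * d\<^sup>2)" by (rule ennreal_leI)
  also have "\<dots> = ennreal (2 * (pi_r (z 0))\<^sup>2) + 2 * (ennreal d)\<^sup>2"
    using \<open>0 \<le> d\<close> by (simp add: ennreal_plus ennreal_mult ennreal_power)
  also have "\<dots> \<le> ennreal (2 * (pi_r (z 0))\<^sup>2) + 2 * (ennreal T * path_action T xbar z)"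
    using power_mono[OF rA[folded d_def], of 2] A2 by (intro add_left_mono mult_left_mono) auto
  finally show ?thesis using t by (simp add: ennreal_mult mult.assoc)
next
  case False
  \<comment> \<open>For \<open>T = 0\<close> the product of 0 and the infinite action is 0, so that
    case is separate; then \<open>t = 0\<close> and the first summand suffices.\<close>
  then show ?thesis using t by (cases "T = 0") (auto simp: path_action_def ennreal_mult_top)
qed

section \<open>Radial scaling of paths\<close>

text \<open>The factor \<kappa> is later the square root of \<open>1 + \<sigma>\<close>. The
  constants are what a bound 1/2 on \<sigma> and on its Lipschitz constant yields for this
  root.\<close>

locale radial_scaling =
  fixes T :: real and M :: "'a::euclidean_space set" and xbar :: 'a and \<kappa> :: "real \<times> 'a \<Rightarrow> real"
  assumes T: "0 < T" and M: "bounded M" "xbar \<in> M"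
    and scale_bounds: "\<And>p. p \<in> {0..T} \<times> M \<Longrightarrow> 1/2 \<le> \<kappa> p \<and> \<kappa> p \<le> 3/2"
    and scale_lipschitz: "\<And>p q. p \<in> {0..T} \<times> M \<Longrightarrow> q \<in> {0..T} \<times> M \<Longrightarrow> \<bar>\<kappa> p - \<kappa> q\<bar> \<le> dist p q / 2"
begin

definition scale_point :: "real \<Rightarrow> 'a cone \<Rightarrow> 'a cone" where
  "scale_point t c = cone_point (pi_x xbar c) (\<kappa> (t, pi_x xbar c) * pi_r c)"

definition scale_path :: "(real \<Rightarrow> 'a cone) \<Rightarrow> real \<Rightarrow> 'a cone" where
  "scale_path z = restrict (\<lambda>t. scale_point t (z t)) {0..T}"

context
  fixes t :: real and c :: "'a cone"
  assumes t: "t \<in> {0..T}" and c: "c \<in> cone_over M"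
begin

lemma pi_x_M: "pi_x xbar c \<in> M"
  using c M(2) by (rule pi_x_in_cone_over)

lemma scale_pos: "0 < \<kappa> (t, pi_x xbar c)"
  using scale_bounds[of "(t, pi_x xbar c)"] t pi_x_M by auto

lemma pi_r_scale_point [simp]: "pi_r (scale_point t c) = \<kappa> (t, pi_x xbar c) * pi_r c"
  unfolding scale_point_def using scale_pos by (intro pi_r_cone_point) simp

lemma pi_x_scale_point [simp]: "pi_x xbar (scale_point t c) = pi_x xbar c"
proof (cases "c = apex")
  case True
  then show ?thesis by (simp add: scale_point_def cone_point_0 pi_x_apex)
next
  case False
  then have "0 < pi_r c" using pi_r_nonneg[of c] pi_r_eq_0_iff[of c] by linarith
  then show ?thesis unfolding scale_point_def using scale_pos by (intro pi_x_cone_point) simp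
qed

lemma scale_point_in_cone_over: "scale_point t c \<in> cone_over M"
  unfolding scale_point_def cone_over_def using pi_x_M scale_pos by (auto intro!: exI mult_nonneg_nonneg)

lemma scale_point_eq: "\<kappa> (t, pi_x xbar c) = 1 \<Longrightarrow> scale_point t c = c"
  by (simp add: scale_point_def)

end

text \<open>The factor varies with the base point, so scaling turns an angular displacement into an
  additional radial one. The latter is at most the smaller radius times a multiple of the sine of
  half the angle, and can thus be absorbed by the angular term of the distance.\<close>

lemma scale_point_dist_le:
  assumes t: "t \<in> {0..T}" and cd: "c \<in> cone_over M" "d \<in> cone_over M"
  shows "dist (scale_point t c) (scale_point t d) \<le> 3 * dist c d"
proof -
  have *: "dist (scale_point t c) (scale_point t d) \<le> 3 * dist c d"
    if cd: "c \<in> cone_over M" "d \<in> cone_over M" and le: "pi_r c \<le> pi_r d" for c d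
  proof -
    define r q where "r = pi_r c" and "q = pi_r d"
    define a b where "a = \<kappa> (t, pi_x xbar c)" and "b = \<kappa> (t, pi_x xbar d)"
    define \<theta> where "\<theta> = cone_angle xbar c d"
    define w where "w = sin (\<theta> / 2)"
    have r: "0 \<le> r" "r \<le> q" using le by (auto simp: r_def q_def)
    have ab: "1/2 \<le> a" "a \<le> 3/2" "1/2 \<le> b" "b \<le> 3/2" "\<bar>a - b\<bar> \<le> dist (pi_x xbar c) (pi_x xbar d) / 2"
      using scale_bounds[of "(t, pi_x xbar c)"] scale_bounds[of "(t, pi_x xbar d)"]
        scale_lipschitz[of "(t, pi_x xbar c)" "(t, pi_x xbar d)"] t pi_x_M[OF t cd(1)] pi_x_M[OF t cd(2)]
      by (auto simp: a_def b_def dist_Pair_Pair)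
    have \<theta>: "0 \<le> \<theta>" "\<theta> \<le> pi" using cone_angle_bounds[of xbar c d] by (auto simp: \<theta>_def)
    \<comment> \<open>The Lipschitz bound alone fails to give \<theta> / 2 when the angle is cut off
      at \<open>pi\<close>. There the range of \<kappa> helps: the factors differ by at most 1,
      which is at most pi / 2.\<close>
    have "\<bar>a - b\<bar> \<le> 1" using ab(1-4) by linarith
    then have ab\<theta>: "\<bar>a - b\<bar> \<le> \<theta> / 2" using ab(5) pi_ge_two by (auto simp: \<theta>_def cone_angle_def min_def)
    have w: "\<theta> / 6 \<le> w" "0 \<le> w" using sin_ge_third[of "\<theta> / 2"] \<theta> by (auto simp: w_def)
    have "\<bar>a - b\<bar> \<le> 3 * w" using ab\<theta> w by linarith
    have "\<bar>a * r - b * q\<bar> \<le> 3/2 * \<bar>r - q\<bar> + r * (3 * w)"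
    proof -
      have "a * r - b * q = b * (r - q) + r * (a - b)" by (simp add: algebra_simps)
      also have "\<bar>\<dots>\<bar> \<le> b * \<bar>r - q\<bar> + r * \<bar>a - b\<bar>" using r ab
        by (intro order.trans[OF abs_triangle_ineq]) (simp add: abs_mult)
      also have "\<dots> \<le> 3/2 * \<bar>r - q\<bar> + r * (3 * w)"
        using ab r \<open>\<bar>a - b\<bar> \<le> 3 * w\<close> by (intro add_mono mult_mono) auto
      finally show ?thesis .
    qed
    then have "(a * r - b * q)\<^sup>2 \<le> (3/2 * \<bar>r - q\<bar> + r * (3 * w))\<^sup>2" by (rule abs_le_square_iff[THEN iffD1, OF order.trans[OF _ abs_ge_self]])
    also have "\<dots> \<le> 2 * (3/2 * \<bar>r - q\<bar>)\<^sup>2 + 2 * (r * (3 * w))\<^sup>2"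
      using sum_squares_bound[of "3/2 * \<bar>r - q\<bar>" "r * (3 * w)"] by (simp only: power2_sum)
    also have "\<dots> = 9/2 * (r - q)\<^sup>2 + 18 * (r * r * w\<^sup>2)" by (simp add: power2_eq_square field_simps)
    \<comment> \<open>This uses \<open>r \<le> q\<close>; the cone distance contains the product
      \<open>r * q\<close> rather than the square of either radius.\<close>
    also have "\<dots> \<le> 9/2 * (r - q)\<^sup>2 + 18 * (r * q * w\<^sup>2)"
      using r by (intro add_left_mono mult_left_mono mult_right_mono) auto
    finally have 1: "(a * r - b * q)\<^sup>2 \<le> 9/2 * (r - q)\<^sup>2 + 18 * (r * q * w\<^sup>2)" .
    have "a * b \<le> (3/2) * (3/2)" using ab by (intro mult_mono) auto
    then have 2: "(a * b) * (4 * (r * q * w\<^sup>2)) \<le> ((3/2) * (3/2)) * (4 * (r * q * w\<^sup>2))"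
      using r by (intro mult_right_mono) auto
    have "(dist (scale_point t c) (scale_point t d))\<^sup>2 = (a * r - b * q)\<^sup>2 + 4 * (a * r) * (b * q) * w\<^sup>2"
      using cone_dist_sq[of "scale_point t c" "scale_point t d" xbar] t cd
      by (simp add: a_def b_def r_def q_def w_def \<theta>_def cone_angle_def)
    also have "\<dots> = (a * r - b * q)\<^sup>2 + (a * b) * (4 * (r * q * w\<^sup>2))" by (simp add: mult_ac)
    \<comment> \<open>The coefficients are 9/2 for the radial term and 18 + 9 = 27 for the angular
      one. Both are rounded up to those of nine times the squared distance, whence the factor
      3.\<close>
    also have "\<dots> \<le> 9 * (r - q)\<^sup>2 + 36 * (r * q * w\<^sup>2)"
    proof -
      have *: "X + Z \<le> 9 * A + 36 * Y"
        if "X \<le> 9/2 * A + 18 * Y" "Z \<le> ((3/2) * (3/2)) * (4 * Y)" "0 \<le> A" "0 \<le> Y" for X Y Z A :: real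
        using that by linarith
      have "0 \<le> r * q * w\<^sup>2" using r by simp
      then show ?thesis by (rule *[OF 1 2 zero_le_power2])
    qed
    also have "\<dots> = 9 * ((r - q)\<^sup>2 + 4 * r * q * w\<^sup>2)" by (simp add: algebra_simps)
    also have "\<dots> = (3 * dist c d)\<^sup>2"
      using cone_dist_sq[of c d xbar] by (simp add: power_mult_distrib r_def q_def w_def \<theta>_def)
    finally show ?thesis by (rule power2_le_imp_le) simp
  qed
  show ?thesis
    using *[of c d] *[of d c] cd by (cases "pi_r c \<le> pi_r d") (auto simp: dist_commute)
qed

lemma scale_point_dist_time_le:
  assumes t: "s \<in> {0..T}" "t \<in> {0..T}" and c: "c \<in> cone_over M"
  shows "dist (scale_point s c) (scale_point t c) \<le> pi_r c * \<bar>s - t\<bar> / 2"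
proof -
  have "(dist (scale_point s c) (scale_point t c))\<^sup>2 = (\<kappa> (s, pi_x xbar c) * pi_r c - \<kappa> (t, pi_x xbar c) * pi_r c)\<^sup>2"
    using cone_dist_sq[of "scale_point s c" "scale_point t c" xbar] t c by (simp add: cone_angle_def)
  then have "dist (scale_point s c) (scale_point t c) = \<bar>\<kappa> (s, pi_x xbar c) * pi_r c - \<kappa> (t, pi_x xbar c) * pi_r c\<bar>"
    by (metis abs_of_nonneg power2_eq_iff_nonneg abs_ge_zero power2_abs zero_le_dist)
  also have "\<dots> = \<bar>\<kappa> (s, pi_x xbar c) - \<kappa> (t, pi_x xbar c)\<bar> * pi_r c"
    by (simp add: abs_mult flip: left_diff_distrib)
  also have "\<dots> \<le> (\<bar>s - t\<bar> / 2) * pi_r c"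
    using scale_lipschitz[of "(s, pi_x xbar c)" "(t, pi_x xbar c)"] t pi_x_M[OF t(1) c]
    by (intro mult_right_mono) (auto simp: dist_Pair_Pair dist_real_def)
  finally show ?thesis by (simp add: mult.commute)
qed

lemma scale_point_dist_le':
  assumes t: "s \<in> {0..T}" "t \<in> {0..T}" and c: "c \<in> cone_over M" "d \<in> cone_over M"
  shows "dist (scale_point s c) (scale_point t d) \<le> 3 * dist c d + pi_r c * \<bar>s - t\<bar> / 2"
  using dist_triangle[of "scale_point s c" "scale_point t d" "scale_point t c"]
    scale_point_dist_le[OF t(2) c] scale_point_dist_time_le[OF t c(1)] by linarith

context
  fixes z :: "real \<Rightarrow> 'a cone"
  assumes z: "continuous_on {0..T} z" "z ` {0..T} \<subseteq> cone_over M"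
begin

lemma pi_r_path_bound:
  obtains R where "0 < R" "\<And>t. t \<in> {0..T} \<Longrightarrow> pi_r (z t) \<le> R"
proof -
  have "compact ((\<lambda>t. pi_r (z t)) ` {0..T})"
    using z by (intro compact_continuous_image continuous_intros) auto
  then obtain R where R: "\<And>t. t \<in> {0..T} \<Longrightarrow> norm (pi_r (z t)) \<le> R"
    using compact_imp_bounded bounded_iff by (metis image_eqI)
  from that[of "max R 1"] R show thesis by force
qed

lemma scale_path_in_cone_over: "scale_path z ` {0..T} \<subseteq> cone_over M"
  using z(2) by (auto simp: scale_path_def intro!: scale_point_in_cone_over)

lemma continuous_on_scale_path: "continuous_on {0..T} (scale_path z)"
proof -
  obtain R where R: "0 < R" "\<And>t. t \<in> {0..T} \<Longrightarrow> pi_r (z t) \<le> R" using pi_r_path_bound by blast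
  show ?thesis
    unfolding continuous_on_def
  proof
    fix t assume t: "t \<in> {0..T}"
    have "((\<lambda>s. 3 * dist (z s) (z t) + R * \<bar>s - t\<bar> / 2) \<longlongrightarrow> 3 * 0 + R * \<bar>t - t\<bar> / 2) (at t within {0..T})"
      using z(1) t by (intro tendsto_intros) (auto simp: continuous_on_def tendsto_dist_iff[symmetric])
    then have "((\<lambda>s. 3 * dist (z s) (z t) + R * \<bar>s - t\<bar> / 2) \<longlongrightarrow> 0) (at t within {0..T})" by simp
    moreover have "\<forall>\<^sub>F s in at t within {0..T}. norm (dist (scale_path z s) (scale_path z t)) \<le> 3 * dist (z s) (z t) + R * \<bar>s - t\<bar> / 2"
      unfolding eventually_at_filter
    proof (intro always_eventually allI impI)
      fix s assume s: "s \<in> {0..T}"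
      have "dist (scale_point s (z s)) (scale_point t (z t)) \<le> 3 * dist (z s) (z t) + pi_r (z s) * \<bar>s - t\<bar> / 2"
        using s t z(2) by (intro scale_point_dist_le') auto
      also have "pi_r (z s) * \<bar>s - t\<bar> / 2 \<le> R * \<bar>s - t\<bar> / 2" using R(2)[OF s] by (simp add: mult_right_mono)
      finally show "norm (dist (scale_path z s) (scale_path z t)) \<le> 3 * dist (z s) (z t) + R * \<bar>s - t\<bar> / 2"
        using s t by (simp add: scale_path_def)
    qed
    ultimately have "((\<lambda>s. dist (scale_path z s) (scale_path z t)) \<longlongrightarrow> 0) (at t within {0..T})"
      by (rule Lim_null_comparison[rotated])
    then show "(scale_path z \<longlongrightarrow> scale_path z t) (at t within {0..T})" by (rule tendsto_dist_iff[THEN iffD2])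
  qed
qed

lemma abs_cont_scale_path:
  assumes "abs_cont_path T z"
  shows "abs_cont_path T (scale_path z)"
proof -
  obtain m where m: "set_integrable lborel {0..T} m"
    "\<And>s t. 0 \<le> s \<Longrightarrow> s \<le> t \<Longrightarrow> t \<le> T \<Longrightarrow> dist (z s) (z t) \<le> (LINT u:{s..t}|lborel. m u)"
    using abs_cont_pathE[OF assms] by blast
  obtain R where R: "0 < R" "\<And>t. t \<in> {0..T} \<Longrightarrow> pi_r (z t) \<le> R" using pi_r_path_bound by blast
  have ci: "set_integrable lborel {s..t} (\<lambda>u. R / 2)" for s t :: real
    unfolding set_integrable_def by (intro integrable_scaleR_left integrable_real_indicator) (auto simp: emeasure_lborel_Icc_eq)
  show ?thesis unfolding abs_cont_path_def
  proof (intro exI[of _ "\<lambda>u. 3 * m u + R / 2"] conjI allI impI)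
    show "set_integrable lborel {0..T} (\<lambda>u. 3 * m u + R / 2)"
      using m(1) ci by (intro set_integral_add) auto
    fix s t assume st: "0 \<le> s \<and> s \<le> t \<and> t \<le> T"
    have "dist (scale_path z s) (scale_path z t) \<le> 3 * dist (z s) (z t) + pi_r (z s) * \<bar>s - t\<bar> / 2"
    proof -
      have "s \<in> {0..T}" "t \<in> {0..T}" using st by auto
      with scale_point_dist_le'[of s t "z s" "z t"] z(2) show ?thesis
        by (simp add: scale_path_def image_subset_iff)
    qed
    also have "\<dots> \<le> 3 * (LINT u:{s..t}|lborel. m u) + R * (t - s) / 2"
      using st R(2)[of s] m(2)[of s t] by (intro add_mono) (auto intro!: mult_right_mono)
    also have "\<dots> = (LINT u:{s..t}|lborel. 3 * m u) + (LINT u:{s..t}|lborel. R / 2)"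
      using st by (simp add: set_lebesgue_integral_def)
    also have "\<dots> = (LINT u:{s..t}|lborel. 3 * m u + R / 2)"
      using st set_integrable_subset[OF m(1), of "{s..t}"] ci by (subst set_integral_add) auto
    finally show "dist (scale_path z s) (scale_path z t) \<le> (LINT u:{s..t}|lborel. 3 * m u + R / 2)" .
  qed
qed

text \<open>\<kappa> is merely Lipschitz, so there is no chain rule for the new radius; where its
  derivative \<open>w'\<close> exists, difference quotients give \<bar>w'\<bar> \<le> 3/2
  \<bar>w\<bar> + r/2 (1 + \<bar>v\<bar>), and elsewhere the speed is 0 by convention. With a = r
  \<bar>v\<bar>, squaring the three summands costs a factor 3. Together with 9/4 a^2 from the motion
  of the base point this makes 3 a^2 + 27/4 w^2 + 3/4 r^2, which is rounded up to 7 (a^2 + w^2) +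
  r^2.\<close>

lemma cone_speed2_scale_path_le:
  assumes t: "0 < t" "t < T" and good: "good_time xbar z t"
  shows "cone_speed2 T xbar (scale_path z) t \<le> 7 * cone_speed2 T xbar z t + (pi_r (z t))\<^sup>2"
proof -
  let ?x = "\<lambda>t. pi_x xbar (z t)" and ?r = "\<lambda>t. pi_r (z t)"
  let ?x' = "\<lambda>t. pi_x xbar (scale_path z t)" and ?r' = "\<lambda>t. pi_r (scale_path z t)"
  have within: "at t within {0..T} = at t" using t by (rule at_within_Icc_at)
  have zM: "z s \<in> cone_over M" if "s \<in> {0..T}" for s using z(2) that by auto
  have xs: "?x' s = ?x s" and rs: "?r' s = \<kappa> (s, ?x s) * ?r s" if "s \<in> {0..T}" for s
    using that zM[OF that] by (simp_all add: scale_path_def)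
  have tT: "t \<in> {0..T}" using t by simp
  have ev: "\<forall>\<^sub>F s in nhds t. s \<in> {0..T}"
    using t eventually_nhds_in_open[of "{0<..<T}" t] by (auto elim!: eventually_mono)
  show ?thesis
  proof (cases "0 < ?r' t \<and> ?x' differentiable (at t) \<and> ?r' differentiable (at t)")
    case False
    then have "cone_speed2 T xbar (scale_path z) t = 0" unfolding cone_speed2_def Let_def within by auto
    then show ?thesis using cone_speed2_nonneg[of T xbar z t] by simp
  next
    case True
    have l: "1/2 \<le> \<kappa> (t, ?x t)" "\<kappa> (t, ?x t) \<le> 3/2"
      using scale_bounds[of "(t, ?x t)"] tT pi_x_M[OF tT zM[OF tT]] by auto
    have "z t \<noteq> apex" using True rs[OF tT] by auto
    then have pos: "0 < ?r t" by (simp add: pi_r_pos_iff)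
    have dx: "?x differentiable (at t)" and dr: "?r differentiable (at t)" using good pos by (auto simp: good_time_def)
    obtain v where v: "(?x has_vector_derivative v) (at t)" using dx vector_derivative_works by blast
    obtain w where w: "(?r has_real_derivative w) (at t)" using dr real_differentiable_def by blast
    obtain w' where w': "(?r' has_real_derivative w') (at t)" using True real_differentiable_def by blast
    have v': "(?x' has_vector_derivative v) (at t)"
      using v by (rule has_vector_derivative_transform_within_open[of ?x v t "{0<..<T}"]) (use t xs in auto)
    have lx: "((\<lambda>s. norm (?x s - ?x t) / \<bar>s - t\<bar>) \<longlongrightarrow> norm v) (at t)" using v by (rule norm_difference_quotient_tendsto)
    have lr: "((\<lambda>s. \<bar>(?r s - ?r t) / (s - t)\<bar>) \<longlongrightarrow> \<bar>w\<bar>) (at t)"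
      using w by (intro tendsto_rabs) (simp add: has_field_derivative_iff)
    have lr': "((\<lambda>s. \<bar>(?r' s - ?r' t) / (s - t)\<bar>) \<longlongrightarrow> \<bar>w'\<bar>) (at t)"
      using w' by (intro tendsto_rabs) (simp add: has_field_derivative_iff)
    have up: "((\<lambda>s. 3/2 * \<bar>(?r s - ?r t) / (s - t)\<bar> + ?r t / 2 * (1 + norm (?x s - ?x t) / \<bar>s - t\<bar>)) \<longlongrightarrow>
        3/2 * \<bar>w\<bar> + ?r t / 2 * (1 + norm v)) (at t)"
      by (intro tendsto_intros lx lr)
    have w'le: "\<bar>w'\<bar> \<le> 3/2 * \<bar>w\<bar> + ?r t / 2 * (1 + norm v)"
    proof (rule tendsto_le[OF _ up lr'])
      have "\<forall>\<^sub>F s in at t. s \<in> {0..T} \<and> s \<noteq> t"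
        using ev by (auto simp: eventually_at_filter elim!: eventually_mono)
      then show "\<forall>\<^sub>F s in at t. \<bar>(?r' s - ?r' t) / (s - t)\<bar> \<le>
          3/2 * \<bar>(?r s - ?r t) / (s - t)\<bar> + ?r t / 2 * (1 + norm (?x s - ?x t) / \<bar>s - t\<bar>)"
      proof eventually_elim
        case (elim s)
        then have sT: "s \<in> {0..T}" by simp
        have xM: "?x s \<in> M" "?x t \<in> M" using pi_x_M[OF sT zM[OF sT]] pi_x_M[OF tT zM[OF tT]] by auto
        have ls: "\<bar>\<kappa> (s, ?x s)\<bar> \<le> 3/2" using scale_bounds[of "(s, ?x s)"] sT xM by auto
        have "\<bar>\<kappa> (s, ?x s) - \<kappa> (t, ?x t)\<bar> \<le> dist (s, ?x s) (t, ?x t) / 2"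
          using sT tT xM by (intro scale_lipschitz) auto
        also have "dist (s, ?x s) (t, ?x t) \<le> \<bar>s - t\<bar> + norm (?x s - ?x t)"
          using sqrt_sum_squares_le_sum_abs[of "s - t" "norm (?x s - ?x t)"] by (simp add: dist_norm norm_Pair)
        finally have ld: "\<bar>\<kappa> (s, ?x s) - \<kappa> (t, ?x t)\<bar> \<le> (\<bar>s - t\<bar> + norm (?x s - ?x t)) / 2" by simp
        have "?r' s - ?r' t = \<kappa> (s, ?x s) * (?r s - ?r t) + ?r t * (\<kappa> (s, ?x s) - \<kappa> (t, ?x t))"
          using rs[OF sT] rs[OF tT] by (simp add: algebra_simps)
        also have "\<bar>\<dots>\<bar> \<le> \<bar>\<kappa> (s, ?x s)\<bar> * \<bar>?r s - ?r t\<bar> + ?r t * \<bar>\<kappa> (s, ?x s) - \<kappa> (t, ?x t)\<bar>"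
          by (intro order.trans[OF abs_triangle_ineq]) (simp add: abs_mult)
        also have "\<dots> \<le> 3/2 * \<bar>?r s - ?r t\<bar> + ?r t * ((\<bar>s - t\<bar> + norm (?x s - ?x t)) / 2)"
          using ls ld by (intro add_mono mult_mono) auto
        finally have "\<bar>?r' s - ?r' t\<bar> / \<bar>s - t\<bar> \<le> (3/2 * \<bar>?r s - ?r t\<bar> + ?r t * ((\<bar>s - t\<bar> + norm (?x s - ?x t)) / 2)) / \<bar>s - t\<bar>"
          by (rule divide_right_mono) simp
        also have "\<dots> = 3/2 * (\<bar>?r s - ?r t\<bar> / \<bar>s - t\<bar>) + ?r t / 2 * (1 + norm (?x s - ?x t) / \<bar>s - t\<bar>)"
          using elim by (simp add: field_simps)
        finally show ?case by (simp add: abs_divide)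
      qed
    qed simp
    define a where "a = ?r t * norm v"
    have sp: "cone_speed2 T xbar z t = a\<^sup>2 + w\<^sup>2"
      unfolding cone_speed2_def Let_def within a_def using pos dx dr vector_derivative_at[OF v] w
      by (simp add: power_mult_distrib has_real_derivative_iff_has_vector_derivative vector_derivative_at)
    have sp': "cone_speed2 T xbar (scale_path z) t = (\<kappa> (t, ?x t))\<^sup>2 * a\<^sup>2 + w'\<^sup>2"
      unfolding cone_speed2_def Let_def within a_def using True vector_derivative_at[OF v'] w' rs[OF tT]
      by (simp add: power_mult_distrib has_real_derivative_iff_has_vector_derivative vector_derivative_at)
    have la: "(\<kappa> (t, ?x t))\<^sup>2 * a\<^sup>2 \<le> (3/2)\<^sup>2 * a\<^sup>2" using l by (intro mult_right_mono power_mono) auto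
    define p q where "p = 3/2 * \<bar>w\<bar>" and "q = ?r t / 2"
    have "3/2 * \<bar>w\<bar> + ?r t / 2 * (1 + norm v) = p + q + a / 2"
      by (simp add: p_def q_def a_def field_simps)
    then have "w'\<^sup>2 \<le> (p + q + a / 2)\<^sup>2"
      using w'le by (intro abs_le_square_iff[THEN iffD1] order.trans[OF _ abs_ge_self]) simp
    also have "\<dots> \<le> 3 * (p\<^sup>2 + q\<^sup>2 + (a / 2)\<^sup>2)"
    proof -
      have "3 * (p\<^sup>2 + q\<^sup>2 + (a / 2)\<^sup>2) - (p + q + a / 2)\<^sup>2 = (p - q)\<^sup>2 + (q - a/2)\<^sup>2 + (p - a/2)\<^sup>2"
        by (simp add: power2_eq_square algebra_simps)
      then show ?thesis by (smt (verit) zero_le_power2)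
    qed
    finally have "w'\<^sup>2 \<le> 27/4 * w\<^sup>2 + 3/4 * (?r t)\<^sup>2 + 3/4 * a\<^sup>2"
      by (simp add: p_def q_def power_mult_distrib power_divide)
    moreover have "(\<kappa> (t, ?x t))\<^sup>2 * a\<^sup>2 \<le> 9/4 * a\<^sup>2" using la by (simp add: power2_eq_square)
    moreover have "K + W' \<le> 7 * (A + W) + R"
      if "W' \<le> 27/4 * W + 3/4 * R + 3/4 * A" "K \<le> 9/4 * A" "0 \<le> A" "0 \<le> W" "0 \<le> R" for K A W W' R :: real
    proof -
      have "K + 3/4 * A \<le> 7 * A" "27/4 * W \<le> 7 * W" "3/4 * R \<le> R" using that by simp_all
      with that(1) show ?thesis by (simp add: distrib_left)
    qed
    ultimately show ?thesis unfolding sp sp' by (simp only: zero_le_power2)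
  qed
qed

text \<open>A continuous path has bounded radius on \<open>{0..T}\<close>, so the speed estimate
  supplies an integrable majorant for the squared metric derivative of the scaled path.\<close>

lemma AC2_scale_path:
  assumes "AC2 T z"
  shows "AC2 T (scale_path z)"
proof -
  have ac: "abs_cont_path T z" and int: "integrable (lebesgue_on {0..T}) (\<lambda>t. (metric_derivative T z t)\<^sup>2)"
    using assms by (auto simp: AC2_def)
  note ac' = abs_cont_scale_path[OF ac]
  note cont' = continuous_on_scale_path scale_path_in_cone_over
  obtain R where R: "0 < R" "\<And>t. t \<in> {0..T} \<Longrightarrow> pi_r (z t) \<le> R" using pi_r_path_bound by blast
  have "integrable (lebesgue_on {0..T}) (\<lambda>t. (metric_derivative T (scale_path z) t)\<^sup>2)"
  proof (rule Bochner_Integration.integrable_bound)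
    show "integrable (lebesgue_on {0..T}) (\<lambda>t. 7 * (metric_derivative T z t)\<^sup>2 + R\<^sup>2)"
      using int by (intro Bochner_Integration.integrable_add integrable_mult_right) (auto intro!: finite_measure.integrable_const finite_measure_lebesgue_on)
    show "(\<lambda>t. (metric_derivative T (scale_path z) t)\<^sup>2) \<in> borel_measurable (lebesgue_on {0..T})"
      using metric_derivative_measurable[OF ac' cont' M T] by (rule borel_measurable_power)
    have "AE t in lborel. 0 < t \<and> t < T \<longrightarrow>
        norm ((metric_derivative T (scale_path z) t)\<^sup>2) \<le> norm (7 * (metric_derivative T z t)\<^sup>2 + R\<^sup>2)"
      using abs_cont_path_AE_good_time[OF ac z M] abs_cont_path_AE_good_time[OF ac' cont' M]
    proof eventually_elim
      case (elim t)
      show ?case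
      proof
        assume t: "0 < t \<and> t < T"
        have "(metric_derivative T (scale_path z) t)\<^sup>2 \<le> 7 * (metric_derivative T z t)\<^sup>2 + (pi_r (z t))\<^sup>2"
          using elim t by (simp add: metric_derivative_sq cone_speed2_scale_path_le)
        also have "(pi_r (z t))\<^sup>2 \<le> R\<^sup>2" using R(2)[of t] t by (intro power_mono) auto
        finally show "norm ((metric_derivative T (scale_path z) t)\<^sup>2) \<le> norm (7 * (metric_derivative T z t)\<^sup>2 + R\<^sup>2)"
          by simp
      qed
    qed
    then show "AE t in lebesgue_on {0..T}. norm ((metric_derivative T (scale_path z) t)\<^sup>2) \<le> norm (7 * (metric_derivative T z t)\<^sup>2 + R\<^sup>2)"
      by (rule AE_lebesgue_on_Icc)
  qed
  with ac' show ?thesis by (simp add: AC2_def)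
qed

lemma path_action_scale_path_le:
  "path_action T xbar (scale_path z) \<le> 7 * path_action T xbar z + (\<integral>\<^sup>+t\<in>{0..T}. ennreal ((pi_r (z t))\<^sup>2) \<partial>lborel)"
proof (cases "AC2 T z")
  case True
  then have ac: "abs_cont_path T z" by (simp add: AC2_def)
  have m: "(\<lambda>t. ennreal ((pi_r (z t))\<^sup>2) * indicator {0..T} t) \<in> borel_measurable lborel"
  proof -
    have "(\<lambda>t. indicator {0..T} t *\<^sub>R (pi_r (z t))\<^sup>2) \<in> borel_measurable borel"
      using z by (intro borel_measurable_continuous_on_indicator continuous_intros) auto
    then have "(\<lambda>t. ennreal (indicator {0..T} t *\<^sub>R (pi_r (z t))\<^sup>2)) \<in> borel_measurable borel" by measurable
    also have "(\<lambda>t. ennreal (indicator {0..T} t *\<^sub>R (pi_r (z t))\<^sup>2)) = (\<lambda>t. ennreal ((pi_r (z t))\<^sup>2) * indicator {0..T} t)"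
      by (auto simp: indicator_def)
    finally show ?thesis by simp
  qed
  have "AE t in lborel. 0 < t \<and> t < T \<longrightarrow>
      ennreal (cone_speed2 T xbar (scale_path z) t) \<le> ennreal 7 * ennreal (cone_speed2 T xbar z t) + ennreal ((pi_r (z t))\<^sup>2)"
    using abs_cont_path_AE_good_time[OF ac z M]
  proof eventually_elim
    case (elim t)
    show ?case
    proof
      assume "0 < t \<and> t < T"
      then have "ennreal (cone_speed2 T xbar (scale_path z) t) \<le> ennreal (7 * cone_speed2 T xbar z t + (pi_r (z t))\<^sup>2)"
        using elim cone_speed2_scale_path_le[of t] by (intro ennreal_leI) auto
      also have "\<dots> = ennreal 7 * ennreal (cone_speed2 T xbar z t) + ennreal ((pi_r (z t))\<^sup>2)"
        using cone_speed2_nonneg[of T xbar z t] by (simp add: ennreal_plus ennreal_mult)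
      finally show "ennreal (cone_speed2 T xbar (scale_path z) t)
          \<le> ennreal 7 * ennreal (cone_speed2 T xbar z t) + ennreal ((pi_r (z t))\<^sup>2)" .
    qed
  qed
  then have "AE t in lborel. t \<in> {0..T} \<longrightarrow>
      ennreal (cone_speed2 T xbar (scale_path z) t) \<le> ennreal 7 * ennreal (cone_speed2 T xbar z t) + ennreal ((pi_r (z t))\<^sup>2)"
    by (rule AE_lborel_Icc)
  then have "AE t in lborel. ennreal (cone_speed2 T xbar (scale_path z) t) * indicator {0..T} t
      \<le> ennreal 7 * (ennreal (cone_speed2 T xbar z t) * indicator {0..T} t) + ennreal ((pi_r (z t))\<^sup>2) * indicator {0..T} t"
    by eventually_elim (auto simp: indicator_def)
  from nn_integral_le_cmult_add[OF m _ _ this] show ?thesis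
    using True AC2_scale_path[OF True] by (simp add: path_action_def ennreal_mult_less_top indicator_def)
qed (simp add: path_action_def ennreal_mult_top)

end

end

section \<open>Plans on path space\<close>

lemma openin_path_metric_subset: "openin (mtopology_of (path_metric T M)) S \<Longrightarrow> S \<subseteq> Omega T M"
  using openin_subset by fastforce

lemma sets_path_borel: "sets (path_borel T M) = sigma_sets (Omega T M) {S. openin (mtopology_of (path_metric T M)) S}"
  unfolding path_borel_def
  by (rule sets_measure_of) (auto dest: openin_path_metric_subset)

lemma space_path_borel [simp]: "space (path_borel T M) = Omega T M"
  unfolding path_borel_def by (rule space_measure_of) (auto dest: openin_path_metric_subset)

lemma continuous_map_imp_vimage_path_borel:
  assumes "continuous_map (mtopology_of (path_metric T M)) Y f" "openin Y A"
  shows "f -` A \<inter> space (path_borel T M) \<in> sets (path_borel T M)"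
proof -
  have "openin (mtopology_of (path_metric T M)) {x \<in> Omega T M. f x \<in> A}"
    using openin_continuous_map_preimage[OF assms] by simp
  moreover have "f -` A \<inter> space (path_borel T M) = {x \<in> Omega T M. f x \<in> A}" by auto
  ultimately show ?thesis by (simp add: sets_path_borel sigma_sets.Basic)
qed

lemma continuous_map_measurable_path_borel:
  assumes "continuous_map (mtopology_of (path_metric T M)) (mtopology_of (path_metric T M)) S"
  shows "S \<in> measurable (path_borel T M) (path_borel T M)"
proof (rule measurable_sigma_sets[OF sets_path_borel])
  show "S \<in> space (path_borel T M) \<rightarrow> Omega T M"
    using continuous_map_funspace[OF assms] by simp
qed (use continuous_map_imp_vimage_path_borel[OF assms] in \<open>auto dest: openin_path_metric_subset\<close>)

text \<open>Evaluations and distances on path space are Lipschitz for the supremum distance, whose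
  open sets generate \<open>path_borel\<close>.\<close>

lemma Lipschitz_measurable_path_borel:
  fixes f :: "(real \<Rightarrow> 'a::metric_space cone) \<Rightarrow> 'b::metric_space"
  assumes "\<And>z w. z \<in> Omega T M \<Longrightarrow> w \<in> Omega T M \<Longrightarrow> dist (f z) (f w) \<le> B * mdist (path_metric T M) z w"
  shows "f \<in> borel_measurable (path_borel T M)"
proof (rule borel_measurableI)
  have "Lipschitz_continuous_map (path_metric T M) euclidean_metric f"
    unfolding Lipschitz_continuous_map_def using assms by auto
  then have "continuous_map (mtopology_of (path_metric T M)) euclidean f"
    using Lipschitz_continuous_imp_continuous_map by fastforce
  then show "f -` S \<inter> space (path_borel T M) \<in> sets (path_borel T M)" if "open S" for S
    using that by (rule continuous_map_imp_vimage_path_borel[of T M euclidean, unfolded open_openin[symmetric]])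
qed

lemma Omega_D:
  assumes "z \<in> Omega T M"
  shows "continuous_on {0..T} z" "z ` {0..T} \<subseteq> cone_over M" "t \<in> {0..T} \<Longrightarrow> z t \<in> cone_over M"
    "z \<in> extensional {0..T}"
  using assms unfolding Omega_eq by auto

lemma dist_eval_le_path_mdist:
  assumes "z \<in> Omega T M" "w \<in> Omega T M" "t \<in> {0..T}"
  shows "dist (z t) (w t) \<le> mdist (path_metric T M) z w"
  using mdist_cfunspace_imp_mdist_le[OF assms(1,2)[unfolded path_metric_def] order_refl, of t] assms(3)
  by (simp add: path_metric_def)

lemma path_mdist_le:
  assumes "0 \<le> B" "\<And>t. t \<in> {0..T} \<Longrightarrow> dist (z t) (w t) \<le> B"
  shows "mdist (path_metric T M) z w \<le> B"
  unfolding path_metric_def using assms by (intro mdist_cfunspace_le) auto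

lemma eval_measurable_path_borel:
  assumes "t \<in> {0..T}"
  shows "(\<lambda>z. z t) \<in> measurable (path_borel T M) (restrict_space borel (cone_over M))"
  using assms by (intro measurable_restrict_space2 Lipschitz_measurable_path_borel[of T M _ 1])
    (auto intro: dist_eval_le_path_mdist Omega_D)

lemma path_prob_measurable_cong: "\<nu> \<in> path_prob T M \<Longrightarrow> measurable \<nu> N = measurable (path_borel T M) N"
  by (rule measurable_cong_sets) (auto simp: path_prob_def)

lemma path_prob_space: "\<nu> \<in> path_prob T M \<Longrightarrow> space \<nu> = Omega T M"
  using sets_eq_imp_space_eq[of \<nu> "path_borel T M"] by (simp add: path_prob_def)

text \<open>\<rho> is the density of the measure that r^2 dt induces on
  \<open>{0..T} \<times> M\<close>, averaged over the plan. No claim is made about a single time;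
  the marginal constraint is the case of the constant 1.\<close>

definition weak_density ::
  "real \<Rightarrow> 'a::euclidean_space set \<Rightarrow> 'a \<Rightarrow> (real \<Rightarrow> 'a cone) measure \<Rightarrow> (real \<times> 'a \<Rightarrow> real) \<Rightarrow> bool" where
  "weak_density T M xbar \<nu> \<rho> \<longleftrightarrow>
     (\<forall>f. continuous_on ({0..T} \<times> M) f \<longrightarrow>
        has_bochner_integral \<nu>
          (\<lambda>z. LINT t:{0..T}|lborel. f (t, pi_x xbar (z t)) * (pi_r (z t))\<^sup>2)
          (LINT x:M|rho0 M. (LINT t:{0..T}|lborel. f (t, x) * \<rho> (t, x))))"

lemma weak_density_cong:
  assumes "\<And>p. p \<in> {0..T} \<times> M \<Longrightarrow> \<rho> p = \<rho>' p"
  shows "weak_density T M xbar \<nu> \<rho> \<longleftrightarrow> weak_density T M xbar \<nu> \<rho>'"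
proof -
  have "(LINT x:M|rho0 M. (LINT t:{0..T}|lborel. f (t, x) * \<rho> (t, x)))
      = (LINT x:M|rho0 M. (LINT t:{0..T}|lborel. f (t, x) * \<rho>' (t, x)))" for f :: "real \<times> 'a \<Rightarrow> real"
    unfolding set_lebesgue_integral_def
    by (intro Bochner_Integration.integral_cong refl) (auto simp: indicator_def assms intro!: Bochner_Integration.integral_cong)
  then show ?thesis by (simp add: weak_density_def)
qed

lemma marginal_constraint_iff_weak_density:
  "marginal_constraint T M xbar \<nu> \<longleftrightarrow> weak_density T M xbar \<nu> (\<lambda>_. 1)"
  by (simp add: marginal_constraint_def weak_density_def)

section \<open>Convex combinations and images of plans\<close>

definition convex_mix :: "real \<Rightarrow> real \<Rightarrow> 'b measure \<Rightarrow> 'b measure \<Rightarrow> 'b measure" where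
  "convex_mix u v M N = plus_measure (scale_measure (ennreal u) M) (scale_measure (ennreal v) N)"

context
  fixes u v :: real and M N :: "'b measure"
  assumes uv: "0 < u" "0 < v" "u + v = 1" and sets_eq: "sets N = sets M"
begin

lemma space_convex_mix: "space (convex_mix u v M N) = space M"
  and sets_convex_mix: "sets (convex_mix u v M N) = sets M"
  by (simp_all add: convex_mix_def space_scale_measure)

lemma nn_integral_convex_mix:
  assumes "f \<in> borel_measurable M"
  shows "(\<integral>\<^sup>+x. f x \<partial>convex_mix u v M N) = ennreal u * (\<integral>\<^sup>+x. f x \<partial>M) + ennreal v * (\<integral>\<^sup>+x. f x \<partial>N)"
  using assms sets_eq unfolding convex_mix_def
  by (subst nn_integral_plus_measure)
     (auto simp: nn_integral_scale_measure measurable_cong_sets[OF sets_eq refl] measurable_cong_sets[OF sets_scale_measure refl])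

text \<open>Without measurability of \<open>f\<close> only this direction is argued: one simple
  minorant on the mixture serves both components, whereas the components may prefer different
  minorants. It is the direction that convexity of \<phi> requires.\<close>

lemma nn_integral_convex_mix_le:
  "(\<integral>\<^sup>+x. f x \<partial>convex_mix u v M N) \<le> ennreal u * (\<integral>\<^sup>+x. f x \<partial>M) + ennreal v * (\<integral>\<^sup>+x. f x \<partial>N)"
  unfolding nn_integral_def[of "convex_mix u v M N" f]
proof (rule SUP_least)
  fix s assume "s \<in> {g. simple_function (convex_mix u v M N) g \<and> g \<le> f}"
  then have s: "simple_function (convex_mix u v M N) s" "\<And>x. s x \<le> f x" by (auto simp: le_fun_def)
  have "s \<in> borel_measurable M"
    using borel_measurable_simple_function[OF s(1)] by (simp add: measurable_cong_sets[OF sets_convex_mix refl])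
  then have "integral\<^sup>S (convex_mix u v M N) s = ennreal u * (\<integral>\<^sup>+x. s x \<partial>M) + ennreal v * (\<integral>\<^sup>+x. s x \<partial>N)"
    using s(1) by (simp add: nn_integral_eq_simple_integral[symmetric] nn_integral_convex_mix)
  also have "\<dots> \<le> ennreal u * (\<integral>\<^sup>+x. f x \<partial>M) + ennreal v * (\<integral>\<^sup>+x. f x \<partial>N)"
    using s(2) by (intro add_mono mult_left_mono nn_integral_mono) auto
  finally show "integral\<^sup>S (convex_mix u v M N) s \<le> \<dots>" .
qed

lemma prob_space_convex_mix:
  assumes "prob_space M" "prob_space N"
  shows "prob_space (convex_mix u v M N)"
proof
  have "emeasure (convex_mix u v M N) (space M) = ennreal u * emeasure M (space M) + ennreal v * emeasure N (space N)"
    using sets_eq sets_eq_imp_space_eq[OF sets_eq] unfolding convex_mix_def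
    by (subst emeasure_plus_measure) auto
  also have "\<dots> = 1" using uv assms by (simp add: prob_space.emeasure_space_1 flip: ennreal_plus)
  finally show "emeasure (convex_mix u v M N) (space (convex_mix u v M N)) = 1" by (simp add: space_convex_mix)
qed

lemma has_bochner_integral_convex_mix:
  fixes f :: "'b \<Rightarrow> real"
  assumes "has_bochner_integral M f a" "has_bochner_integral N f b"
  shows "has_bochner_integral (convex_mix u v M N) f (u * a + v * b)"
proof -
  have iM: "integrable M f" and iN: "integrable N f" using assms by (auto simp: has_bochner_integral_iff)
  have fm[measurable]: "f \<in> borel_measurable M" using iM by auto
  have finM: "(\<integral>\<^sup>+x. ennreal (norm (f x)) \<partial>M) < \<infinity>" and finN: "(\<integral>\<^sup>+x. ennreal (norm (f x)) \<partial>N) < \<infinity>"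
    using iM iN by (auto simp: integrable_iff_bounded)
  have int: "integrable (convex_mix u v M N) f"
    unfolding integrable_iff_bounded using finM finN
    by (simp add: nn_integral_convex_mix measurable_cong_sets[OF sets_convex_mix refl] ennreal_mult_less_top)
  have fin: "(\<integral>\<^sup>+x. ennreal (f x) \<partial>K) < \<infinity>" "(\<integral>\<^sup>+x. ennreal (- f x) \<partial>K) < \<infinity>" if "integrable K f" for K
  proof -
    have "(\<integral>\<^sup>+x. ennreal (norm (f x)) \<partial>K) < \<infinity>" using that by (simp add: integrable_iff_bounded)
    moreover have "(\<integral>\<^sup>+x. ennreal (f x) \<partial>K) \<le> (\<integral>\<^sup>+x. ennreal (norm (f x)) \<partial>K)"
      "(\<integral>\<^sup>+x. ennreal (- f x) \<partial>K) \<le> (\<integral>\<^sup>+x. ennreal (norm (f x)) \<partial>K)"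
      by (auto intro!: nn_integral_mono ennreal_leI)
    ultimately show "(\<integral>\<^sup>+x. ennreal (f x) \<partial>K) < \<infinity>" "(\<integral>\<^sup>+x. ennreal (- f x) \<partial>K) < \<infinity>"
      by (auto intro: le_less_trans)
  qed
  have e: "enn2real (ennreal u * A + ennreal v * B) = u * enn2real A + v * enn2real B"
    if AB: "A < \<infinity>" "B < \<infinity>" for A B
  proof -
    obtain a b where "A = ennreal a" "0 \<le> a" "B = ennreal b" "0 \<le> b" using AB by (cases A; cases B) auto
    moreover from this have "ennreal u * A + ennreal v * B = ennreal (u * a + v * b)"
      using uv by (simp add: ennreal_mult ennreal_plus)
    ultimately show ?thesis using uv by (simp del: ennreal_plus)
  qed
  have "integral\<^sup>L (convex_mix u v M N) f = u * integral\<^sup>L M f + v * integral\<^sup>L N f"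
    using fin[OF iM] fin[OF iN]
    by (simp add: real_lebesgue_integral_def int iM iN nn_integral_convex_mix e algebra_simps)
  with int assms show ?thesis by (simp add: has_bochner_integral_iff)
qed

end

text \<open>A simple minorant of \<open>f\<close> pulls back to a measurable minorant of the
  composition with \<open>S\<close>, but a minorant of the composition need not factor through
  \<open>S\<close>; hence an inequality for general \<open>f\<close>.\<close>

lemma nn_integral_distr_le:
  assumes S: "S \<in> measurable M N"
  shows "(\<integral>\<^sup>+x. f x \<partial>distr M N S) \<le> (\<integral>\<^sup>+x. f (S x) \<partial>M)"
  unfolding nn_integral_def[of "distr M N S" f]
proof (rule SUP_least)
  fix s assume "s \<in> {g. simple_function (distr M N S) g \<and> g \<le> f}"
  then have s: "simple_function (distr M N S) s" "\<And>x. s x \<le> f x" by (auto simp: le_fun_def)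
  have "integral\<^sup>S (distr M N S) s = (\<integral>\<^sup>+x. s (S x) \<partial>M)"
    using s(1) borel_measurable_simple_function[OF s(1)] S
    by (simp add: nn_integral_eq_simple_integral[symmetric] nn_integral_distr)
  also have "\<dots> \<le> (\<integral>\<^sup>+x. f (S x) \<partial>M)" using s(2) by (intro nn_integral_mono)
  finally show "integral\<^sup>S (distr M N S) s \<le> (\<integral>\<^sup>+x. f (S x) \<partial>M)" .
qed

section \<open>Push-forward of a plan under radial scaling\<close>

context radial_scaling
begin

lemma scale_path_in_Omega: "z \<in> Omega T M \<Longrightarrow> scale_path z \<in> Omega T M"
  using continuous_on_scale_path[of z] scale_path_in_cone_over[of z] unfolding Omega_eq
  by (auto simp: scale_path_def)

lemma scale_path_measurable: "scale_path \<in> measurable (path_borel T M) (path_borel T M)"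
proof (rule continuous_map_measurable_path_borel)
  have "mdist (path_metric T M) (scale_path z) (scale_path w) \<le> 3 * mdist (path_metric T M) z w"
    if "z \<in> Omega T M" "w \<in> Omega T M" for z w
  proof (rule path_mdist_le)
    fix t assume t: "t \<in> {0..T}"
    have "dist (scale_path z t) (scale_path w t) \<le> 3 * dist (z t) (w t)"
      using t that by (simp add: scale_path_def scale_point_dist_le Omega_D(3))
    also have "\<dots> \<le> 3 * mdist (path_metric T M) z w" using dist_eval_le_path_mdist[OF that t] by simp
    finally show "dist (scale_path z t) (scale_path w t) \<le> 3 * mdist (path_metric T M) z w" .
  qed simp
  then have "Lipschitz_continuous_map (path_metric T M) (path_metric T M) scale_path"
    unfolding Lipschitz_continuous_map_def using scale_path_in_Omega by blast
  then show "continuous_map (mtopology_of (path_metric T M)) (mtopology_of (path_metric T M)) scale_path"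
    by (rule Lipschitz_continuous_imp_continuous_map)
qed

context
  fixes \<mu> :: "(real \<Rightarrow> 'a cone) measure"
  assumes \<mu>: "\<mu> \<in> path_prob T M"
begin

definition "scaled_plan = distr \<mu> (path_borel T M) scale_path"

lemma scale_path_measurable_plan: "scale_path \<in> measurable \<mu> (path_borel T M)"
  using scale_path_measurable by (simp add: path_prob_measurable_cong[OF \<mu>])

lemma scaled_plan_path_prob: "scaled_plan \<in> path_prob T M"
  using prob_space.prob_space_distr[OF _ scale_path_measurable_plan] \<mu>
  by (auto simp: scaled_plan_def path_prob_def)

lemma scaled_plan_coupling:
  assumes "coupling_constraint T M \<gamma> \<mu>" and one: "\<And>x. x \<in> M \<Longrightarrow> \<kappa> (0, x) = 1 \<and> \<kappa> (T, x) = 1"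
  shows "coupling_constraint T M \<gamma> scaled_plan"
  unfolding coupling_constraint_def
proof (intro allI impI)
  fix f :: "'a cone \<times> 'a cone \<Rightarrow> real"
  assume "continuous_on (cone_over M \<times> cone_over M) f \<and> homogeneous2 M f"
  then have b: "has_bochner_integral \<mu> (\<lambda>z. f (z 0, z T)) (LINT p|\<gamma>. f p)"
    using assms(1) by (simp add: coupling_constraint_def)
  have "scale_path z t = z t" if "z \<in> space \<mu>" "t = 0 \<or> t = T" for z t
  proof -
    have "z \<in> Omega T M" "t \<in> {0..T}" using that T by (auto simp: path_prob_space[OF \<mu>])
    then have "z t \<in> cone_over M" by (rule Omega_D)
    with \<open>t \<in> {0..T}\<close> that(2) one pi_x_M[OF \<open>t \<in> {0..T}\<close>] show ?thesis
      by (auto simp: scale_path_def intro!: scale_point_eq)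
  qed
  then have "has_bochner_integral \<mu> (\<lambda>z. f (scale_path z 0, scale_path z T)) (LINT p|\<gamma>. f p)"
    using b by (subst has_bochner_integral_cong[OF refl _ refl]) auto
  moreover have "(\<lambda>z. f (z 0, z T)) \<in> borel_measurable (path_borel T M)"
    using b by (auto simp: has_bochner_integral_iff path_prob_measurable_cong[OF \<mu>, symmetric])
  ultimately show "has_bochner_integral scaled_plan (\<lambda>z. f (z 0, z T)) (LINT p|\<gamma>. f p)"
    unfolding scaled_plan_def using scale_path_measurable_plan by (intro has_bochner_integral_distr)
qed

text \<open>Base points do not move and r^2 is multiplied by \<kappa>^2, so testing the new plan
  with \<open>f\<close> amounts to testing the old one with f \<kappa>^2.\<close>

lemma scaled_plan_weak_density:
  assumes \<rho>: "weak_density T M xbar \<mu> (\<lambda>_. 1)"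
  shows "weak_density T M xbar scaled_plan (\<lambda>p. (\<kappa> p)\<^sup>2)"
  unfolding weak_density_def
proof (intro allI impI)
  fix f :: "real \<times> 'a \<Rightarrow> real" assume f: "continuous_on ({0..T} \<times> M) f"
  have "(1/2)-lipschitz_on ({0..T} \<times> M) \<kappa>"
    using scale_lipschitz by (intro lipschitz_onI) (auto simp: dist_real_def)
  then have \<kappa>: "continuous_on ({0..T} \<times> M) \<kappa>" by (rule lipschitz_on_continuous_on)
  let ?F = "\<lambda>z. LINT t:{0..T}|lborel. f (t, pi_x xbar (z t)) * (pi_r (z t))\<^sup>2"
  let ?I = "LINT x:M|rho0 M. (LINT t:{0..T}|lborel. f (t, x) * (\<kappa> (t, x))\<^sup>2)"
  have "continuous_on ({0..T} \<times> M) (\<lambda>p. f p * (\<kappa> p)\<^sup>2)" using f \<kappa> by (intro continuous_intros)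
  then have b: "has_bochner_integral \<mu> (\<lambda>z. LINT t:{0..T}|lborel. (f (t, pi_x xbar (z t)) * (\<kappa> (t, pi_x xbar (z t)))\<^sup>2) * (pi_r (z t))\<^sup>2) ?I"
    using \<rho>[unfolded weak_density_def, rule_format, of "\<lambda>p. f p * (\<kappa> p)\<^sup>2"] by simp
  have "?F (scale_path z) = (LINT t:{0..T}|lborel. (f (t, pi_x xbar (z t)) * (\<kappa> (t, pi_x xbar (z t)))\<^sup>2) * (pi_r (z t))\<^sup>2)"
    if "z \<in> space \<mu>" for z
  proof (rule set_lebesgue_integral_cong)
    have zM: "z \<in> Omega T M" using that by (simp add: path_prob_space[OF \<mu>])
    show "\<forall>t. t \<in> {0..T} \<longrightarrow> f (t, pi_x xbar (scale_path z t)) * (pi_r (scale_path z t))\<^sup>2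
        = (f (t, pi_x xbar (z t)) * (\<kappa> (t, pi_x xbar (z t)))\<^sup>2) * (pi_r (z t))\<^sup>2"
    proof (intro allI impI)
      fix t assume t: "t \<in> {0..T}"
      then have "z t \<in> cone_over M" using Omega_D[OF zM] by blast
      with t show "f (t, pi_x xbar (scale_path z t)) * (pi_r (scale_path z t))\<^sup>2
        = (f (t, pi_x xbar (z t)) * (\<kappa> (t, pi_x xbar (z t)))\<^sup>2) * (pi_r (z t))\<^sup>2"
        by (simp add: scale_path_def power_mult_distrib)
    qed
  qed simp
  then have "has_bochner_integral \<mu> (\<lambda>z. ?F (scale_path z)) ?I"
    using b by (subst has_bochner_integral_cong[OF refl _ refl]) auto
  moreover have "?F \<in> borel_measurable (path_borel T M)"
    using \<rho> f by (auto simp: weak_density_def has_bochner_integral_iff path_prob_measurable_cong[OF \<mu>, symmetric])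
  ultimately show "has_bochner_integral scaled_plan ?F ?I"
    unfolding scaled_plan_def using scale_path_measurable_plan by (intro has_bochner_integral_distr)
qed

text \<open>The additional term of the pathwise estimate is the time integral of r^2. Its mean is
  known from the density of \<open>\<mu>\<close>, tested with the constant 1, and does not depend on
  \<kappa>.\<close>

lemma scaled_plan_action_le:
  assumes \<rho>: "weak_density T M xbar \<mu> (\<lambda>_. 1)"
  shows "action T xbar scaled_plan \<le> 7 * action T xbar \<mu> + ennreal (LINT x:M|rho0 M. (LINT t:{0..T}|lborel. 1))"
proof -
  let ?h = "\<lambda>z :: real \<Rightarrow> 'a cone. LINT t:{0..T}|lborel. (pi_r (z t))\<^sup>2"
  have b: "has_bochner_integral \<mu> ?h (LINT x:M|rho0 M. (LINT t:{0..T}|lborel. 1))"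
    using \<rho>[unfolded weak_density_def, rule_format, of "\<lambda>_. 1"] by simp
  have h0: "0 \<le> ?h z" for z by (simp add: set_lebesgue_integral_def)
  have "action T xbar scaled_plan \<le> (\<integral>\<^sup>+z. path_action T xbar (scale_path z) \<partial>\<mu>)"
    unfolding action_def scaled_plan_def by (rule nn_integral_distr_le[OF scale_path_measurable_plan])
  also have "\<dots> \<le> ennreal 7 * (\<integral>\<^sup>+z. path_action T xbar z \<partial>\<mu>) + (\<integral>\<^sup>+z. ennreal (?h z) \<partial>\<mu>)"
  proof (rule nn_integral_le_cmult_add)
    show "(\<lambda>z. ennreal (?h z)) \<in> borel_measurable \<mu>" using b by (auto simp: has_bochner_integral_iff)
    show "AE z in \<mu>. path_action T xbar (scale_path z) \<le> ennreal 7 * path_action T xbar z + ennreal (?h z)"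
    proof (rule AE_I2)
      fix z assume "z \<in> space \<mu>"
      then have z: "continuous_on {0..T} z" "z ` {0..T} \<subseteq> cone_over M"
        using Omega_D[of z T M] by (auto simp: path_prob_space[OF \<mu>])
      have "set_integrable lborel {0..T} (\<lambda>t. (pi_r (z t))\<^sup>2)"
        using z by (intro borel_integrable_atLeastAtMost' continuous_intros)
      then have "(\<integral>\<^sup>+t\<in>{0..T}. ennreal ((pi_r (z t))\<^sup>2) \<partial>lborel) = ennreal (?h z)"
        unfolding set_lebesgue_integral_def set_integrable_def
        by (subst nn_integral_eq_integral[symmetric]) (auto intro!: nn_integral_cong simp: indicator_def)
      then show "path_action T xbar (scale_path z) \<le> ennreal 7 * path_action T xbar z + ennreal (?h z)"
        using path_action_scale_path_le[OF z] by simp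
    qed
  qed auto
  also have "(\<integral>\<^sup>+z. ennreal (?h z) \<partial>\<mu>) = ennreal (LINT x:M|rho0 M. (LINT t:{0..T}|lborel. 1))"
    using b h0 by (subst nn_integral_eq_integral) (auto simp: has_bochner_integral_iff)
  finally show ?thesis by (simp add: action_def)
qed

end

end

section \<open>Densities of plans\<close>

text \<open>\<open>pi_x\<close> is discontinuous at the apex, but \<open>f\<close> is bounded and
  the factor r^2 extinguishes the jump. The parameter in \<open>S\<close> is time in the marginal
  constraint and the other endpoint in the coupling constraint.\<close>

lemma continuous_on_cone_square:
  fixes f :: "'s::metric_space \<times> 'a::euclidean_space \<Rightarrow> real"
  assumes f: "continuous_on (S \<times> M) f" and B: "\<And>p. p \<in> S \<times> M \<Longrightarrow> \<bar>f p\<bar> \<le> B" and x: "xbar \<in> M"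
  shows "continuous_on (S \<times> cone_over M) (\<lambda>p. f (fst p, pi_x xbar (snd p)) * (pi_r (snd p))\<^sup>2)"
  unfolding continuous_on_def
proof
  fix p assume p: "p \<in> S \<times> cone_over M"
  let ?F = "at p within S \<times> cone_over M"
  let ?g = "\<lambda>p. (fst p, pi_x xbar (snd p))"
  have gM: "?g q \<in> S \<times> M" if "q \<in> S \<times> cone_over M" for q
    using that x by (auto intro: pi_x_in_cone_over)
  have ev: "\<forall>\<^sub>F q in ?F. q \<in> S \<times> cone_over M" by (simp add: eventually_at_filter)
  have r: "((\<lambda>q. (pi_r (snd q))\<^sup>2) \<longlongrightarrow> (pi_r (snd p))\<^sup>2) ?F"
  proof -
    have "continuous_on (S \<times> cone_over M) (\<lambda>q. (pi_r (snd q))\<^sup>2)" by (intro continuous_intros)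
    then show ?thesis using p by (auto simp: continuous_on_def)
  qed
  show "((\<lambda>p. f (?g p) * (pi_r (snd p))\<^sup>2) \<longlongrightarrow> f (?g p) * (pi_r (snd p))\<^sup>2) ?F"
  proof (cases "snd p = apex")
    case True
    have "((\<lambda>q. B * (pi_r (snd q))\<^sup>2) \<longlongrightarrow> 0) ?F" using tendsto_mult_right_zero[of "\<lambda>q. (pi_r (snd q))\<^sup>2" ?F B] r True by simp
    moreover have "\<forall>\<^sub>F q in ?F. norm (f (?g q) * (pi_r (snd q))\<^sup>2) \<le> B * (pi_r (snd q))\<^sup>2"
      using ev by eventually_elim (use gM B in \<open>auto simp: abs_mult intro!: mult_right_mono\<close>)
    ultimately have "((\<lambda>p. f (?g p) * (pi_r (snd p))\<^sup>2) \<longlongrightarrow> 0) ?F" by (rule Lim_null_comparison[rotated])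
    then show ?thesis using True by simp
  next
    case False
    have "((\<lambda>q. pi_x xbar (snd q)) \<longlongrightarrow> pi_x xbar (snd p)) ?F"
      by (rule isCont_tendsto_compose[OF isCont_pi_x[OF False]]) (intro tendsto_intros)
    then have "(?g \<longlongrightarrow> ?g p) ?F" by (intro tendsto_Pair tendsto_intros)
    then have "((\<lambda>q. f (?g q)) \<longlongrightarrow> f (?g p)) ?F"
      using gM[OF p] eventually_mono[OF ev gM] by (rule continuous_on_tendsto_compose[OF f])
    then show ?thesis using r by (rule tendsto_mult)
  qed
qed

lemma eval_compose_measurable:
  fixes \<phi> :: "real \<times> 'a::euclidean_space cone \<Rightarrow> real"
  assumes \<phi>: "continuous_on ({0..T} \<times> cone_over M) \<phi>" and t: "t \<in> {0..T}"
  shows "(\<lambda>z. \<phi> (t, z t)) \<in> borel_measurable (path_borel T M)"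
proof -
  have "continuous_on (cone_over M) (\<lambda>c. \<phi> (t, c))"
    by (rule continuous_on_compose2[OF \<phi>]) (use t in \<open>auto intro!: continuous_intros\<close>)
  then have "(\<lambda>c. \<phi> (t, c)) \<in> borel_measurable (restrict_space borel (cone_over M))"
    by (rule borel_measurable_continuous_on_restrict)
  from measurable_compose[OF eval_measurable_path_borel[OF t] this] show ?thesis .
qed

text \<open>Continuity of the paths reduces joint measurability to fixed times: time is replaced by
  a grid point of mesh 1/(n+1), and a function of countably many fixed times is measurable. Rounding
  down keeps the grid point between 0 and \<open>t\<close>, so the path is never evaluated outside
  \<open>{0..T}\<close>.\<close>

lemma eval_jointly_measurable:
  fixes \<phi> :: "real \<times> 'a::euclidean_space cone \<Rightarrow> real"
  assumes \<phi>: "continuous_on ({0..T} \<times> cone_over M) \<phi>"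
  shows "(\<lambda>(z, t). indicator {0..T} t * \<phi> (t, z t)) \<in> borel_measurable (path_borel T M \<Otimes>\<^sub>M borel)"
proof -
  define G where "G n i z = (if real_of_int i / real (Suc n) \<in> {0..T}
      then \<phi> (real_of_int i / real (Suc n), z (real_of_int i / real (Suc n))) else 0)" for n and i :: int and z
  have Gm: "G n i \<in> borel_measurable (path_borel T M)" for n i
    unfolding G_def[abs_def] using eval_compose_measurable[OF \<phi>]
    by (cases "real_of_int i / real (Suc n) \<in> {0..T}") auto
  define F where "F n p = indicator {0..T} (snd p) * G n \<lfloor>snd p * real (Suc n)\<rfloor> (fst p)" for n p
  have Fm: "F n \<in> borel_measurable (path_borel T M \<Otimes>\<^sub>M borel)" for n
    unfolding F_def[abs_def]
  proof (intro borel_measurable_times)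
    show "(\<lambda>p. G n \<lfloor>snd p * real (Suc n)\<rfloor> (fst p)) \<in> borel_measurable (path_borel T M \<Otimes>\<^sub>M borel)"
    proof (rule measurable_compose_countable[where f="\<lambda>i p. G n i (fst p)" and g="\<lambda>p. \<lfloor>snd p * real (Suc n)\<rfloor>"])
      show "(\<lambda>p. G n i (fst p)) \<in> borel_measurable (path_borel T M \<Otimes>\<^sub>M borel)" for i
        using measurable_compose[OF measurable_fst Gm] .
    qed measurable
  qed measurable
  show ?thesis
  proof (rule borel_measurable_LIMSEQ_real[OF _ Fm])
    fix p assume "p \<in> space (path_borel T M \<Otimes>\<^sub>M (borel :: real measure))"
    then obtain z t where p: "p = (z, t)" and z: "z \<in> Omega T M" by (auto simp: space_pair_measure)
    show "(\<lambda>n. F n p) \<longlonglongrightarrow> (case p of (z, t) \<Rightarrow> indicator {0..T} t * \<phi> (t, z t))"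
    proof (cases "t \<in> {0..T}")
      case True
      define \<tau> where "\<tau> n = real_of_int \<lfloor>t * real (Suc n)\<rfloor> / real (Suc n)" for n
      have \<tau>: "0 \<le> \<tau> n" "\<tau> n \<le> t" "t - 1 / real (Suc n) \<le> \<tau> n" for n
      proof -
        have "real_of_int \<lfloor>t * real (Suc n)\<rfloor> \<le> t * real (Suc n)" by (rule of_int_floor_le)
        then show "\<tau> n \<le> t" by (simp add: \<tau>_def divide_le_eq)
        show "0 \<le> \<tau> n" using True by (simp add: \<tau>_def)
        have "t * real (Suc n) - 1 \<le> real_of_int \<lfloor>t * real (Suc n)\<rfloor>" by linarith
        then have "(t * real (Suc n) - 1) / real (Suc n) \<le> \<tau> n" unfolding \<tau>_def by (rule divide_right_mono) simp
        then show "t - 1 / real (Suc n) \<le> \<tau> n" by (simp add: diff_divide_distrib)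
      qed
      have "(\<lambda>n. t - 1 / real (Suc n)) \<longlonglongrightarrow> t"
        using tendsto_diff[OF tendsto_const[of t] LIMSEQ_Suc[OF lim_1_over_n]] by simp
      then have lim: "\<tau> \<longlonglongrightarrow> t"
        using \<tau> by (intro tendsto_sandwich[where f="\<lambda>n. t - 1 / real (Suc n)" and h="\<lambda>_. t" and g=\<tau>]) auto
      have T\<tau>: "\<tau> n \<in> {0..T}" for n using \<tau>[of n] True by auto
      have "continuous_on {0..T} (\<lambda>s. \<phi> (s, z s))"
        by (rule continuous_on_compose2[OF \<phi>]) (use Omega_D[OF z] in \<open>auto intro!: continuous_intros\<close>)
      then have "(\<lambda>n. \<phi> (\<tau> n, z (\<tau> n))) \<longlonglongrightarrow> \<phi> (t, z t)"
        using lim True T\<tau> by (intro continuous_on_tendsto_compose[of "{0..T}" "\<lambda>s. \<phi> (s, z s)"]) auto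
      moreover have "F n p = \<phi> (\<tau> n, z (\<tau> n))" for n
        using True T\<tau>[of n] by (simp add: F_def G_def p \<tau>_def)
      ultimately show ?thesis using True by (simp add: p)
    qed (simp add: F_def p)
  qed
qed

text \<open>A bound on the first moments uniform in \<open>t\<close> gives absolute integrability on
  the product, as the time interval is bounded.\<close>

lemma eval_fubini:
  fixes \<phi> :: "real \<times> 'a::euclidean_space cone \<Rightarrow> real"
  assumes \<nu>: "\<nu> \<in> path_prob T M" and \<phi>: "continuous_on ({0..T} \<times> cone_over M) \<phi>"
    and K: "\<And>t. t \<in> {0..T} \<Longrightarrow> (\<integral>\<^sup>+z. ennreal \<bar>\<phi> (t, z t)\<bar> \<partial>\<nu>) \<le> ennreal K"
  shows "has_bochner_integral \<nu> (\<lambda>z. LINT t:{0..T}|lborel. \<phi> (t, z t)) (LINT t:{0..T}|lborel. (\<integral>z. \<phi> (t, z t) \<partial>\<nu>))"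
proof -
  interpret \<nu>: prob_space \<nu> using \<nu> by (simp add: path_prob_def)
  interpret P: pair_sigma_finite \<nu> "lborel :: real measure" ..
  let ?f = "\<lambda>z t. indicator {0..T} t * \<phi> (t, z t)"
  have m: "(\<lambda>(z, t). ?f z t) \<in> borel_measurable (\<nu> \<Otimes>\<^sub>M lborel)"
    using eval_jointly_measurable[OF \<phi>] \<nu>
    by (subst measurable_cong_sets[OF sets_pair_measure_cong refl]) (auto simp: path_prob_def)
  have int: "integrable (\<nu> \<Otimes>\<^sub>M lborel) (\<lambda>(z, t). ?f z t)"
  proof (rule integrableI_bounded[OF m])
    have "(\<integral>\<^sup>+p. ennreal (norm (case p of (z, t) \<Rightarrow> ?f z t)) \<partial>(\<nu> \<Otimes>\<^sub>M lborel))
        = (\<integral>\<^sup>+t. \<integral>\<^sup>+z. ennreal (norm (?f z t)) \<partial>\<nu> \<partial>lborel)"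
      using m by (subst P.nn_integral_snd[symmetric]) auto
    also have "\<dots> \<le> (\<integral>\<^sup>+t. ennreal K * indicator {0..T} t \<partial>lborel)"
    proof (rule nn_integral_mono)
      fix t
      show "(\<integral>\<^sup>+z. ennreal (norm (?f z t)) \<partial>\<nu>) \<le> ennreal K * indicator {0..T} t"
        using K[of t] by (cases "t \<in> {0..T}") auto
    qed
    also have "\<dots> < \<infinity>" by (simp add: nn_integral_cmult_indicator ennreal_mult_less_top emeasure_lborel_Icc_eq)
    finally show "(\<integral>\<^sup>+p. ennreal (norm (case p of (z, t) \<Rightarrow> ?f z t)) \<partial>(\<nu> \<Otimes>\<^sub>M lborel)) < \<infinity>" .
  qed
  have "(\<integral>z. (\<integral>t. ?f z t \<partial>lborel) \<partial>\<nu>) = (\<integral>t. (\<integral>z. ?f z t \<partial>\<nu>) \<partial>lborel)"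
    using P.Fubini_integral[OF int] by simp
  also have "\<dots> = (LINT t:{0..T}|lborel. (\<integral>z. \<phi> (t, z t) \<partial>\<nu>))"
    by (simp add: set_lebesgue_integral_def)
  finally show ?thesis
    using P.integrable_fst[OF int] by (simp add: has_bochner_integral_iff set_lebesgue_integral_def)
qed

section \<open>The reference measure and densities at a given time\<close>

lemma rho0_prob_space:
  fixes U M :: "'a::euclidean_space set"
  assumes "open U" "bounded U" "U \<noteq> {}" "M = closure U"
  shows "prob_space (rho0 M)"
  unfolding rho0_def
proof (rule prob_space_uniform_measure)
  have M: "M \<in> sets lborel" "U \<subseteq> M" "bounded M" using assms by (auto simp: closure_subset bounded_closure)
  show "emeasure lborel M \<noteq> 0"
  proof
    assume "emeasure lborel M = 0"
    then have "emeasure lborel U = 0" using emeasure_mono[OF M(2,1)] by auto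
    then have "negligible U" using assms(1) by (simp add: negligible_iff_null_sets null_sets_def)
    then show False using open_not_negligible assms(1,3) by blast
  qed
  show "emeasure lborel M \<noteq> \<infinity>" using emeasure_bounded_finite[OF M(3)] by auto
qed

lemma sets_rho0 [simp, measurable_cong]: "sets (rho0 M) = sets borel"
  by (simp add: rho0_def)

text \<open>Nonempty open sets are not negligible, so the set in \<open>U\<close> where
  \<open>h\<close> is nonzero is empty; continuity then passes to the closure.\<close>

lemma continuous_on_closure_zero_AE:
  fixes h :: "'a::euclidean_space \<Rightarrow> real"
  assumes U: "open U" "bounded U" "U \<noteq> {}" "M = closure U"
    and h: "continuous_on M h" and ae: "AE x in rho0 M. x \<in> M \<longrightarrow> h x = 0" and x: "x \<in> M"
  shows "h x = 0"
proof -
  have M: "M \<in> sets lborel" "U \<subseteq> M" using U by (auto simp: closure_subset)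
  have "emeasure lborel M \<noteq> \<infinity>"
    using emeasure_bounded_finite[of M] U by (simp add: bounded_closure)
  have ae': "AE x in lborel. x \<in> M \<longrightarrow> h x = 0"
  proof -
    have "emeasure lborel M \<noteq> 0"
    proof
      assume "emeasure lborel M = 0"
      then have "emeasure (rho0 M) (space (rho0 M)) = 0" unfolding rho0_def using M(1) by (subst emeasure_uniform_measure) auto
      then show False using prob_space.emeasure_space_1[OF rho0_prob_space[OF U]] by simp
    qed
    then show ?thesis using ae \<open>emeasure lborel M \<noteq> \<infinity>\<close> M unfolding rho0_def
      by (subst (asm) AE_uniform_measure) (auto simp: top.not_eq_extremum zero_less_iff_neq_zero)
  qed
  define V where "V = h -` (- {0}) \<inter> U"
  have op: "open V" unfolding V_def
    using continuous_on_subset[OF h M(2)] U(1) by (subst (asm) continuous_on_open_vimage) auto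
  have "AE x in lborel. x \<notin> V" using ae' by eventually_elim (use M(2) in \<open>auto simp: V_def\<close>)
  then have "V \<in> null_sets lborel" using op by (subst (asm) AE_iff_null_sets[symmetric]) auto
  then have "negligible V" by (simp add: negligible_iff_null_sets null_sets_completionI)
  then have "V = {}" using open_not_negligible[OF op] by blast
  then have "h y = 0" if "y \<in> U" for y using that by (auto simp: V_def)
  then show ?thesis using continuous_constant_on_closure[of U h 0 x] h x U(4) by simp
qed

lemma double_integral:
  fixes h :: "real \<times> 'a::euclidean_space \<Rightarrow> real"
  assumes h: "continuous_on ({0..T} \<times> M) h" and M: "compact M" "prob_space (rho0 M)"
  shows "integrable (rho0 M \<Otimes>\<^sub>M lborel) (\<lambda>(x, t). indicator M x * (indicator {0..T} t * h (t, x)))"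
    and "(LINT x:M|rho0 M. (LINT t:{0..T}|lborel. h (t, x)))
      = (\<integral>(x, t). indicator M x * (indicator {0..T} t * h (t, x)) \<partial>(rho0 M \<Otimes>\<^sub>M lborel))"
    and "(LINT x:M|rho0 M. (LINT t:{0..T}|lborel. h (t, x)))
      = (LINT t:{0..T}|lborel. (LINT x:M|rho0 M. h (t, x)))"
proof -
  interpret R: prob_space "rho0 M" by (rule M(2))
  interpret P: pair_sigma_finite "rho0 M" "lborel :: real measure" ..
  let ?f = "\<lambda>x t. indicator M x * (indicator {0..T} t * h (t, x))"
  have Mb: "M \<in> sets borel" using M(1) by (simp add: compact_imp_closed)
  obtain B where B: "\<And>p. p \<in> {0..T} \<times> M \<Longrightarrow> \<bar>h p\<bar> \<le> B"
  proof -
    have "bounded (h ` ({0..T} \<times> M))"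
      using h M(1) by (intro compact_imp_bounded compact_continuous_image compact_Times) auto
    then show ?thesis using that by (auto simp: bounded_iff)
  qed
  have "continuous_on (M \<times> {0..T}) (\<lambda>p. h (snd p, fst p))"
    by (rule continuous_on_compose2[OF h]) (auto intro!: continuous_intros)
  moreover have "M \<times> {0..T} \<in> sets borel"
    using M(1) by (intro borel_closed compact_imp_closed compact_Times) auto
  ultimately have "(\<lambda>p. indicator (M \<times> {0..T}) p *\<^sub>R h (snd p, fst p)) \<in> borel_measurable borel"
    by (intro borel_measurable_continuous_on_indicator)
  also have "(\<lambda>p. indicator (M \<times> {0..T}) p *\<^sub>R h (snd p, fst p)) = (\<lambda>(x, t). ?f x t)"
    by (auto simp: indicator_def fun_eq_iff)
  finally have m: "(\<lambda>(x, t). ?f x t) \<in> borel_measurable (rho0 M \<Otimes>\<^sub>M lborel)"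
    by (subst measurable_cong_sets[OF _ refl, of _ "borel \<Otimes>\<^sub>M borel"]) (auto simp: borel_prod intro!: sets_pair_measure_cong)
  show int: "integrable (rho0 M \<Otimes>\<^sub>M lborel) (\<lambda>(x, t). ?f x t)"
  proof (rule integrableI_bounded[OF m])
    have "(\<integral>\<^sup>+p. ennreal (norm (case p of (x, t) \<Rightarrow> ?f x t)) \<partial>(rho0 M \<Otimes>\<^sub>M lborel))
        = (\<integral>\<^sup>+t. \<integral>\<^sup>+x. ennreal (norm (?f x t)) \<partial>rho0 M \<partial>lborel)"
      using m by (subst P.nn_integral_snd[symmetric]) auto
    also have "\<dots> \<le> (\<integral>\<^sup>+t. ennreal \<bar>B\<bar> * indicator {0..T} t \<partial>lborel)"
    proof (rule nn_integral_mono)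
      fix t
      have "(\<integral>\<^sup>+x. ennreal (norm (?f x t)) \<partial>rho0 M) \<le> (\<integral>\<^sup>+x. ennreal \<bar>B\<bar> * indicator {0..T} t \<partial>rho0 M)"
        using B by (intro nn_integral_mono) (auto simp: indicator_def intro!: ennreal_leI order.trans[OF B abs_ge_self])
      then show "(\<integral>\<^sup>+x. ennreal (norm (?f x t)) \<partial>rho0 M) \<le> ennreal \<bar>B\<bar> * indicator {0..T} t"
        by (simp add: R.emeasure_space_1)
    qed
    also have "\<dots> < \<infinity>" by (simp add: nn_integral_cmult_indicator ennreal_mult_less_top emeasure_lborel_Icc_eq)
    finally show "(\<integral>\<^sup>+p. ennreal (norm (case p of (x, t) \<Rightarrow> ?f x t)) \<partial>(rho0 M \<Otimes>\<^sub>M lborel)) < \<infinity>" .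
  qed
  have fst: "(LINT x:M|rho0 M. (LINT t:{0..T}|lborel. h (t, x))) = (\<integral>x. (\<integral>t. ?f x t \<partial>lborel) \<partial>rho0 M)"
    by (simp add: set_lebesgue_integral_def)
  also have "\<dots> = (\<integral>(x, t). ?f x t \<partial>(rho0 M \<Otimes>\<^sub>M lborel))" using P.integral_fst[OF int] .
  finally show "(LINT x:M|rho0 M. (LINT t:{0..T}|lborel. h (t, x))) = (\<integral>(x, t). ?f x t \<partial>(rho0 M \<Otimes>\<^sub>M lborel))" .
  have "(\<integral>x. (\<integral>t. ?f x t \<partial>lborel) \<partial>rho0 M) = (\<integral>t. (\<integral>x. ?f x t \<partial>rho0 M) \<partial>lborel)"
    using P.Fubini_integral[OF int] by simp
  also have "\<dots> = (LINT t:{0..T}|lborel. (LINT x:M|rho0 M. h (t, x)))"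
    unfolding set_lebesgue_integral_def
  proof (intro Bochner_Integration.integral_cong refl)
    fix t show "(\<integral>x. ?f x t \<partial>rho0 M) = indicator {0..T} t *\<^sub>R (\<integral>x. indicator M x *\<^sub>R h (t, x) \<partial>rho0 M)"
      by (cases "t \<in> {0..T}") simp_all
  qed
  finally show "(LINT x:M|rho0 M. (LINT t:{0..T}|lborel. h (t, x))) = (LINT t:{0..T}|lborel. (LINT x:M|rho0 M. h (t, x)))"
    using fst by simp
qed

lemma C01_continuous_on:
  assumes "f \<in> C01 T M"
  shows "continuous_on ({0..T} \<times> M) f"
  using assms by (auto simp: C01_def intro: lipschitz_on_continuous_on)

lemma pi_x_eval_measurable:
  fixes M :: "'a::euclidean_space set"
  assumes t: "t \<in> {0..T}"
  shows "(\<lambda>z. pi_x xbar (z t)) \<in> measurable (path_borel T M) borel"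
proof -
  have "(pi_x xbar) \<in> measurable (borel :: 'a cone measure) borel"
  proof (rule measurable_piecewise_restrict[where C="{{apex}, - {apex}}"])
    fix X assume "X \<in> {{apex}, - {apex :: 'a cone}}"
    moreover have "continuous_on {apex} (pi_x xbar)" by simp
    moreover have "continuous_on (- {apex}) (pi_x xbar)"
      by (intro continuous_at_imp_continuous_on ballI isCont_pi_x) auto
    ultimately show "pi_x xbar \<in> borel_measurable (restrict_space borel X)"
      by (auto intro: borel_measurable_continuous_on_restrict)
  qed auto
  moreover have "(\<lambda>z. z t) \<in> measurable (path_borel T M) borel"
    using eval_measurable_path_borel[OF t, of M] measurable_restrict_space2_iff by blast
  ultimately show ?thesis by (rule measurable_compose[rotated])
qed

lemma pi_r_eval_measurable:
  fixes M :: "'a::euclidean_space set"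
  assumes t: "t \<in> {0..T}"
  shows "(\<lambda>z. pi_r (z t)) \<in> borel_measurable (path_borel T M)"
proof -
  have "continuous_on ({0..T} \<times> cone_over M) (\<lambda>p. pi_r (snd p))" by (intro continuous_intros)
  from eval_compose_measurable[OF this t] show ?thesis by simp
qed

lemma lipschitz_density_integral:
  fixes M :: "'a::euclidean_space set"
  assumes \<nu>: "\<nu> \<in> path_prob T M" and \<rho>: "lipschitz_density T M xbar \<nu> \<rho>" and t: "t \<in> {0..T}"
    and M: "compact M" "xbar \<in> M" and b: "continuous_on M b"
  shows "(\<integral>z. b (pi_x xbar (z t)) * (pi_r (z t))\<^sup>2 \<partial>\<nu>) = (LINT x:M|rho0 M. b x * \<rho> (t, x))"
    and "(\<integral>\<^sup>+z. ennreal ((pi_r (z t))\<^sup>2) \<partial>\<nu>) = (\<integral>\<^sup>+x. ennreal (\<rho> (t, x)) \<partial>rho0 M)"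
proof -
  have Mb: "M \<in> sets borel" using M(1) by (simp add: compact_imp_closed)
  have h2: "h2 xbar t \<nu> = density (rho0 M) (\<lambda>x. ennreal (\<rho> (t, x)))" and pos: "\<And>p. 0 \<le> \<rho> p" and C: "\<rho> \<in> C01 T M"
    using \<rho> t by (auto simp: lipschitz_density_def)
  have xm[measurable]: "(\<lambda>z. pi_x xbar (z t)) \<in> measurable \<nu> borel"
    using pi_x_eval_measurable[OF t] by (simp add: path_prob_measurable_cong[OF \<nu>])
  have rm[measurable]: "(\<lambda>z. pi_r (z t)) \<in> borel_measurable \<nu>"
    using pi_r_eval_measurable[OF t] by (simp add: path_prob_measurable_cong[OF \<nu>])
  have \<rho>m[measurable]: "(\<lambda>x. \<rho> (t, x)) \<in> borel_measurable borel"
  proof -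
    have "continuous_on M (\<lambda>x. \<rho> (t, x))"
      by (rule continuous_on_compose2[OF C01_continuous_on[OF C]]) (use t in \<open>auto intro!: continuous_intros\<close>)
    then have "(\<lambda>x. indicator M x *\<^sub>R \<rho> (t, x)) \<in> borel_measurable borel"
      using Mb by (intro borel_measurable_continuous_on_indicator)
    also have "(\<lambda>x. indicator M x *\<^sub>R \<rho> (t, x)) = (\<lambda>x. \<rho> (t, x))"
      using C by (auto simp: C01_def indicator_def fun_eq_iff)
    finally show ?thesis .
  qed
  \<comment> \<open>\<open>h2\<close> is a measure on the whole space, so \<open>b\<close> is
    extended by 0 to a Borel function. This changes nothing along paths, since their base points
    stay in \<open>M\<close>.\<close>
  define c where "c x = indicator M x *\<^sub>R b x" for x
  have cm[measurable]: "c \<in> borel_measurable borel"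
    unfolding c_def[abs_def] using Mb b by (intro borel_measurable_continuous_on_indicator)
  have "(\<integral>x. c x \<partial>h2 xbar t \<nu>) = (\<integral>z. c (pi_x xbar (z t)) \<partial>density \<nu> (\<lambda>z. ennreal ((pi_r (z t))\<^sup>2)))"
    unfolding h2_def by (intro integral_distr) auto
  also have "\<dots> = (\<integral>z. (pi_r (z t))\<^sup>2 *\<^sub>R c (pi_x xbar (z t)) \<partial>\<nu>)" by (intro integral_density) auto
  also have "\<dots> = (\<integral>z. b (pi_x xbar (z t)) * (pi_r (z t))\<^sup>2 \<partial>\<nu>)"
  proof (intro Bochner_Integration.integral_cong refl)
    fix z assume "z \<in> space \<nu>"
    then have "z t \<in> cone_over M" using t by (intro Omega_D(3)) (auto simp: path_prob_space[OF \<nu>])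
    then show "(pi_r (z t))\<^sup>2 *\<^sub>R c (pi_x xbar (z t)) = b (pi_x xbar (z t)) * (pi_r (z t))\<^sup>2"
      using pi_x_in_cone_over[OF _ M(2)] by (simp add: c_def)
  qed
  finally have 1: "(\<integral>x. c x \<partial>h2 xbar t \<nu>) = (\<integral>z. b (pi_x xbar (z t)) * (pi_r (z t))\<^sup>2 \<partial>\<nu>)" .
  have "(\<integral>x. c x \<partial>h2 xbar t \<nu>) = (\<integral>x. \<rho> (t, x) *\<^sub>R c x \<partial>rho0 M)"
    unfolding h2 using pos by (intro integral_density) auto
  also have "\<dots> = (LINT x:M|rho0 M. b x * \<rho> (t, x))"
    unfolding set_lebesgue_integral_def c_def by (intro Bochner_Integration.integral_cong refl) simp
  finally show "(\<integral>z. b (pi_x xbar (z t)) * (pi_r (z t))\<^sup>2 \<partial>\<nu>) = (LINT x:M|rho0 M. b x * \<rho> (t, x))" using 1 by simp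
  have "emeasure (h2 xbar t \<nu>) UNIV = (\<integral>\<^sup>+z. ennreal ((pi_r (z t))\<^sup>2) \<partial>\<nu>)"
    unfolding h2_def by (subst emeasure_distr) (auto simp: emeasure_density cong: nn_integral_cong_simp)
  moreover have "emeasure (h2 xbar t \<nu>) UNIV = (\<integral>\<^sup>+x. ennreal (\<rho> (t, x)) \<partial>rho0 M)"
    unfolding h2 by (subst emeasure_density) auto
  ultimately show "(\<integral>\<^sup>+z. ennreal ((pi_r (z t))\<^sup>2) \<partial>\<nu>) = (\<integral>\<^sup>+x. ennreal (\<rho> (t, x)) \<partial>rho0 M)" by simp
qed

lemma continuous_on_compact_bounded:
  fixes f :: "'b::metric_space \<Rightarrow> real"
  assumes "continuous_on K f" "compact K"
  obtains B where "0 \<le> B" "\<And>p. p \<in> K \<Longrightarrow> \<bar>f p\<bar> \<le> B"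
proof -
  have "bounded (f ` K)" using assms by (intro compact_imp_bounded compact_continuous_image)
  then obtain B where "\<And>p. p \<in> K \<Longrightarrow> \<bar>f p\<bar> \<le> B" by (auto simp: bounded_iff)
  then show ?thesis using that[of "max B 0"] by (simp add: max.coboundedI1)
qed

text \<open>Integrates the identity at single times. The total mass of \<open>h2\<close> is bounded
  uniformly in time because \<rho> is, which justifies exchanging the integrals.\<close>

lemma lipschitz_density_imp_weak_density:
  fixes M :: "'a::euclidean_space set"
  assumes \<nu>: "\<nu> \<in> path_prob T M" and \<rho>: "lipschitz_density T M xbar \<nu> \<rho>"
    and M: "compact M" "xbar \<in> M" "prob_space (rho0 M)"
  shows "weak_density T M xbar \<nu> \<rho>"
  unfolding weak_density_def
proof (intro allI impI)
  fix f :: "real \<times> 'a \<Rightarrow> real" assume f: "continuous_on ({0..T} \<times> M) f"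
  interpret R: prob_space "rho0 M" by (rule M(3))
  have C: "\<rho> \<in> C01 T M" and pos: "\<And>p. 0 \<le> \<rho> p" using \<rho> by (auto simp: lipschitz_density_def)
  note \<rho>c = C01_continuous_on[OF C]
  have cpt: "compact ({0..T} \<times> M)" using M(1) by (intro compact_Times) auto
  obtain B where B: "0 \<le> B" "\<And>p. p \<in> {0..T} \<times> M \<Longrightarrow> \<bar>f p\<bar> \<le> B"
    using continuous_on_compact_bounded[OF f cpt] by blast
  obtain K where K: "0 \<le> K" "\<And>p. p \<in> {0..T} \<times> M \<Longrightarrow> \<bar>\<rho> p\<bar> \<le> K"
    using continuous_on_compact_bounded[OF \<rho>c cpt] by blast
  have K': "\<rho> p \<le> K" for p
  proof (cases "p \<in> {0..T} \<times> M")
    case False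
    then have "\<rho> p = 0" using C unfolding C01_def by blast
    then show ?thesis using K(1) by simp
  qed (use K(2)[of p] in auto)
  let ?\<phi> = "\<lambda>p. f (fst p, pi_x xbar (snd p)) * (pi_r (snd p))\<^sup>2"
  have \<phi>: "continuous_on ({0..T} \<times> cone_over M) ?\<phi>" by (rule continuous_on_cone_square[OF f B(2) M(2)])
  have bd: "(\<integral>\<^sup>+z. ennreal \<bar>?\<phi> (t, z t)\<bar> \<partial>\<nu>) \<le> ennreal (B * K)" if t: "t \<in> {0..T}" for t
  proof -
    have rm: "(\<lambda>z. pi_r (z t)) \<in> borel_measurable \<nu>"
      using pi_r_eval_measurable[OF t] by (simp add: path_prob_measurable_cong[OF \<nu>])
    have "(\<integral>\<^sup>+z. ennreal \<bar>?\<phi> (t, z t)\<bar> \<partial>\<nu>) \<le> (\<integral>\<^sup>+z. ennreal B * ennreal ((pi_r (z t))\<^sup>2) \<partial>\<nu>)"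
    proof (rule nn_integral_mono)
      fix z assume "z \<in> space \<nu>"
      then have "z t \<in> cone_over M" using t by (intro Omega_D(3)) (auto simp: path_prob_space[OF \<nu>])
      then have "\<bar>f (t, pi_x xbar (z t))\<bar> \<le> B" using t pi_x_in_cone_over[OF _ M(2)] by (intro B) auto
      then show "ennreal \<bar>?\<phi> (t, z t)\<bar> \<le> ennreal B * ennreal ((pi_r (z t))\<^sup>2)"
        using B(1) by (auto simp: abs_mult ennreal_mult[symmetric] intro!: ennreal_leI mult_right_mono)
    qed
    also have "\<dots> = ennreal B * (\<integral>\<^sup>+x. ennreal (\<rho> (t, x)) \<partial>rho0 M)"
      using rm lipschitz_density_integral(2)[OF \<nu> \<rho> t M(1,2) continuous_on_const]
      by (subst nn_integral_cmult) auto
    also have "\<dots> \<le> ennreal B * (\<integral>\<^sup>+x. ennreal K \<partial>rho0 M)"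
      using K' by (intro mult_left_mono nn_integral_mono) (auto intro: ennreal_leI)
    also have "\<dots> = ennreal (B * K)" using B K by (simp add: R.emeasure_space_1 ennreal_mult)
    finally show ?thesis .
  qed
  have "has_bochner_integral \<nu> (\<lambda>z. LINT t:{0..T}|lborel. ?\<phi> (t, z t)) (LINT t:{0..T}|lborel. (\<integral>z. ?\<phi> (t, z t) \<partial>\<nu>))"
    by (rule eval_fubini[OF \<nu> \<phi> bd])
  also have "(LINT t:{0..T}|lborel. (\<integral>z. ?\<phi> (t, z t) \<partial>\<nu>)) = (LINT t:{0..T}|lborel. (LINT x:M|rho0 M. f (t, x) * \<rho> (t, x)))"
  proof (rule set_lebesgue_integral_cong)
    show "\<forall>t. t \<in> {0..T} \<longrightarrow> (\<integral>z. ?\<phi> (t, z t) \<partial>\<nu>) = (LINT x:M|rho0 M. f (t, x) * \<rho> (t, x))"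
    proof (intro allI impI)
      fix t assume t: "t \<in> {0..T}"
      have "continuous_on M (\<lambda>x. f (t, x))"
        by (rule continuous_on_compose2[OF f]) (use t in \<open>auto intro!: continuous_intros\<close>)
      from lipschitz_density_integral(1)[OF \<nu> \<rho> t M(1,2) this]
      show "(\<integral>z. ?\<phi> (t, z t) \<partial>\<nu>) = (LINT x:M|rho0 M. f (t, x) * \<rho> (t, x))" by simp
    qed
  qed simp
  also have "\<dots> = (LINT x:M|rho0 M. (LINT t:{0..T}|lborel. f (t, x) * \<rho> (t, x)))"
    using double_integral(3)[of T M "\<lambda>p. f p * \<rho> p"] f \<rho>c M by (simp add: continuous_intros)
  finally show "has_bochner_integral \<nu> (\<lambda>z. LINT t:{0..T}|lborel. f (t, pi_x xbar (z t)) * (pi_r (z t))\<^sup>2)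
      (LINT x:M|rho0 M. (LINT t:{0..T}|lborel. f (t, x) * \<rho> (t, x)))" by simp
qed

section \<open>Marginals at single times\<close>

lemma cone_over_apex: "xbar \<in> M \<Longrightarrow> apex \<in> cone_over M"
  unfolding cone_over_def using cone_point_0[of xbar] by force

text \<open>\<open>b(x) r^2\<close> at one endpoint is 2-homogeneous, and the square of the radius
  makes it continuous at the apex, so it is an admissible test function. Hence plans with the same
  coupling have the same \<open>h2\<close> at the times 0 and \<open>T\<close>.\<close>

lemma coupling_constraint_endpoints:
  fixes M :: "'a::euclidean_space set"
  assumes c: "coupling_constraint T M \<gamma> \<nu>" and b: "continuous_on M b" and M: "compact M" "xbar \<in> M"
  shows "has_bochner_integral \<nu> (\<lambda>z. b (pi_x xbar (z 0)) * (pi_r (z 0))\<^sup>2)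
      (LINT p|\<gamma>. b (pi_x xbar (fst p)) * (pi_r (fst p))\<^sup>2)"
    and "has_bochner_integral \<nu> (\<lambda>z. b (pi_x xbar (z T)) * (pi_r (z T))\<^sup>2)
      (LINT p|\<gamma>. b (pi_x xbar (snd p)) * (pi_r (snd p))\<^sup>2)"
proof -
  obtain B where B: "\<And>x. x \<in> M \<Longrightarrow> \<bar>b x\<bar> \<le> B" using continuous_on_compact_bounded[OF b M(1)] by blast
  have "continuous_on (cone_over M \<times> M) (\<lambda>p. b (snd p))"
    by (rule continuous_on_compose2[OF b]) (auto intro!: continuous_intros)
  from continuous_on_cone_square[OF this _ M(2), of B] B
  have c2: "continuous_on (cone_over M \<times> cone_over M) (\<lambda>p. b (pi_x xbar (snd p)) * (pi_r (snd p))\<^sup>2)" by auto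
  have c1: "continuous_on (cone_over M \<times> cone_over M) (\<lambda>p. b (pi_x xbar (fst p)) * (pi_r (fst p))\<^sup>2)"
  proof -
    have "continuous_on (cone_over M \<times> cone_over M) (\<lambda>p. (snd p, fst p))" by (intro continuous_intros)
    moreover have "(\<lambda>p. (snd p, fst p)) ` (cone_over M \<times> cone_over M) \<subseteq> cone_over M \<times> cone_over M" by auto
    ultimately show ?thesis using continuous_on_compose2[OF c2] by fastforce
  qed
  have h: "b (pi_x xbar (cone_point x (l * r))) * (pi_r (cone_point x (l * r)))\<^sup>2
      = l\<^sup>2 * (b (pi_x xbar (cone_point x r)) * (pi_r (cone_point x r))\<^sup>2)" if "0 \<le> r" "0 < l" for x r l
    using that by (cases "r = 0") (simp_all add: cone_point_0 pi_r_cone_point pi_x_cone_point power_mult_distrib)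
  show "has_bochner_integral \<nu> (\<lambda>z. b (pi_x xbar (z 0)) * (pi_r (z 0))\<^sup>2)
      (LINT p|\<gamma>. b (pi_x xbar (fst p)) * (pi_r (fst p))\<^sup>2)"
    using c[unfolded coupling_constraint_def, rule_format, OF conjI, OF c1] h by (simp add: homogeneous2_def)
  show "has_bochner_integral \<nu> (\<lambda>z. b (pi_x xbar (z T)) * (pi_r (z T))\<^sup>2)
      (LINT p|\<gamma>. b (pi_x xbar (snd p)) * (pi_r (snd p))\<^sup>2)"
    using c[unfolded coupling_constraint_def, rule_format, OF conjI, OF c2] h by (simp add: homogeneous2_def)
qed

text \<open>The majorant is the squared supremum distance to the constant path at the apex. As a
  distance function it is measurable although the supremum runs over uncountably many times; its
  integral is bounded by the action and the second moment of the initial radius.\<close>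

lemma sup_pi_r_sq_integrable:
  fixes M :: "'a::euclidean_space set"
  assumes \<mu>: "\<mu> \<in> path_prob T M" and T: "0 < T" and M: "bounded M" "xbar \<in> M"
    and A: "action T xbar \<mu> < \<infinity>" and r0: "integrable \<mu> (\<lambda>z. (pi_r (z 0))\<^sup>2)"
  obtains W where "integrable \<mu> W" "\<And>z t. z \<in> space \<mu> \<Longrightarrow> t \<in> {0..T} \<Longrightarrow> (pi_r (z t))\<^sup>2 \<le> W z"
proof -
  let ?m = "path_metric T M"
  define a where "a = restrict (\<lambda>_::real. apex :: 'a cone) {0..T}"
  have "continuous_on {0..T} a" by (rule continuous_on_eq[OF continuous_on_const]) (simp add: a_def)
  then have a: "a \<in> Omega T M" unfolding Omega_eq using cone_over_apex[OF M(2)] by (auto simp: a_def)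
  have at: "a t = apex" if "t \<in> {0..T}" for t using that by (simp add: a_def)
  have Wm: "(\<lambda>z. mdist ?m z a) \<in> borel_measurable \<mu>"
    unfolding path_prob_measurable_cong[OF \<mu>]
  proof (rule Lipschitz_measurable_path_borel[where B=1])
    fix z w assume zw: "z \<in> Omega T M" "w \<in> Omega T M"
    show "dist (mdist ?m z a) (mdist ?m w a) \<le> 1 * mdist ?m z w"
      using mdist_triangle[OF zw a] mdist_triangle[OF zw(2,1) a] mdist_commute[of ?m z w]
      by (auto simp: dist_real_def abs_le_iff)
  qed
  have le: "pi_r (z t) \<le> mdist ?m z a" if "z \<in> Omega T M" "t \<in> {0..T}" for z t
    using dist_eval_le_path_mdist[OF that(1) a that(2)] at[OF that(2)] by simp
  have pt: "ennreal ((mdist ?m z a)\<^sup>2) \<le> ennreal (2 * T) * path_action T xbar z + ennreal (2 * (pi_r (z 0))\<^sup>2)"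
    if z: "z \<in> Omega T M" for z
  proof (cases "path_action T xbar z")
    case (real p)
    define K where "K = 2 * (pi_r (z 0))\<^sup>2 + 2 * T * p"
    have K: "0 \<le> K" using real(1) T by (simp add: K_def)
    have "mdist ?m z a \<le> sqrt K"
    proof (rule path_mdist_le)
      fix t assume t: "t \<in> {0..T}"
      have "ennreal ((pi_r (z t))\<^sup>2) \<le> ennreal K"
        using path_action_pi_r_bound[OF Omega_D(1,2)[OF z] M t] real T
        by (simp add: K_def ennreal_plus ennreal_mult)
      then have "(pi_r (z t))\<^sup>2 \<le> K" using K by (simp add: ennreal_le_iff)
      then show "dist (z t) (a t) \<le> sqrt K" using at[OF t] by (simp add: real_le_rsqrt)
    qed (use K in simp)
    then have "(mdist ?m z a)\<^sup>2 \<le> K" using K by (metis mdist_nonneg power_mono real_sqrt_pow2)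
    then have "ennreal ((mdist ?m z a)\<^sup>2) \<le> ennreal K" by (rule ennreal_leI)
    also have "\<dots> = ennreal (2 * T) * path_action T xbar z + ennreal (2 * (pi_r (z 0))\<^sup>2)"
      using real T by (simp add: K_def ennreal_plus ennreal_mult add.commute)
    finally show ?thesis .
  next
    case top
    then show ?thesis using T by (simp add: ennreal_mult_top)
  qed
  have "(\<integral>\<^sup>+z. ennreal ((mdist ?m z a)\<^sup>2) \<partial>\<mu>)
      \<le> ennreal (2 * T) * (\<integral>\<^sup>+z. path_action T xbar z \<partial>\<mu>) + (\<integral>\<^sup>+z. ennreal (2 * (pi_r (z 0))\<^sup>2) \<partial>\<mu>)"
  proof (rule nn_integral_le_cmult_add)
    show "AE z in \<mu>. ennreal ((mdist ?m z a)\<^sup>2) \<le> ennreal (2 * T) * path_action T xbar z + ennreal (2 * (pi_r (z 0))\<^sup>2)"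
      using pt by (intro AE_I2) (simp add: path_prob_space[OF \<mu>])
  qed (use r0 T in auto)
  also have "\<dots> < \<infinity>"
  proof -
    have "(\<integral>\<^sup>+z. ennreal (2 * (pi_r (z 0))\<^sup>2) \<partial>\<mu>) < \<infinity>"
      using r0 by (subst nn_integral_eq_integral) auto
    then show ?thesis using A by (simp add: action_def ennreal_mult_less_top)
  qed
  finally have "integrable \<mu> (\<lambda>z. (mdist ?m z a)\<^sup>2)"
    using Wm by (intro integrableI_nonneg) auto
  then show thesis
  proof (rule that)
    show "(pi_r (z t))\<^sup>2 \<le> (mdist ?m z a)\<^sup>2" if "z \<in> space \<mu>" "t \<in> {0..T}" for z t
      using le[of z t] that by (intro power_mono) (auto simp: path_prob_space[OF \<mu>])
  qed
qed

text \<open>Upgrades the averaged constraint to every single time. By dominated convergence the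
  tested marginal \<open>g\<close> is continuous in time. With \<beta> the expected value, the test
  function (g(t) - \<beta>) b(x) is then admissible and makes the integral of (g - \<beta>)^2
  vanish.\<close>

lemma weak_density_pointwise:
  fixes M :: "'a::euclidean_space set"
  assumes \<mu>: "\<mu> \<in> path_prob T M" and T: "0 < T" and M: "compact M" "xbar \<in> M" "prob_space (rho0 M)"
    and wd: "weak_density T M xbar \<mu> (\<lambda>_. 1)"
    and W: "integrable \<mu> W" "\<And>z t. z \<in> space \<mu> \<Longrightarrow> t \<in> {0..T} \<Longrightarrow> (pi_r (z t))\<^sup>2 \<le> W z"
    and b: "continuous_on M b" and t: "t \<in> {0..T}"
  shows "(\<integral>z. b (pi_x xbar (z t)) * (pi_r (z t))\<^sup>2 \<partial>\<mu>) = (LINT x:M|rho0 M. b x)"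
proof -
  define \<beta> where "\<beta> = (LINT x:M|rho0 M. b x)"
  define g where "g t = (\<integral>z. b (pi_x xbar (z t)) * (pi_r (z t))\<^sup>2 \<partial>\<mu>)" for t
  have zM: "z t \<in> cone_over M" "pi_x xbar (z t) \<in> M" if "z \<in> space \<mu>" "t \<in> {0..T}" for z t
    using Omega_D(3)[of z T M t] that pi_x_in_cone_over[OF _ M(2)] by (auto simp: path_prob_space[OF \<mu>])
  have cpt: "compact ({0..T} \<times> M)" using M(1) by (intro compact_Times) auto
  have fub: "(LINT t:{0..T}|lborel. (\<integral>z. f (t, pi_x xbar (z t)) * (pi_r (z t))\<^sup>2 \<partial>\<mu>))
      = (LINT t:{0..T}|lborel. (LINT x:M|rho0 M. f (t, x)))" if f: "continuous_on ({0..T} \<times> M) f" for f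
  proof -
    obtain B where B: "0 \<le> B" "\<And>p. p \<in> {0..T} \<times> M \<Longrightarrow> \<bar>f p\<bar> \<le> B"
      using continuous_on_compact_bounded[OF f cpt] by blast
    let ?\<phi> = "\<lambda>p. f (fst p, pi_x xbar (snd p)) * (pi_r (snd p))\<^sup>2"
    have \<phi>: "continuous_on ({0..T} \<times> cone_over M) ?\<phi>" by (rule continuous_on_cone_square[OF f B(2) M(2)])
    have bd: "(\<integral>\<^sup>+z. ennreal \<bar>?\<phi> (t, z t)\<bar> \<partial>\<mu>) \<le> ennreal (\<integral>z. B * \<bar>W z\<bar> \<partial>\<mu>)" if t: "t \<in> {0..T}" for t
    proof -
      have "(\<integral>\<^sup>+z. ennreal \<bar>?\<phi> (t, z t)\<bar> \<partial>\<mu>) \<le> (\<integral>\<^sup>+z. ennreal (B * \<bar>W z\<bar>) \<partial>\<mu>)"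
      proof (intro nn_integral_mono ennreal_leI)
        fix z assume z: "z \<in> space \<mu>"
        have "(pi_r (z t))\<^sup>2 \<le> \<bar>W z\<bar>" using W(2)[OF z t] by linarith
        then show "\<bar>?\<phi> (t, z t)\<bar> \<le> B * \<bar>W z\<bar>" using B zM[OF z t] t by (auto simp: abs_mult intro!: mult_mono)
      qed
      also have "\<dots> = ennreal (\<integral>z. B * \<bar>W z\<bar> \<partial>\<mu>)" using W(1) B(1) by (intro nn_integral_eq_integral) auto
      finally show ?thesis .
    qed
    have "has_bochner_integral \<mu> (\<lambda>z. LINT t:{0..T}|lborel. ?\<phi> (t, z t)) (LINT t:{0..T}|lborel. (\<integral>z. ?\<phi> (t, z t) \<partial>\<mu>))"
      by (rule eval_fubini[OF \<mu> \<phi> bd])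
    moreover have "has_bochner_integral \<mu> (\<lambda>z. LINT t:{0..T}|lborel. ?\<phi> (t, z t)) (LINT x:M|rho0 M. (LINT t:{0..T}|lborel. f (t, x)))"
      using wd[unfolded weak_density_def, rule_format, OF f] by simp
    ultimately have "(LINT t:{0..T}|lborel. (\<integral>z. ?\<phi> (t, z t) \<partial>\<mu>)) = (LINT x:M|rho0 M. (LINT t:{0..T}|lborel. f (t, x)))"
      by (rule has_bochner_integral_eq)
    then show ?thesis using double_integral(3)[OF f M(1,3)] by simp
  qed
  have gc: "continuous_on {0..T} g"
  proof (rule continuous_on_sequentiallyI)
    fix u :: "nat \<Rightarrow> real" and s assume u: "\<forall>n. u n \<in> {0..T}" "s \<in> {0..T}" "u \<longlonglongrightarrow> s"
    obtain B where B: "0 \<le> B" "\<And>x. x \<in> M \<Longrightarrow> \<bar>b x\<bar> \<le> B" using continuous_on_compact_bounded[OF b M(1)] by blast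
    have "continuous_on ({0..T} \<times> M) (\<lambda>p. b (snd p))"
      by (rule continuous_on_compose2[OF b]) (auto intro!: continuous_intros)
    from continuous_on_cone_square[OF this _ M(2), of B] B(2)
    have \<phi>: "continuous_on ({0..T} \<times> cone_over M) (\<lambda>p. b (pi_x xbar (snd p)) * (pi_r (snd p))\<^sup>2)" by auto
    have m: "(\<lambda>z. b (pi_x xbar (z t)) * (pi_r (z t))\<^sup>2) \<in> borel_measurable \<mu>" if "t \<in> {0..T}" for t
      using eval_compose_measurable[OF \<phi> that] by (simp add: path_prob_measurable_cong[OF \<mu>])
    show "(\<lambda>n. g (u n)) \<longlonglongrightarrow> g s"
      unfolding g_def
    proof (rule integral_dominated_convergence[where w="\<lambda>z. B * \<bar>W z\<bar>"])
      show "integrable \<mu> (\<lambda>z. B * \<bar>W z\<bar>)" using W(1) by auto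
      show "AE z in \<mu>. (\<lambda>n. b (pi_x xbar (z (u n))) * (pi_r (z (u n)))\<^sup>2) \<longlonglongrightarrow> b (pi_x xbar (z s)) * (pi_r (z s))\<^sup>2"
      proof (rule AE_I2)
        fix z assume "z \<in> space \<mu>"
        then have z: "z \<in> Omega T M" by (simp add: path_prob_space[OF \<mu>])
        have "continuous_on {0..T} (\<lambda>t. b (pi_x xbar (z t)) * (pi_r (z t))\<^sup>2)"
        proof -
          have "continuous_on {0..T} (\<lambda>t. (t, z t))" using Omega_D(1)[OF z] by (intro continuous_intros)
          moreover have "(\<lambda>t. (t, z t)) ` {0..T} \<subseteq> {0..T} \<times> cone_over M" using Omega_D(2)[OF z] by auto
          ultimately show ?thesis using continuous_on_compose2[OF \<phi>] by fastforce
        qed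
        then show "(\<lambda>n. b (pi_x xbar (z (u n))) * (pi_r (z (u n)))\<^sup>2) \<longlonglongrightarrow> b (pi_x xbar (z s)) * (pi_r (z s))\<^sup>2"
          using u by (intro continuous_on_tendsto_compose[of "{0..T}" "\<lambda>t. b (pi_x xbar (z t)) * (pi_r (z t))\<^sup>2"]) auto
      qed
      show "AE z in \<mu>. norm (b (pi_x xbar (z (u n))) * (pi_r (z (u n)))\<^sup>2) \<le> B * \<bar>W z\<bar>" for n
      proof (rule AE_I2)
        fix z assume z: "z \<in> space \<mu>"
        have "(pi_r (z (u n)))\<^sup>2 \<le> \<bar>W z\<bar>" using W(2)[OF z, of "u n"] u(1) by (meson abs_ge_self order.trans)
        then show "norm (b (pi_x xbar (z (u n))) * (pi_r (z (u n)))\<^sup>2) \<le> B * \<bar>W z\<bar>"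
          using B zM(2)[OF z, of "u n"] u(1) by (simp only: real_norm_def abs_mult) (intro mult_mono, auto)
      qed
    qed (use m u in auto)
  qed
  define a where "a t = g t - \<beta>" for t
  have ac: "continuous_on {0..T} a" unfolding a_def using gc by (intro continuous_intros)
  have "continuous_on ({0..T} \<times> M) (\<lambda>p. a (fst p) * b (snd p))"
    by (intro continuous_intros continuous_on_compose2[OF ac] continuous_on_compose2[OF b]) auto
  from fub[OF this] have eq: "(LINT t:{0..T}|lborel. a t * g t) = (LINT t:{0..T}|lborel. a t * \<beta>)"
    by (simp add: g_def \<beta>_def mult.assoc)
  have int: "set_integrable lborel {0..T} (\<lambda>t. a t * g t)" "set_integrable lborel {0..T} (\<lambda>t. a t * \<beta>)"
    "set_integrable lborel {0..T} (\<lambda>t. (a t)\<^sup>2)"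
    using ac gc by (auto intro!: borel_integrable_atLeastAtMost' continuous_intros)
  have "(LINT t:{0..T}|lborel. (a t)\<^sup>2) = (LINT t:{0..T}|lborel. a t * g t - a t * \<beta>)"
    by (simp add: a_def power2_eq_square algebra_simps)
  also have "\<dots> = 0" using eq set_integral_diff(2)[OF int(1,2)] by simp
  finally have "((\<lambda>t. (a t)\<^sup>2) has_integral 0) {0..T}"
    using set_borel_integral_eq_integral[OF int(3)] by (metis integrable_integral)
  then have "(a t)\<^sup>2 = 0"
    using has_integral_0_cbox_imp_0[of 0 T "\<lambda>t. (a t)\<^sup>2" t] ac T t by (auto intro!: continuous_intros)
  then show ?thesis by (simp add: a_def g_def \<beta>_def)
qed

section \<open>The space \<open>B0\<close>, and convexity of the constraints\<close>

lemma C01_norm_bounds: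
  assumes f: "f \<in> C01 T M" and M: "compact M" "M \<noteq> {}" and T: "0 \<le> T"
  shows "p \<in> {0..T} \<times> M \<Longrightarrow> \<bar>f p\<bar> \<le> C01_norm T M f"
    and "p \<in> {0..T} \<times> M \<Longrightarrow> q \<in> {0..T} \<times> M \<Longrightarrow> \<bar>f p - f q\<bar> \<le> C01_norm T M f * dist p q"
    and "0 \<le> C01_norm T M f"
proof -
  define L where "L = Inf {L. L-lipschitz_on ({0..T} \<times> M) f}"
  define s where "s = (SUP p\<in>{0..T} \<times> M. \<bar>f p\<bar>)"
  have n: "C01_norm T M f = s + L" by (simp add: C01_norm_def L_def s_def)
  have ne: "{L. L-lipschitz_on ({0..T} \<times> M) f} \<noteq> {}" using f by (auto simp: C01_def)
  have L0: "0 \<le> L" unfolding L_def using ne by (rule cInf_greatest) (auto dest: lipschitz_on_nonneg)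
  obtain B where B: "\<And>p. p \<in> {0..T} \<times> M \<Longrightarrow> \<bar>f p\<bar> \<le> B"
    using continuous_on_compact_bounded[OF C01_continuous_on[OF f]] M(1) by (metis compact_Icc compact_Times)
  have s: "\<bar>f p\<bar> \<le> s" if "p \<in> {0..T} \<times> M" for p
    unfolding s_def using that B by (intro cSUP_upper bdd_aboveI2[where M=B]) auto
  obtain x where "x \<in> M" using M(2) by auto
  then have s0: "0 \<le> s" using s[of "(0, x)"] T by (auto intro: order.trans[OF abs_ge_zero])
  show "\<bar>f p\<bar> \<le> C01_norm T M f" if "p \<in> {0..T} \<times> M" using s[OF that] L0 by (simp add: n)
  show "0 \<le> C01_norm T M f" using s0 L0 by (simp add: n)
  show "\<bar>f p - f q\<bar> \<le> C01_norm T M f * dist p q" if pq: "p \<in> {0..T} \<times> M" "q \<in> {0..T} \<times> M"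
  proof (cases "p = q")
    case False
    then have d: "0 < dist p q" by simp
    have "\<bar>f p - f q\<bar> / dist p q \<le> L" unfolding L_def
    proof (rule cInf_greatest[OF ne])
      fix K assume "K \<in> {L. L-lipschitz_on ({0..T} \<times> M) f}"
      then have "dist (f p) (f q) \<le> K * dist p q" using pq by (auto intro: lipschitz_onD)
      then show "\<bar>f p - f q\<bar> / dist p q \<le> K" using d by (simp add: dist_real_def divide_le_eq)
    qed
    then have "\<bar>f p - f q\<bar> \<le> L * dist p q" using d by (simp add: divide_le_eq)
    also have "\<dots> \<le> C01_norm T M f * dist p q" using s0 d by (simp add: n mult_right_mono)
    finally show ?thesis .
  qed simp
qed

text \<open>Pointwise operations make \<open>B0\<close> a subspace of a real vector space, the
  setting of the subgradient argument.\<close>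

instantiation "fun" :: (type, real_vector) real_vector
begin

definition scaleR_fun :: "real \<Rightarrow> ('a \<Rightarrow> 'b) \<Rightarrow> 'a \<Rightarrow> 'b" where
  "scaleR_fun c f = (\<lambda>x. c *\<^sub>R f x)"

instance
  by standard (simp_all add: scaleR_fun_def fun_eq_iff scaleR_add_right scaleR_add_left)

end

lemma subspace_B0: "subspace (B0 T M)"
  unfolding subspace_def
proof (intro conjI ballI allI)
  show "0 \<in> B0 T M"
    by (auto simp: B0_def C01_def zero_fun_def intro!: exI[of _ 0] lipschitz_onI)
next
  fix f g assume fg: "f \<in> B0 T M" "g \<in> B0 T M"
  then obtain K L where "K-lipschitz_on ({0..T} \<times> M) f" "L-lipschitz_on ({0..T} \<times> M) g"
    by (auto simp: B0_def C01_def)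
  then have "(K + L)-lipschitz_on ({0..T} \<times> M) (\<lambda>p. f p + g p)" by (rule lipschitz_on_add)
  with fg show "f + g \<in> B0 T M" by (auto simp: B0_def C01_def plus_fun_def)
next
  fix c :: real and f assume f: "f \<in> B0 T M"
  then obtain L where "L-lipschitz_on ({0..T} \<times> M) f" by (auto simp: B0_def C01_def)
  then have "(\<bar>c\<bar> * L)-lipschitz_on ({0..T} \<times> M) (\<lambda>p. c *\<^sub>R f p)" by (rule lipschitz_on_cmult)
  with f show "c *\<^sub>R f \<in> B0 T M" by (auto simp: B0_def C01_def scaleR_fun_def)
qed

text \<open>A difference of roots is the difference of the radicands divided by the sum of the
  roots. Each root is at least 1/2, so this sum is at least 1 and the Lipschitz constant does not
  grow.\<close>

lemma sqrt_density_scaling: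
  fixes \<sigma> :: "real \<times> 'a::euclidean_space \<Rightarrow> real"
  assumes T: "0 < T" and M: "bounded M" "xbar \<in> M"
    and b: "\<And>p. p \<in> {0..T} \<times> M \<Longrightarrow> \<bar>\<sigma> p\<bar> \<le> 1/2"
    and l: "\<And>p q. p \<in> {0..T} \<times> M \<Longrightarrow> q \<in> {0..T} \<times> M \<Longrightarrow> \<bar>\<sigma> p - \<sigma> q\<bar> \<le> dist p q / 2"
  shows "radial_scaling T M xbar (\<lambda>p. sqrt (1 + \<sigma> p))"
proof
  have bd: "1/2 \<le> sqrt (1 + \<sigma> p)" "sqrt (1 + \<sigma> p) \<le> 3/2" if "p \<in> {0..T} \<times> M" for p
  proof -
    have "- (1/2) \<le> \<sigma> p" "\<sigma> p \<le> 1/2" using b[OF that] by linarith+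
    then have sq: "(1/2)\<^sup>2 \<le> 1 + \<sigma> p" "1 + \<sigma> p \<le> (3/2)\<^sup>2" by (simp_all add: power2_eq_square)
    show "1/2 \<le> sqrt (1 + \<sigma> p)" using sq(1) by (rule real_le_rsqrt)
    have "sqrt (1 + \<sigma> p) \<le> sqrt ((3/2)\<^sup>2)" using sq(2) by (rule real_sqrt_le_mono)
    then show "sqrt (1 + \<sigma> p) \<le> 3/2" by simp
  qed
  show "1/2 \<le> sqrt (1 + \<sigma> p) \<and> sqrt (1 + \<sigma> p) \<le> 3/2" if "p \<in> {0..T} \<times> M" for p
    using bd[OF that] by simp
  show "\<bar>sqrt (1 + \<sigma> p) - sqrt (1 + \<sigma> q)\<bar> \<le> dist p q / 2" if pq: "p \<in> {0..T} \<times> M" "q \<in> {0..T} \<times> M" for p q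
  proof -
    define x y where "x = sqrt (1 + \<sigma> p)" and "y = sqrt (1 + \<sigma> q)"
    have xy: "1 \<le> x + y" using bd(1)[OF pq(1)] bd(1)[OF pq(2)] by (simp add: x_def y_def)
    have sq: "x\<^sup>2 = 1 + \<sigma> p" "y\<^sup>2 = 1 + \<sigma> q" using b[OF pq(1)] b[OF pq(2)] by (auto simp: x_def y_def abs_le_iff)
    have "\<bar>x - y\<bar> * 1 \<le> \<bar>x - y\<bar> * (x + y)" using xy by (intro mult_left_mono) auto
    also have "\<dots> = \<bar>(x - y) * (x + y)\<bar>" using xy by (simp add: abs_mult)
    also have "(x - y) * (x + y) = \<sigma> p - \<sigma> q" using sq by (simp add: power2_eq_square algebra_simps)
    finally show ?thesis using l[OF pq] by (simp add: x_def y_def)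
  qed
qed (use T M in auto)

lemma coupling_constraint_convex_mix:
  assumes uv: "0 < u" "0 < v" "u + v = 1" and s: "sets \<nu> = sets \<mu>"
    and "coupling_constraint T M \<gamma> \<mu>" "coupling_constraint T M \<gamma> \<nu>"
  shows "coupling_constraint T M \<gamma> (convex_mix u v \<mu> \<nu>)"
  unfolding coupling_constraint_def
proof (intro allI impI)
  fix f assume "continuous_on (cone_over M \<times> cone_over M) f \<and> homogeneous2 M f"
  then have "has_bochner_integral \<mu> (\<lambda>z. f (z 0, z T)) (LINT p|\<gamma>. f p)"
    "has_bochner_integral \<nu> (\<lambda>z. f (z 0, z T)) (LINT p|\<gamma>. f p)"
    using assms(5,6) by (auto simp: coupling_constraint_def)
  from has_bochner_integral_convex_mix[OF uv s this] uv(3)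
  show "has_bochner_integral (convex_mix u v \<mu> \<nu>) (\<lambda>z. f (z 0, z T)) (LINT p|\<gamma>. f p)"
    by (simp flip: distrib_right)
qed

lemma weak_density_convex_mix:
  fixes M :: "'a::euclidean_space set"
  assumes uv: "0 < u" "0 < v" "u + v = 1" and s: "sets \<nu> = sets \<mu>"
    and M: "compact M" "prob_space (rho0 M)"
    and \<rho>: "continuous_on ({0..T} \<times> M) \<rho>" "continuous_on ({0..T} \<times> M) \<rho>'"
    and wd: "weak_density T M xbar \<mu> \<rho>" "weak_density T M xbar \<nu> \<rho>'"
  shows "weak_density T M xbar (convex_mix u v \<mu> \<nu>) (\<lambda>p. u * \<rho> p + v * \<rho>' p)"
  unfolding weak_density_def
proof (intro allI impI)
  fix f :: "real \<times> 'a \<Rightarrow> real" assume f: "continuous_on ({0..T} \<times> M) f"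
  let ?I = "\<lambda>h. LINT x:M|rho0 M. (LINT t:{0..T}|lborel. h (t, x))"
  have c: "continuous_on ({0..T} \<times> M) (\<lambda>p. f p * \<rho> p)" "continuous_on ({0..T} \<times> M) (\<lambda>p. f p * \<rho>' p)"
    "continuous_on ({0..T} \<times> M) (\<lambda>p. f p * (u * \<rho> p + v * \<rho>' p))"
    using f \<rho> by (auto intro!: continuous_intros)
  have "?I (\<lambda>p. f p * (u * \<rho> p + v * \<rho>' p)) = u * ?I (\<lambda>p. f p * \<rho> p) + v * ?I (\<lambda>p. f p * \<rho>' p)"
  proof -
    \<comment> \<open>Linearity is checked on the product measure, where one integrability statement
      per summand suffices; for the iterated integral it would have to be verified at both
      levels.\<close>
    let ?h = "\<lambda>h. \<lambda>(x, t). indicator M x * (indicator {0..T} t * h (t, x)) :: real"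
    let ?R = "rho0 M \<Otimes>\<^sub>M lborel"
    have "?h (\<lambda>p. f p * (u * \<rho> p + v * \<rho>' p)) = (\<lambda>p. u * ?h (\<lambda>p. f p * \<rho> p) p + v * ?h (\<lambda>p. f p * \<rho>' p) p)"
      by (auto simp: fun_eq_iff algebra_simps)
    then have "integral\<^sup>L ?R (?h (\<lambda>p. f p * (u * \<rho> p + v * \<rho>' p)))
        = u * integral\<^sup>L ?R (?h (\<lambda>p. f p * \<rho> p)) + v * integral\<^sup>L ?R (?h (\<lambda>p. f p * \<rho>' p))"
      using double_integral(1)[OF c(1) M] double_integral(1)[OF c(2) M] by simp
    then show ?thesis
      unfolding double_integral(2)[OF c(1) M] double_integral(2)[OF c(2) M] double_integral(2)[OF c(3) M] .
  qed
  moreover have "has_bochner_integral (convex_mix u v \<mu> \<nu>)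
      (\<lambda>z. LINT t:{0..T}|lborel. f (t, pi_x xbar (z t)) * (pi_r (z t))\<^sup>2)
      (u * ?I (\<lambda>p. f p * \<rho> p) + v * ?I (\<lambda>p. f p * \<rho>' p))"
    using wd f by (intro has_bochner_integral_convex_mix[OF uv s]) (auto simp: weak_density_def)
  ultimately show "has_bochner_integral (convex_mix u v \<mu> \<nu>)
      (\<lambda>z. LINT t:{0..T}|lborel. f (t, pi_x xbar (z t)) * (pi_r (z t))\<^sup>2)
      (?I (\<lambda>p. f p * (u * \<rho> p + v * \<rho>' p)))" by simp
qed

text \<open>The coupling fixes the measures \<open>h2\<close> at the endpoints, and the minimizer shows that they equal
  \<open>rho0 M\<close>.\<close>

lemma lipschitz_density_endpoints:
  fixes U M :: "'a::euclidean_space set"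
  assumes U: "open U" "bounded U" "U \<noteq> {}" "M = closure U" and T: "0 < T" and x: "xbar \<in> M"
    and \<mu>: "\<mu> \<in> path_prob T M" "coupling_constraint T M \<gamma> \<mu>" "weak_density T M xbar \<mu> (\<lambda>_. 1)"
      "action T xbar \<mu> < \<infinity>"
    and \<nu>: "\<nu> \<in> path_prob T M" "coupling_constraint T M \<gamma> \<nu>" "lipschitz_density T M xbar \<nu> \<rho>"
    and t: "t = 0 \<or> t = T" and y: "y \<in> M"
  shows "\<rho> (t, y) = 1"
proof -
  have M: "compact M" "bounded M" using U by (auto simp: compact_closure bounded_closure)
  have pr: "prob_space (rho0 M)" by (rule rho0_prob_space[OF U])
  interpret R: prob_space "rho0 M" by (rule pr)
  have tT: "t \<in> {0..T}" using t T by auto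
  have "integrable \<mu> (\<lambda>z. (pi_r (z 0))\<^sup>2)"
    using coupling_constraint_endpoints(1)[OF \<mu>(2) continuous_on_const M(1) x, of 1] by (simp add: has_bochner_integral_iff)
  then obtain W where W: "integrable \<mu> W" "\<And>z t. z \<in> space \<mu> \<Longrightarrow> t \<in> {0..T} \<Longrightarrow> (pi_r (z t))\<^sup>2 \<le> W z"
    using sup_pi_r_sq_integrable[OF \<mu>(1) T M(2) x \<mu>(4)] by blast
  have eq: "(LINT x:M|rho0 M. b x * \<rho> (t, x)) = (LINT x:M|rho0 M. b x)" if b: "continuous_on M b" for b
  proof -
    have "(\<integral>z. b (pi_x xbar (z t)) * (pi_r (z t))\<^sup>2 \<partial>\<nu>) = (\<integral>z. b (pi_x xbar (z t)) * (pi_r (z t))\<^sup>2 \<partial>\<mu>)"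
      using t coupling_constraint_endpoints[OF \<mu>(2) b M(1) x] coupling_constraint_endpoints[OF \<nu>(2) b M(1) x]
      by (auto simp: has_bochner_integral_iff)
    also have "\<dots> = (LINT x:M|rho0 M. b x)" by (rule weak_density_pointwise[OF \<mu>(1) T M(1) x pr \<mu>(3) W b tT])
    finally show ?thesis using lipschitz_density_integral(1)[OF \<nu>(1,3) tT M(1) x b] by simp
  qed
  \<comment> \<open>Testing the density with its own deviation from 1 makes the integral of the
    squared deviation vanish.\<close>
  define b where "b y = \<rho> (t, y) - 1" for y
  have "\<rho> \<in> C01 T M" using \<nu>(3) by (simp add: lipschitz_density_def)
  then have "continuous_on M (\<lambda>y. \<rho> (t, y))"
    by (intro continuous_on_compose2[OF C01_continuous_on]) (use tT in \<open>auto intro!: continuous_intros\<close>)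
  then have b: "continuous_on M b" unfolding b_def by (intro continuous_intros)
  have Mb: "M \<in> sets borel" using M(1) by (simp add: compact_imp_closed)
  have int: "set_integrable (rho0 M) M h" if h: "continuous_on M h" for h :: "'a \<Rightarrow> real"
  proof -
    obtain B where B: "0 \<le> B" "\<And>x. x \<in> M \<Longrightarrow> \<bar>h x\<bar> \<le> B" using continuous_on_compact_bounded[OF h M(1)] by blast
    have "(\<lambda>x. indicator M x *\<^sub>R h x) \<in> borel_measurable (rho0 M)"
      using borel_measurable_continuous_on_indicator[OF Mb h] by (simp add: measurable_cong_sets[OF sets_rho0 refl])
    then show ?thesis unfolding set_integrable_def
      by (rule R.integrable_const_bound[rotated, of _ B]) (use B in \<open>auto simp: indicator_def\<close>)
  qed
  have "continuous_on M (\<lambda>x. b x * \<rho> (t, x))" using b \<open>continuous_on M (\<lambda>y. \<rho> (t, y))\<close> by (intro continuous_intros)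
  then have "(LINT x:M|rho0 M. b x * \<rho> (t, x) - b x) = 0"
    using eq[OF b] int b by (subst set_integral_diff) auto
  then have "(LINT x:M|rho0 M. (b x)\<^sup>2) = 0" by (simp add: b_def power2_eq_square algebra_simps)
  moreover have "set_integrable (rho0 M) M (\<lambda>x. (b x)\<^sup>2)" using b by (intro int continuous_intros)
  ultimately have "AE x in rho0 M. indicator M x *\<^sub>R (b x)\<^sup>2 = 0"
    unfolding set_lebesgue_integral_def set_integrable_def
    by (subst (asm) integral_nonneg_eq_0_iff_AE) auto
  then have "AE x in rho0 M. x \<in> M \<longrightarrow> b x = 0" by eventually_elim (auto simp: indicator_def)
  from continuous_on_closure_zero_AE[OF U b this y] show ?thesis by (simp add: b_def)
qed

section \<open>The pressure as a subgradient of the optimal action\<close>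

theorem theorem5p3:
  fixes U M :: "'a::euclidean_space set"
    and T :: real and xbar :: 'a
    and \<gamma> :: "('a cone \<times> 'a cone) measure"
    and \<mu> :: "(real \<Rightarrow> 'a cone) measure"
  assumes "open U" "bounded U" "U \<noteq> {}" "lipschitz_boundary U"
    and "M = closure U" "0 < T" "xbar \<in> M"
    and "\<gamma> \<in> P2_cone M"
    and "geodesic_minimizer T M xbar \<gamma> \<mu>"
    and "action T xbar \<mu> < \<infinity>"
  shows "\<exists>P\<in>B0_dual T M. \<forall>\<nu>.
    gen_almost_diffeo T M xbar \<nu> \<and> coupling_constraint T M \<gamma> \<nu> \<longrightarrow>
      ereal (P (\<lambda>p. rho_of T M xbar \<nu> p - indicator ({0..T} \<times> M) p))
        \<le> enn2ereal (action T xbar \<nu>) - enn2ereal (action T xbar \<mu>)"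
proof -
  note U = assms(1-3) assms(5)
  note T = assms(6) and x = assms(7)
  have M: "compact M" "bounded M" "M \<noteq> {}" using U x by (auto simp: compact_closure bounded_closure)
  have pr: "prob_space (rho0 M)" by (rule rho0_prob_space[OF U])
  have \<mu>: "\<mu> \<in> path_prob T M" "coupling_constraint T M \<gamma> \<mu>" "weak_density T M xbar \<mu> (\<lambda>_. 1)"
    and min: "\<And>\<mu>'. admissible_plan T M xbar \<gamma> \<mu>' \<Longrightarrow> action T xbar \<mu> \<le> action T xbar \<mu>'"
    using assms(9) by (auto simp: geodesic_minimizer_def admissible_plan_def marginal_constraint_iff_weak_density)
  define a0 where "a0 = enn2real (action T xbar \<mu>)"
  have a0: "action T xbar \<mu> = ennreal a0" "0 \<le> a0" using assms(10) by (auto simp: a0_def less_top)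
  \<comment> \<open>The action bound for all scaled plans. The absolute value makes
    \<open>0 \<le> C\<close> evident without evaluating the integral.\<close>
  define C where "C = 7 * a0 + \<bar>LINT x:M|rho0 M. (LINT t:{0..T}|lborel. 1)\<bar>"
  \<comment> \<open>The heights are real, so infinite actions never enter. \<open>0 \<le> a\<close>
    is demanded because \<open>ennreal\<close> sends negative numbers to 0.\<close>
  define G where "G = {(\<sigma>, a). \<sigma> \<in> B0 T M \<and> 0 \<le> a \<and> (\<exists>\<nu>\<in>path_prob T M.
      coupling_constraint T M \<gamma> \<nu> \<and> weak_density T M xbar \<nu> (\<lambda>p. 1 + \<sigma> p) \<and> action T xbar \<nu> \<le> ennreal a)}"
  have B0C: "\<sigma> \<in> C01 T M" if "\<sigma> \<in> B0 T M" for \<sigma> using that by (simp add: B0_def)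
  have G_small: "(\<sigma>, C) \<in> G"
    if \<sigma>: "\<sigma> \<in> B0 T M" and b: "\<And>p. p \<in> {0..T} \<times> M \<Longrightarrow> \<bar>\<sigma> p\<bar> \<le> 1/2"
      and l: "\<And>p q. p \<in> {0..T} \<times> M \<Longrightarrow> q \<in> {0..T} \<times> M \<Longrightarrow> \<bar>\<sigma> p - \<sigma> q\<bar> \<le> dist p q / 2" for \<sigma>
  proof -
    interpret S: radial_scaling T M xbar "\<lambda>p. sqrt (1 + \<sigma> p)" by (rule sqrt_density_scaling[OF T M(2) x b l])
    let ?\<nu> = "S.scaled_plan \<mu>"
    have "coupling_constraint T M \<gamma> ?\<nu>" using \<sigma> by (intro S.scaled_plan_coupling[OF \<mu>(1,2)]) (auto simp: B0_def)
    moreover have "weak_density T M xbar ?\<nu> (\<lambda>p. 1 + \<sigma> p)"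
    proof (rule weak_density_cong[THEN iffD1, OF _ S.scaled_plan_weak_density[OF \<mu>(1,3)]])
      show "(sqrt (1 + \<sigma> p))\<^sup>2 = 1 + \<sigma> p" if "p \<in> {0..T} \<times> M" for p using b[OF that] by (auto simp: abs_le_iff)
    qed
    moreover have "action T xbar ?\<nu> \<le> ennreal C"
    proof -
      have "action T xbar ?\<nu> \<le> 7 * ennreal a0 + ennreal (LINT x:M|rho0 M. (LINT t:{0..T}|lborel. 1))"
        using S.scaled_plan_action_le[OF \<mu>(1,3)] by (simp add: a0)
      also have "\<dots> \<le> 7 * ennreal a0 + ennreal \<bar>LINT x:M|rho0 M. (LINT t:{0..T}|lborel. 1)\<bar>"
        by (intro add_left_mono ennreal_leI abs_ge_self)
      also have "\<dots> = ennreal C" using a0 by (simp add: C_def ennreal_plus ennreal_mult)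
      finally show ?thesis .
    qed
    moreover have "0 \<le> C" using a0 by (simp add: C_def)
    ultimately show ?thesis using \<sigma> S.scaled_plan_path_prob[OF \<mu>(1)] by (auto simp: G_def)
  qed
  \<comment> \<open>Any \<open>n\<close> strictly above the norm normalizes \<sigma> to size at most
    1/2; strictness avoids division by 0 when the norm is 0.\<close>
  have G_scaled: "((1 / (2 * n)) *\<^sub>R \<sigma>, C) \<in> G" if \<sigma>: "\<sigma> \<in> B0 T M" and n: "C01_norm T M \<sigma> < n" for \<sigma> n
  proof (rule G_small)
    note bounds = C01_norm_bounds[OF B0C[OF \<sigma>] M(1,3) less_imp_le[OF T]]
    have n0: "0 < n" using bounds(3) n by linarith
    show "(1 / (2 * n)) *\<^sub>R \<sigma> \<in> B0 T M" using \<sigma> by (intro subspace_scale[OF subspace_B0])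
    show "\<bar>((1 / (2 * n)) *\<^sub>R \<sigma>) p\<bar> \<le> 1/2" if "p \<in> {0..T} \<times> M" for p
      using bounds(1)[OF that] n n0 by (simp add: scaleR_fun_def abs_mult field_simps)
    show "\<bar>((1 / (2 * n)) *\<^sub>R \<sigma>) p - ((1 / (2 * n)) *\<^sub>R \<sigma>) q\<bar> \<le> dist p q / 2"
      if "p \<in> {0..T} \<times> M" "q \<in> {0..T} \<times> M" for p q
    proof -
      have "\<bar>\<sigma> p - \<sigma> q\<bar> \<le> C01_norm T M \<sigma> * dist p q" by (rule bounds(2)[OF that])
      also have "\<dots> \<le> n * dist p q" using n by (intro mult_right_mono) auto
      finally have "\<bar>\<sigma> p - \<sigma> q\<bar> / (2 * n) \<le> n * dist p q / (2 * n)" using n0 by (intro divide_right_mono) auto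
      moreover have "((1 / (2 * n)) *\<^sub>R \<sigma>) p - ((1 / (2 * n)) *\<^sub>R \<sigma>) q = (\<sigma> p - \<sigma> q) / (2 * n)"
        by (simp add: scaleR_fun_def diff_divide_distrib)
      ultimately show ?thesis using n0 by (simp add: abs_divide)
    qed
  qed
  obtain P where P: "\<And>\<sigma> \<tau>. \<sigma> \<in> B0 T M \<Longrightarrow> \<tau> \<in> B0 T M \<Longrightarrow> P (\<sigma> + \<tau>) = P \<sigma> + P \<tau>"
    "\<And>c \<sigma>. \<sigma> \<in> B0 T M \<Longrightarrow> P (c *\<^sub>R \<sigma>) = c * P \<sigma>" "\<And>\<sigma> a. (\<sigma>, a) \<in> G \<Longrightarrow> P \<sigma> \<le> a - a0"
  proof (rule convex_epigraph_subgradient[OF subspace_B0, of G T M a0])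
    show "\<sigma> \<in> B0 T M" if "(\<sigma>, a) \<in> G" for \<sigma> a using that by (simp add: G_def)
  next
    fix \<sigma> \<tau> and a b u v :: real
    assume g: "(\<sigma>, a) \<in> G" "(\<tau>, b) \<in> G" and uv: "0 < u" "0 < v" "u + v = 1"
    obtain \<nu>1 where 1: "\<nu>1 \<in> path_prob T M" "coupling_constraint T M \<gamma> \<nu>1"
      "weak_density T M xbar \<nu>1 (\<lambda>p. 1 + \<sigma> p)" "action T xbar \<nu>1 \<le> ennreal a" "\<sigma> \<in> B0 T M" "0 \<le> a"
      using g(1) by (auto simp: G_def)
    obtain \<nu>2 where 2: "\<nu>2 \<in> path_prob T M" "coupling_constraint T M \<gamma> \<nu>2"
      "weak_density T M xbar \<nu>2 (\<lambda>p. 1 + \<tau> p)" "action T xbar \<nu>2 \<le> ennreal b" "\<tau> \<in> B0 T M" "0 \<le> b"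
      using g(2) by (auto simp: G_def)
    have s: "sets \<nu>2 = sets \<nu>1" using 1(1) 2(1) by (simp add: path_prob_def)
    let ?\<nu> = "convex_mix u v \<nu>1 \<nu>2"
    have "?\<nu> \<in> path_prob T M"
      using 1(1) 2(1) prob_space_convex_mix[OF uv s] sets_convex_mix[OF uv s] by (auto simp: path_prob_def)
    moreover have "coupling_constraint T M \<gamma> ?\<nu>" by (rule coupling_constraint_convex_mix[OF uv s 1(2) 2(2)])
    moreover have "weak_density T M xbar ?\<nu> (\<lambda>p. 1 + (u *\<^sub>R \<sigma> + v *\<^sub>R \<tau>) p)"
    proof -
      have c: "continuous_on ({0..T} \<times> M) (\<lambda>p. 1 + \<sigma> p)" "continuous_on ({0..T} \<times> M) (\<lambda>p. 1 + \<tau> p)"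
        using C01_continuous_on[OF B0C[OF 1(5)]] C01_continuous_on[OF B0C[OF 2(5)]] by (auto intro!: continuous_intros)
      have "u * (1 + \<sigma> p) + v * (1 + \<tau> p) = 1 + (u *\<^sub>R \<sigma> + v *\<^sub>R \<tau>) p" for p
        using uv(3) by (simp add: scaleR_fun_def algebra_simps)
      with weak_density_convex_mix[OF uv s M(1) pr c 1(3) 2(3)] show ?thesis by simp
    qed
    moreover have "action T xbar ?\<nu> \<le> ennreal (u * a + v * b)"
    proof -
      have "action T xbar ?\<nu> \<le> ennreal u * action T xbar \<nu>1 + ennreal v * action T xbar \<nu>2"
        unfolding action_def by (rule nn_integral_convex_mix_le[OF uv s])
      also have "\<dots> \<le> ennreal u * ennreal a + ennreal v * ennreal b"
        using 1(4) 2(4) by (intro add_mono mult_left_mono) auto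
      also have "\<dots> = ennreal (u * a + v * b)" using uv 1(6) 2(6) by (simp add: ennreal_plus ennreal_mult)
      finally show ?thesis .
    qed
    moreover have "u *\<^sub>R \<sigma> + v *\<^sub>R \<tau> \<in> B0 T M"
      using 1(5) 2(5) by (intro subspace_add[OF subspace_B0] subspace_scale[OF subspace_B0])
    ultimately show "(u *\<^sub>R \<sigma> + v *\<^sub>R \<tau>, u * a + v * b) \<in> G" using uv 1(6) 2(6) by (auto simp: G_def)
  next
    fix \<sigma> assume \<sigma>: "\<sigma> \<in> B0 T M"
    have "0 \<le> C01_norm T M \<sigma>" using C01_norm_bounds(3)[OF B0C[OF \<sigma>] M(1,3)] T by simp
    then show "\<exists>s>0. \<exists>a. (s *\<^sub>R \<sigma>, a) \<in> G"
      using G_scaled[OF \<sigma>, of "C01_norm T M \<sigma> + 1"]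
      by (intro exI[of _ "1 / (2 * (C01_norm T M \<sigma> + 1))"]) auto
  next
    fix a assume "(0, a) \<in> G"
    then obtain \<nu> where \<nu>: "\<nu> \<in> path_prob T M" "coupling_constraint T M \<gamma> \<nu>"
      "weak_density T M xbar \<nu> (\<lambda>p. 1)" "action T xbar \<nu> \<le> ennreal a" "0 \<le> a"
      by (auto simp: G_def)
    then have "action T xbar \<mu> \<le> action T xbar \<nu>"
      \<comment> \<open>Over \<sigma> = 0 the averaged density is the marginal constraint, so the
        plan is a competitor of the minimizer.\<close>
      by (intro min) (simp add: admissible_plan_def marginal_constraint_iff_weak_density)
    then have "ennreal a0 \<le> ennreal a" using \<nu>(4) a0(1) by simp
    then show "a0 \<le> a" using \<nu>(5) by (simp add: ennreal_le_iff)
  qed (rule that)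
  have P_le: "P \<sigma> \<le> 2 * (C - a0) * C01_norm T M \<sigma>" if \<sigma>: "\<sigma> \<in> B0 T M" for \<sigma>
  proof -
    have nn: "0 \<le> C01_norm T M \<sigma>" using C01_norm_bounds(3)[OF B0C[OF \<sigma>] M(1,3)] T by simp
    have lt: "P \<sigma> \<le> 2 * (C - a0) * n" if n: "C01_norm T M \<sigma> < n" for n
    proof -
      have n0: "0 < n" using nn n by linarith
      have "P ((1 / (2 * n)) *\<^sub>R \<sigma>) \<le> C - a0" by (rule P(3)[OF G_scaled[OF \<sigma> n]])
      then show ?thesis using n0 by (simp add: P(2)[OF \<sigma>] field_simps)
    qed
    \<comment> \<open>Letting \<open>n\<close> decrease to the norm replaces \<open>n\<close> by the
      norm itself.\<close>
    have "((\<lambda>n. 2 * (C - a0) * n) \<longlongrightarrow> 2 * (C - a0) * C01_norm T M \<sigma>) (at_right (C01_norm T M \<sigma>))"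
      by (intro tendsto_intros)
    then show ?thesis
    proof (rule tendsto_lowerbound)
      show "\<forall>\<^sub>F n in at_right (C01_norm T M \<sigma>). P \<sigma> \<le> 2 * (C - a0) * n"
        by (rule eventually_mono[OF eventually_at_right_less]) (rule lt)
    qed simp
  qed
  have "P \<in> B0_dual T M"
    unfolding B0_dual_def mem_Collect_eq
  proof (intro conjI ballI allI exI[of _ "2 * (C - a0)"])
    show "P (\<lambda>p. f p + g p) = P f + P g" if "f \<in> B0 T M" "g \<in> B0 T M" for f g
      using P(1)[OF that] by (simp add: plus_fun_def)
    show "P (\<lambda>p. c * f p) = c * P f" if "f \<in> B0 T M" for c f
      using P(2)[OF that, of c] by (simp add: scaleR_fun_def)
    show "\<bar>P f\<bar> \<le> 2 * (C - a0) * C01_norm T M f" if f: "f \<in> B0 T M" for f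
    proof -
      \<comment> \<open>\<open>P_le\<close> is one-sided; applied to the negative of
        \<open>f\<close>, which has the same norm, it bounds the absolute value.\<close>
      have "(-1) *\<^sub>R f \<in> B0 T M" using f by (rule subspace_scale[OF subspace_B0])
      then have "P ((-1) *\<^sub>R f) \<le> 2 * (C - a0) * C01_norm T M ((-1) *\<^sub>R f)" by (rule P_le)
      moreover have "C01_norm T M ((-1) *\<^sub>R f) = C01_norm T M f"
        by (simp add: C01_norm_def scaleR_fun_def lipschitz_on_def dist_real_def abs_minus_commute)
      ultimately show ?thesis using P_le[OF f] P(2)[OF f, of "-1"] by simp
    qed
  qed
  moreover have "ereal (P (\<lambda>p. rho_of T M xbar \<nu> p - indicator ({0..T} \<times> M) p))
        \<le> enn2ereal (action T xbar \<nu>) - enn2ereal (action T xbar \<mu>)"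
    if g: "gen_almost_diffeo T M xbar \<nu>" and c: "coupling_constraint T M \<gamma> \<nu>" for \<nu>
  proof -
    define \<rho> where "\<rho> = rho_of T M xbar \<nu>"
    define \<sigma> where "\<sigma> p = \<rho> p - indicator ({0..T} \<times> M) p" for p
    have \<nu>: "\<nu> \<in> path_prob T M" using g by (simp add: gen_almost_diffeo_def)
    obtain \<rho>' where \<rho>': "lipschitz_density T M xbar \<nu> \<rho>'" using g by (auto simp: gen_almost_diffeo_def)
    then have ld: "lipschitz_density T M xbar \<nu> \<rho>"
      unfolding \<rho>_def rho_of_def
      by (rule theI[of "lipschitz_density T M xbar \<nu>"]) (rule lipschitz_density_unique[OF U _ \<rho>'])
    then have C\<rho>: "\<rho> \<in> C01 T M" by (simp add: lipschitz_density_def)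
    have "\<sigma> \<in> C01 T M"
    proof -
      obtain L where "L-lipschitz_on ({0..T} \<times> M) \<rho>" using C\<rho> by (auto simp: C01_def)
      then have "L-lipschitz_on ({0..T} \<times> M) \<sigma>" by (auto simp: lipschitz_on_def \<sigma>_def dist_real_def)
      then show ?thesis using C\<rho> by (auto simp: C01_def \<sigma>_def)
    qed
    moreover have "\<sigma> (t, y) = 0" if "t = 0 \<or> t = T" "y \<in> M" for t y
      using lipschitz_density_endpoints[OF U T x \<mu> assms(10) \<nu> c ld that] that T by (auto simp: \<sigma>_def)
    ultimately have \<sigma>: "\<sigma> \<in> B0 T M" by (simp add: B0_def)
    have wd: "weak_density T M xbar \<nu> (\<lambda>p. 1 + \<sigma> p)"
      using lipschitz_density_imp_weak_density[OF \<nu> ld M(1) x pr]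
      by (subst weak_density_cong[of T M _ \<rho>]) (auto simp: \<sigma>_def)
    show ?thesis
    proof (cases "action T xbar \<nu>")
      case (real a)
      then have "(\<sigma>, a) \<in> G" using \<sigma> \<nu> c wd by (auto simp: G_def)
      from P(3)[OF this] show ?thesis using real a0 by (simp add: \<sigma>_def[abs_def] \<rho>_def)
    next
      \<comment> \<open>The action of \<open>\<mu>\<close> is finite, so an infinite action of
        \<open>\<nu>\<close> makes the right-hand side infinite.\<close>
      case top
      then show ?thesis using a0 by simp
    qed
  qed
  ultimately show ?thesis by blast
qed

end
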